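(* There is a birational morphism between the generalized Cayley curve $\mathcal C_{\ell}$ and the Reid–Donagi–Knörrer curve $F_L$, with $L=\pi^{*-1}(\ell)$, defined by $$ j:\ \ell'\mapsto L',\qquad L'=\pi^{*-1}(\ell'), $$ where $\ell'$ is a line obtained from $\ell$ by the billiard reflection on a confocal quadric.
   Context: Consider in $\mathbf E^d$ the confocal family $\mathcal Q_{\lambda}:\ \sum_{i=1}^d \frac{x_i^2}{a_i-\lambda}=1$ ($a_1,\dots,a_d$ distinct reals). Let $\ell$ be a line tangent to the quadrics $\mathcal Q_{\alpha_1},\dots,\mathcal Q_{\alpha_{d-1}}$ of the family, and let $\mathcal A_{\ell}$ be the set of all lines tangent to the same $d-1$ quadrics. Two lines intersecting at a point $P$ of a quadric $\mathcal Q$ satisfy the billiard reflection law on $\mathcal Q$ if they are coplanar with the normal to $\mathcal Q$ at $P$ and make congruent angles with it. The generalized Cayley curve $\mathcal C_\ell$ is the variety of hyperplanes tangent to quadrics of the confocal family at the points of $\ell$. It is reinterpreted as the set of lines of $\mathcal A_\ell$ intersecting $\ell$: for almost every tangent hyperplane there is a unique line $\ell'$ obtained from $\ell$ by the billiard reflection at its point of tangency. Let $\mathcal Q^p_{\alpha_j}\subset\mathbf P^d$ be the projective closures of $\mathcal Q_{\alpha_j}$. In $\mathbf P^{2d-1}$ with homogeneous coordinates $(x,y)=(x_0,\dots,x_d,y_1,\dots,y_{d-1})$ let $V$ be the intersection of the two quadrics $$x_1^2+\dots+x_d^2-y_1^2-\dots-y_{d-1}^2=0,\qquad a_1x_1^2+\dots+a_dx_d^2-\alpha_1y_1^2-\dots-\alpha_{d-1}y_{d-1}^2=x_0^2.$$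 $F=F(V)$ is the set of all $(d-2)$-dimensional linear subspaces of $V$. For $L\in F$, $F_L$ is the closure in $F$ of $\{L'\in F\mid \dim L\cap L'=d-3\}$ (the Reid–Donagi–Knörrer curve). The projection $\pi':\mathbf P^{2d-1}\setminus\{(x,y)\mid x=0\}\to\mathbf P^d$, $\pi'(x,y)=x$, maps $L\in F(V)$ to a subspace $\pi'(L)$ of codimension $2$ tangent to the quadrics dual to $\mathcal Q^p_{\alpha_1},\dots,\mathcal Q^p_{\alpha_{d-1}}$; the space dual to $\pi'(L)$, denoted $\pi^*(L)$, is a line tangent to $\mathcal Q^p_{\alpha_1},\dots,\mathcal Q^p_{\alpha_{d-1}}$. *)

theory Defs
  imports "HOL-Analysis.Analysis"
begin

section \<open>Varieties in homogeneous coordinates\<close>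

text \<open>
  A point of \<open>P(\<complex>\<^sup>N)\<close>, a hyperplane, or more generally a linear subspace is an element of a type
  \<open>'p\<close>, and \<open>\<kappa> z\<close> is the set of all its homogeneous coordinate vectors, i.e. a line through the
  origin with the origin removed.  Linear subspaces of projective space are represented by the
  corresponding vector subspaces, so a projective dimension \<open>r\<close> is \<^const>\<open>vec.dim\<close> \<open>= r + 1\<close>.
\<close>

inductive hom_poly :: "nat \<Rightarrow> (complex ^ 'n::finite \<Rightarrow> complex) \<Rightarrow> bool" where
  const: "hom_poly 0 (\<lambda>_. c)"
| coord: "hom_poly 1 (\<lambda>u. u $ i)"
| add: "hom_poly e f \<Longrightarrow> hom_poly e g \<Longrightarrow> hom_poly e (\<lambda>u. f u + g u)"
| mult: "hom_poly e f \<Longrightarrow> hom_poly e' g \<Longrightarrow> hom_poly (e + e') (\<lambda>u. f u * g u)"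

text \<open>The Zariski topology on \<open>X\<close>, generated by the distinguished open sets.\<close>

definition zariski :: "('p \<Rightarrow> (complex ^ 'n::finite) set) \<Rightarrow> 'p set \<Rightarrow> 'p topology" where
  "zariski \<kappa> X =
     topology_generated_by {{z \<in> X. \<exists>u\<in>\<kappa> z. f u \<noteq> 0} | f. \<exists>e. hom_poly e f}"

definition open_dense :: "('p \<Rightarrow> (complex ^ 'n::finite) set) \<Rightarrow> 'p set \<Rightarrow> 'p set \<Rightarrow> bool" where
  "open_dense \<kappa> X U \<longleftrightarrow> openin (zariski \<kappa> X) U \<and> zariski \<kappa> X closure_of U = X"

text \<open>
  Since coordinate vectors are nonzero, the last condition below includes that the polynomials
  \<open>G\<close> have no common zero on the neighbourhood \<open>U\<close>.
\<close>

definition regular_map ::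
  "('p \<Rightarrow> (complex ^ 'n::finite) set) \<Rightarrow> ('q \<Rightarrow> (complex ^ 'k::finite) set)
     \<Rightarrow> 'p set \<Rightarrow> 'q set \<Rightarrow> ('p \<Rightarrow> 'q) \<Rightarrow> bool" where
  "regular_map \<kappa> \<mu> X Y f \<longleftrightarrow>
     f ` X \<subseteq> Y \<and>
     (\<forall>z\<in>X. \<exists>U e G. openin (zariski \<kappa> X) U \<and> z \<in> U \<and>
        (\<forall>k. hom_poly e (\<lambda>u. G u $ k)) \<and> (\<forall>w\<in>U. \<forall>u\<in>\<kappa> w. G u \<in> \<mu> (f w)))"

definition birational_morphism ::
  "('p \<Rightarrow> (complex ^ 'n::finite) set) \<Rightarrow> ('q \<Rightarrow> (complex ^ 'k::finite) set)
     \<Rightarrow> 'p set \<Rightarrow> 'q set \<Rightarrow> ('p \<Rightarrow> 'q) \<Rightarrow> bool" where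
  "birational_morphism \<kappa> \<mu> X Y f \<longleftrightarrow>
     regular_map \<kappa> \<mu> X Y f \<and>
     (\<exists>U W g. open_dense \<kappa> X U \<and> open_dense \<mu> Y W \<and>
        regular_map \<kappa> \<mu> U W f \<and> regular_map \<mu> \<kappa> W U g \<and>
        (\<forall>z\<in>U. g (f z) = z) \<and> (\<forall>w\<in>W. f (g w) = w))"

definition hyperplane_coords :: "(complex ^ 'n::finite) set \<Rightarrow> (complex ^ 'n) set" where
  "hyperplane_coords H = {u. u \<noteq> 0 \<and> H = {X. (\<Sum>k\<in>UNIV. u $ k * X $ k) = 0}}"

text \<open>
  Pluecker coordinates of a subspace of dimension \<open>CARD('m)\<close>: all maximal minors of the matrix of
  a basis.  Minors are indexed by arbitrary column tuples \<open>\<phi>\<close>; this repeats each classical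
  coordinate up to sign and adds zeros, which does not affect the embedding.
\<close>

definition pluecker_coords ::
  "(complex ^ ('i::finite + 'm::finite)) set \<Rightarrow> (complex ^ ('m \<Rightarrow> 'i + 'm)) set" where
  "pluecker_coords L =
     {(\<chi> \<phi>. det (\<chi> i j. b i $ \<phi> j)) | b :: 'm \<Rightarrow> complex ^ ('i + 'm).
        inj b \<and> vec.independent (range b) \<and> vec.span (range b) = L}"


section \<open>The confocal family and billiard reflection\<close>

text \<open>
  Homogeneous coordinates on \<open>P\<^sup>d\<close> are indexed by \<^typ>\<open>'d option\<close>, where \<open>None\<close> is the index of
  \<open>x\<^sub>0\<close> and \<open>d = CARD('d)\<close>.  Division by zero makes the next three definitions meaningless for
  \<open>\<mu> = a i\<close>; they are only used for other values of \<open>\<mu>\<close>.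
\<close>

definition conf_quadric :: "('d::finite \<Rightarrow> real) \<Rightarrow> complex \<Rightarrow> (complex ^ ('d option)) set" where
  "conf_quadric a \<mu> =
     {X. (\<Sum>i\<in>UNIV. (X $ Some i)\<^sup>2 / (of_real (a i) - \<mu>)) = (X $ None)\<^sup>2}"

definition tangent_hyperplane ::
  "('d::finite \<Rightarrow> real) \<Rightarrow> complex \<Rightarrow> complex ^ ('d option) \<Rightarrow> (complex ^ ('d option)) set" where
  "tangent_hyperplane a \<mu> P =
     {X. (\<Sum>i\<in>UNIV. P $ Some i * X $ Some i / (of_real (a i) - \<mu>)) = P $ None * X $ None}"

definition normal :: "('d::finite \<Rightarrow> real) \<Rightarrow> complex \<Rightarrow> complex ^ ('d option) \<Rightarrow> complex ^ 'd" where
  "normal a \<mu> P = (\<chi> i. P $ Some i / (of_real (a i) - \<mu>))"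

definition proj_closure :: "(real ^ 'd::finite) set \<Rightarrow> (complex ^ ('d option)) set" where
  "proj_closure l =
     vec.span ((\<lambda>x. \<chi> k. case k of None \<Rightarrow> 1 | Some i \<Rightarrow> complex_of_real (x $ i)) ` l)"

definition line_tangent_to ::
  "('d::finite \<Rightarrow> real) \<Rightarrow> complex \<Rightarrow> (complex ^ ('d option)) set \<Rightarrow> bool" where
  "line_tangent_to a \<mu> l \<longleftrightarrow>
     (\<exists>P\<in>l. P \<noteq> 0 \<and> P \<in> conf_quadric a \<mu> \<and> l \<subseteq> tangent_hyperplane a \<mu> P)"

text \<open>The complex bilinear (not Hermitian) extension of the Euclidean inner product.\<close>

definition bdot :: "complex ^ 'd::finite \<Rightarrow> complex ^ 'd \<Rightarrow> complex" where
  "bdot v w = (\<Sum>i\<in>UNIV. v $ i * w $ i)"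

definition directions :: "(complex ^ ('d::finite option)) set \<Rightarrow> (complex ^ 'd) set" where
  "directions l = {v. v \<noteq> 0 \<and> (\<chi> k. case k of None \<Rightarrow> 0 | Some i \<Rightarrow> v $ i) \<in> l}"

text \<open>Squared cosine of the angle between two lines with the given non-isotropic directions.\<close>

definition cos_sq :: "complex ^ 'd::finite \<Rightarrow> complex ^ 'd \<Rightarrow> complex" where
  "cos_sq v w = (bdot v w)\<^sup>2 / (bdot v v * bdot w w)"

definition billiard_law ::
  "('d::finite \<Rightarrow> real) \<Rightarrow> complex \<Rightarrow> complex ^ ('d option)
     \<Rightarrow> (complex ^ ('d option)) set \<Rightarrow> (complex ^ ('d option)) set \<Rightarrow> bool" where
  "billiard_law a \<mu> P l l' \<longleftrightarrow>
     P \<in> conf_quadric a \<mu> \<and> P $ None \<noteq> 0 \<and> P \<in> l \<and> P \<in> l' \<and>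
     (\<exists>v\<in>directions l. \<exists>w\<in>directions l'.
        bdot v v \<noteq> 0 \<and> bdot w w \<noteq> 0 \<and> bdot (normal a \<mu> P) (normal a \<mu> P) \<noteq> 0 \<and>
        vec.dim {v, w, normal a \<mu> P} \<le> 2 \<and>
        cos_sq v (normal a \<mu> P) = cos_sq w (normal a \<mu> P))"

text \<open>
  The line \<open>l'\<close> arises from \<open>l\<close> by reflection at the point \<open>P\<close> where the hyperplane \<open>H\<close> touches a
  confocal quadric.  A line always satisfies the angle condition together with itself, so
  \<open>l' \<noteq> l\<close> has to be required.
\<close>

definition billiard_reflection ::
  "('d::finite \<Rightarrow> real) \<Rightarrow> (complex ^ ('d option)) set
     \<Rightarrow> (complex ^ ('d option)) set \<Rightarrow> (complex ^ ('d option)) set \<Rightarrow> bool" where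
  "billiard_reflection a l H l' \<longleftrightarrow>
     vec.subspace l' \<and> vec.dim l' = 2 \<and> l' \<noteq> l \<and>
     (\<exists>\<mu> P. \<mu> \<notin> complex_of_real ` range a \<and> H = tangent_hyperplane a \<mu> P \<and>
        billiard_law a \<mu> P l l')"

definition cayley_curve ::
  "('d::finite \<Rightarrow> real) \<Rightarrow> (complex ^ ('d option)) set \<Rightarrow> (complex ^ ('d option)) set set" where
  "cayley_curve a l =
     zariski hyperplane_coords {H. vec.subspace H \<and> vec.dim H = CARD('d)} closure_of
       {tangent_hyperplane a \<mu> P | \<mu> P.
          \<mu> \<notin> complex_of_real ` range a \<and> P \<in> l \<and> P \<noteq> 0 \<and> P \<in> conf_quadric a \<mu>}"


section \<open>Linear subspaces of the intersection of two quadrics\<close>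

text \<open>
  Coordinates on \<open>P\<^sup>2\<^sup>d\<^sup>-\<^sup>1\<close> are indexed by \<^typ>\<open>'d option + 'm\<close> with \<open>CARD('m) = d - 1\<close>; \<open>Inl None\<close>,
  \<open>Inl (Some i)\<close> and \<open>Inr j\<close> are the indices of \<open>x\<^sub>0\<close>, \<open>x\<^sub>i\<close> and \<open>y\<^sub>j\<close>.
\<close>

definition V_cone ::
  "('d::finite \<Rightarrow> real) \<Rightarrow> ('m::finite \<Rightarrow> real) \<Rightarrow> (complex ^ ('d option + 'm)) set" where
  "V_cone a \<alpha> =
     {z. (\<Sum>i\<in>UNIV. (z $ Inl (Some i))\<^sup>2) - (\<Sum>j\<in>UNIV. (z $ Inr j)\<^sup>2) = 0 \<and>
         (\<Sum>i\<in>UNIV. of_real (a i) * (z $ Inl (Some i))\<^sup>2)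
           - (\<Sum>j\<in>UNIV. of_real (\<alpha> j) * (z $ Inr j)\<^sup>2) = (z $ Inl None)\<^sup>2}"

definition F_set ::
  "('d::finite \<Rightarrow> real) \<Rightarrow> ('m::finite \<Rightarrow> real) \<Rightarrow> (complex ^ ('d option + 'm)) set set" where
  "F_set a \<alpha> = {L. vec.subspace L \<and> vec.dim L + 1 = CARD('d) \<and> L \<subseteq> V_cone a \<alpha>}"

definition RDK_curve ::
  "('d::finite \<Rightarrow> real) \<Rightarrow> ('m::finite \<Rightarrow> real) \<Rightarrow> (complex ^ ('d option + 'm)) set
     \<Rightarrow> (complex ^ ('d option + 'm)) set set" where
  "RDK_curve a \<alpha> L =
     zariski pluecker_coords (F_set a \<alpha>) closure_of
       {L' \<in> F_set a \<alpha>. vec.dim (L \<inter> L') + 2 = CARD('d)}"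

definition pi' :: "(complex ^ ('d::finite option + 'm::finite)) set \<Rightarrow> (complex ^ ('d option)) set" where
  "pi' L = (\<lambda>z. \<chi> k. z $ Inl k) ` L"

definition pi_star :: "(complex ^ ('d::finite option + 'm::finite)) set \<Rightarrow> (complex ^ ('d option)) set" where
  "pi_star L = {X. \<forall>x\<in>pi' L. (\<Sum>k\<in>UNIV. x $ k * X $ k) = 0}"

end

theory Submission
  imports Defs "HOL-Computational_Algebra.Polynomial"
begin

text \<open>
  The space \<open>L\<close> is the graph of a linear map over the annihilator of the line. Let \<open>h\<close> be the
  coordinate vector of a hyperplane tangent to the quadric of parameter \<open>\<mu>\<close> at a point of the line.
  Then \<open>(h, 0)\<close> is isotropic for, and orthogonal to \<open>L\<close> under, the member of parameter \<open>\<mu>\<close> of the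
  pencil defining \<open>V\<close>. So \<open>V\<close> meets the span of \<open>L\<close> and \<open>(h, 0)\<close> in \<open>L\<close> and one further space of
  the same dimension. If \<open>h\<close> is not isotropic, this space is the image of \<open>L\<close> under the reflection
  in \<open>h\<close>, so it lies over the line obtained by billiard reflection. It depends polynomially on \<open>h\<close>
  even at the exceptional points, because the two forms of the pencil give proportional equations
  for it that never vanish simultaneously. Conversely, if \<open>L'\<close> meets \<open>L\<close> in codimension one, then
  \<open>L + L'\<close> contains exactly one point \<open>(h, 0)\<close>, and its coordinates are linear in the Pluecker
  coordinates of \<open>L'\<close>.

  The closures are compared through limits: every point of the algebraic curve cut out by
  proportionality of the two equations is a limit of tangent hyperplanes whose parameter avoids any
  given finite set.
\<close>

text \<open>The curve may be reducible, and density has to hold on every component, so exhibiting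
  one hyperplane with a well-defined billiard reflection proves too little. What is shown instead is
  that, for all but finitely many parameters, every tangent hyperplane of that parameter is
  nondegenerate (\<open>finite_bad\<close>). A norm over the double cover of the parameter line
  reduces this to a single parameter. Far below all \<open>a i\<close> the quadrics are real
  ellipsoids around a point of the line, and there positivity decides. Reality of the line enters a
  second time: its direction v has v . v \<noteq> 0, so no nonzero h can be isotropic for, and
  orthogonal to L under, both generators of the pencil (\<open>singular_zero\<close>). This makes L
  a graph over the y-coordinates and makes j defined at every point of the curve. The map j can take
  the value L itself, so its inverse is only constructed on the open set of spaces meeting L in
  codimension one.\<close>

lemma hom_poly_scale: "hom_poly e f \<Longrightarrow> f (c *s u) = c ^ e * f u"
  by (induction rule: hom_poly.induct) (auto simp: algebra_simps power_add)

lemma hom_poly_cmult: "hom_poly e f \<Longrightarrow> hom_poly e (\<lambda>u. c * f u)"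
  using hom_poly.mult[OF hom_poly.const[of c], of e f] by simp

lemma hom_poly_multc: "hom_poly e f \<Longrightarrow> hom_poly e (\<lambda>u. f u * c)"
  using hom_poly_cmult[of e f c] by (simp add: mult.commute)

lemma hom_poly_diff: "hom_poly e f \<Longrightarrow> hom_poly e g \<Longrightarrow> hom_poly e (\<lambda>u. f u - g u)"
  using hom_poly.add[of e f "\<lambda>u. (-1) * g u"] hom_poly_cmult[of e g "-1"] by simp

lemma hom_poly_power: "hom_poly e f \<Longrightarrow> hom_poly (n * e) (\<lambda>u. f u ^ n)"
proof (induction n)
  case 0 then show ?case using hom_poly.const[of 1] by simp
next
  case (Suc n) then show ?case using hom_poly.mult[of e f "n * e"] by simp
qed

lemma hom_poly_zero: "hom_poly e (\<lambda>_. 0)"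
  using hom_poly_cmult[OF hom_poly_power[OF hom_poly.coord, of e], of 0] by simp

lemma hom_poly_sum:
  "(\<And>x. x \<in> S \<Longrightarrow> hom_poly e (f x)) \<Longrightarrow> hom_poly e (\<lambda>u. \<Sum>x\<in>S. f x u)"
  by (induction S rule: infinite_finite_induct) (auto intro: hom_poly_zero hom_poly.add)

lemma hom_poly_prod:
  assumes "finite S" "\<And>x. x \<in> S \<Longrightarrow> hom_poly (e x) (f x)"
  shows "hom_poly (sum e S) (\<lambda>u. \<Prod>x\<in>S. f x u)"
  using assms
proof (induction S rule: finite_induct)
  case empty then show ?case using hom_poly.const[of 1] by simp
next
  case (insert x F) then show ?case using hom_poly.mult[of "e x" "f x"] by simp
qed

lemma hom_poly_compose:
  assumes "hom_poly e f" "\<And>k. hom_poly e' (\<lambda>u. G u $ k)"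
  shows "hom_poly (e * e') (\<lambda>u. f (G u))"
  using assms
proof (induction rule: hom_poly.induct)
  case (const c) then show ?case using hom_poly.const[of c] by simp
next
  case (mult e1 f e2 g)
  then show ?case using hom_poly.mult[of "e1 * e'" "\<lambda>u. f (G u)" "e2 * e'" "\<lambda>u. g (G u)"]
    by (simp add: algebra_simps)
qed (auto intro: hom_poly.intros)

text \<open>The degree may vary from row to row because in the family \<open>B2\<close> below one
  row has degree 2 and all others have degree 1.\<close>

lemma hom_poly_det:
  assumes "\<And>i j. hom_poly (e i) (\<lambda>u. M u i j)"
  shows "hom_poly (sum e UNIV) (\<lambda>u. det (\<chi> (i::'m::finite) j. M u i j))"
  unfolding det_def using assms
  by (auto intro!: hom_poly_sum hom_poly_cmult hom_poly_prod)

lemma hom_poly_continuous: "hom_poly e f \<Longrightarrow> continuous_on S f"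
  by (induction rule: hom_poly.induct) (auto intro!: continuous_intros)

lemma hom_poly_bdot: "(\<And>k. hom_poly e (\<lambda>u. G u $ k)) \<Longrightarrow> hom_poly e (\<lambda>u. bdot x (G u))"
  unfolding bdot_def by (auto intro!: hom_poly_sum hom_poly_cmult)

section \<open>The Zariski topology in terms of coordinate vectors\<close>

definition proj_coords :: "('p \<Rightarrow> (complex ^ 'n::finite) set) \<Rightarrow> bool" where
  "proj_coords \<kappa> \<longleftrightarrow> (\<forall>z. \<forall>u\<in>\<kappa> z. \<forall>u'\<in>\<kappa> z. \<exists>c. c \<noteq> 0 \<and> u' = c *s u)"

lemma proj_coords_nz:
  assumes "proj_coords \<kappa>" "hom_poly e f" "u \<in> \<kappa> z" "u' \<in> \<kappa> z" "f u \<noteq> 0"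
  shows "f u' \<noteq> 0"
proof -
  obtain c where "c \<noteq> 0" "u' = c *s u" using assms unfolding proj_coords_def by blast
  then show ?thesis using hom_poly_scale[OF assms(2)] assms(5) by auto
qed

lemma openin_zariski_basic:
  "hom_poly e f \<Longrightarrow> openin (zariski \<kappa> X) {z \<in> X. \<exists>u\<in>\<kappa> z. f u \<noteq> 0}"
  unfolding zariski_def by (rule topology_generated_by_Basis) auto

text \<open>The distinguished sets are given only as a subbasis. They form a basis because the
  product of two forms cuts out the intersection; this needs nonvanishing to be independent of the
  chosen coordinate vector.\<close>

lemma openin_zariski_nbhd:
  assumes \<kappa>: "proj_coords \<kappa>" and U: "openin (zariski \<kappa> X) U" "z \<in> U"
  shows "\<exists>e f. hom_poly e f \<and> (\<exists>u\<in>\<kappa> z. f u \<noteq> 0) \<and> {w \<in> X. \<exists>u\<in>\<kappa> w. f u \<noteq> 0} \<subseteq> U"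
proof -
  have "generate_topology_on {{z \<in> X. \<exists>u\<in>\<kappa> z. f u \<noteq> 0} | f. \<exists>e. hom_poly e f} U"
    using U(1) unfolding zariski_def openin_topology_generated_by_iff .
  then show ?thesis using U(2)
  proof (induction arbitrary: z)
    case (Int U V)
    from Int.IH(1)[of z] Int.prems obtain e f where f: "hom_poly e f" "\<exists>u\<in>\<kappa> z. f u \<noteq> 0"
      "{w \<in> X. \<exists>u\<in>\<kappa> w. f u \<noteq> 0} \<subseteq> U" by blast
    from Int.IH(2)[of z] Int.prems obtain e' g where g: "hom_poly e' g" "\<exists>u\<in>\<kappa> z. g u \<noteq> 0"
      "{w \<in> X. \<exists>u\<in>\<kappa> w. g u \<noteq> 0} \<subseteq> V" by blast
    have "\<exists>u\<in>\<kappa> z. f u * g u \<noteq> 0"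
      using f(2) g(2) proj_coords_nz[OF \<kappa> g(1)] by (metis mult_eq_0_iff)
    moreover have "{w \<in> X. \<exists>u\<in>\<kappa> w. f u * g u \<noteq> 0} \<subseteq> U \<inter> V" using f(3) g(3) by auto
    ultimately show ?case using hom_poly.mult[OF f(1) g(1)] by blast
  next
    case (UN K)
    then obtain k where k: "k \<in> K" "z \<in> k" by blast
    show ?case using UN.IH[OF k] k(1) by blast
  qed auto
qed

lemma openin_zariskiI:
  assumes "U \<subseteq> X"
    and "\<And>z. z \<in> U \<Longrightarrow> \<exists>e f. hom_poly e f \<and> (\<exists>u\<in>\<kappa> z. f u \<noteq> 0) \<and> {w \<in> X. \<exists>u\<in>\<kappa> w. f u \<noteq> 0} \<subseteq> U"
  shows "openin (zariski \<kappa> X) U"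
proof (subst openin_subopen, intro ballI)
  fix z assume z: "z \<in> U"
  then obtain e f where f: "hom_poly e f" "\<exists>u\<in>\<kappa> z. f u \<noteq> 0" "{w \<in> X. \<exists>u\<in>\<kappa> w. f u \<noteq> 0} \<subseteq> U"
    using assms(2) by blast
  then show "\<exists>T. openin (zariski \<kappa> X) T \<and> z \<in> T \<and> T \<subseteq> U"
    using openin_zariski_basic[OF f(1)] z assms(1) by blast
qed

text \<open>Turns closure into a statement about forms: every form that is nonzero at z is nonzero
  somewhere on S. All closures and densities below are handled through it. The clause on
  \<open>\<kappa> z\<close> appears because a point without coordinate vectors lies in no
  distinguished set, hence not in the space.\<close>

lemma zariski_closure_iff:
  assumes \<kappa>: "proj_coords \<kappa>"
  shows "z \<in> zariski \<kappa> X closure_of S \<longleftrightarrow> z \<in> X \<and> \<kappa> z \<noteq> {} \<and>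
    (\<forall>e f. hom_poly e f \<longrightarrow> (\<exists>u\<in>\<kappa> z. f u \<noteq> 0) \<longrightarrow> (\<exists>s\<in>S \<inter> X. \<exists>u\<in>\<kappa> s. f u \<noteq> 0))" (is "?l \<longleftrightarrow> ?r")
proof
  assume l: ?l
  have top: "z \<in> topspace (zariski \<kappa> X)" using l by (simp add: in_closure_of)
  then obtain e f where "hom_poly e f" "\<exists>u\<in>\<kappa> z. f u \<noteq> 0"
    using openin_zariski_nbhd[OF \<kappa> openin_topspace] by blast
  then have ne: "\<kappa> z \<noteq> {}" by blast
  have "topspace (zariski \<kappa> X) \<subseteq> X"
    unfolding zariski_def topology_generated_by_topspace by blast
  then have zX: "z \<in> X" using top by blast
  have "\<exists>s\<in>S \<inter> X. \<exists>u\<in>\<kappa> s. f u \<noteq> 0"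
    if f: "hom_poly e f" "\<exists>u\<in>\<kappa> z. f u \<noteq> 0" for e f
  proof -
    have "\<exists>y. y \<in> S \<and> y \<in> {z \<in> X. \<exists>u\<in>\<kappa> z. f u \<noteq> 0}"
      using l[unfolded in_closure_of, THEN conjunct2, rule_format, of "{z \<in> X. \<exists>u\<in>\<kappa> z. f u \<noteq> 0}"]
        openin_zariski_basic[OF f(1), of \<kappa> X] f(2) zX by fast
    then show ?thesis by blast
  qed
  then show ?r using ne zX by blast
next
  assume r: ?r
  \<comment> \<open>The constant form 1 places every point that has coordinates in the
    space.\<close>
  then have "z \<in> {z \<in> X. \<exists>u\<in>\<kappa> z. (1::complex) \<noteq> 0}" by auto
  then have "z \<in> topspace (zariski \<kappa> X)"
    using openin_subset[OF openin_zariski_basic[OF hom_poly.const[of 1], of \<kappa> X]] by blast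
  moreover have "\<exists>y. y \<in> S \<and> y \<in> T" if T: "z \<in> T" "openin (zariski \<kappa> X) T" for T
  proof -
    obtain e f where f: "hom_poly e f" "\<exists>u\<in>\<kappa> z. f u \<noteq> 0" "{w \<in> X. \<exists>u\<in>\<kappa> w. f u \<noteq> 0} \<subseteq> T"
      using openin_zariski_nbhd[OF \<kappa> T(2,1)] by blast
    then obtain s where "s \<in> S \<inter> X" "\<exists>u\<in>\<kappa> s. f u \<noteq> 0" using r by blast
    then show ?thesis using f(3) by blast
  qed
  ultimately show ?l unfolding in_closure_of by blast
qed

lemma open_denseI:
  assumes "proj_coords \<kappa>" "openin (zariski \<kappa> X) U" "U \<subseteq> X" "\<And>z. z \<in> X \<Longrightarrow> \<kappa> z \<noteq> {}"
    and "\<And>z u e f. z \<in> X \<Longrightarrow> u \<in> \<kappa> z \<Longrightarrow> hom_poly e f \<Longrightarrow> f u \<noteq> 0 \<Longrightarrow> \<exists>s\<in>U. \<exists>u\<in>\<kappa> s. f u \<noteq> 0"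
  shows "open_dense \<kappa> X U"
  unfolding open_dense_def
proof (intro conjI assms(2) set_eqI)
  fix z
  have "\<exists>s\<in>U \<inter> X. \<exists>u\<in>\<kappa> s. f u \<noteq> 0"
    if z: "z \<in> X" "hom_poly e f" "\<exists>u\<in>\<kappa> z. f u \<noteq> 0" for e f
  proof -
    obtain u where "u \<in> \<kappa> z" "f u \<noteq> 0" using z(3) by blast
    from assms(5)[OF z(1) this(1) z(2) this(2)] show ?thesis using assms(3) by blast
  qed
  then show "z \<in> zariski \<kappa> X closure_of U \<longleftrightarrow> z \<in> X"
    unfolding zariski_closure_iff[OF assms(1)] using assms(4)[of z] by blast
qed

lemma regular_mapI:
  assumes "f ` X \<subseteq> Y"
    and "\<And>z. z \<in> X \<Longrightarrow> \<exists>e' q e G. hom_poly e' q \<and> (\<exists>u\<in>\<kappa> z. q u \<noteq> 0) \<and> (\<forall>k. hom_poly e (\<lambda>u. G u $ k)) \<and>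
        (\<forall>w\<in>X. \<forall>u\<in>\<kappa> w. q u \<noteq> 0 \<longrightarrow> G u \<in> \<mu> (f w))"
    and \<kappa>: "proj_coords \<kappa>"
  shows "regular_map \<kappa> \<mu> X Y f"
  unfolding regular_map_def
proof (intro conjI ballI assms(1))
  fix z assume z: "z \<in> X"
  obtain e' q e G where *: "hom_poly e' q" "\<exists>u\<in>\<kappa> z. q u \<noteq> 0" "\<forall>k. hom_poly e (\<lambda>u. G u $ k)"
    "\<forall>w\<in>X. \<forall>u\<in>\<kappa> w. q u \<noteq> 0 \<longrightarrow> G u \<in> \<mu> (f w)"
    using assms(2)[OF z] by blast
  show "\<exists>U e G. openin (zariski \<kappa> X) U \<and> z \<in> U \<and>
        (\<forall>k. hom_poly e (\<lambda>u. G u $ k)) \<and> (\<forall>w\<in>U. \<forall>u\<in>\<kappa> w. G u \<in> \<mu> (f w))"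
  proof (intro exI[of _ "{w \<in> X. \<exists>u\<in>\<kappa> w. q u \<noteq> 0}"] exI[of _ e] exI[of _ G] conjI ballI)
    show "openin (zariski \<kappa> X) {w \<in> X. \<exists>u\<in>\<kappa> w. q u \<noteq> 0}" by (rule openin_zariski_basic[OF *(1)])
    show "z \<in> {w \<in> X. \<exists>u\<in>\<kappa> w. q u \<noteq> 0}" using z *(2) by blast
    show "\<forall>k. hom_poly e (\<lambda>u. G u $ k)" by fact
  next
    fix w u assume w: "w \<in> {w \<in> X. \<exists>u\<in>\<kappa> w. q u \<noteq> 0}" "u \<in> \<kappa> w"
    then obtain u' where "u' \<in> \<kappa> w" "q u' \<noteq> 0" by blast
    then have "q u \<noteq> 0" using proj_coords_nz[OF \<kappa> *(1) _ w(2)] by blast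
    then show "G u \<in> \<mu> (f w)" using *(4) w by blast
  qed
qed

section \<open>Bilinear algebra and Pluecker coordinates\<close>

lemma bdot_add_left: "bdot (x + y) z = bdot x z + bdot y z"
  unfolding bdot_def by (simp add: distrib_right sum.distrib)

lemma bdot_add_right: "bdot z (x + y) = bdot z x + bdot z y"
  unfolding bdot_def by (simp add: distrib_left sum.distrib)

lemma bdot_scale_left: "bdot (c *s x) z = c * bdot x z"
  unfolding bdot_def by (simp add: sum_distrib_left mult.assoc)

lemma bdot_scale_right: "bdot z (c *s x) = c * bdot z x"
  unfolding bdot_def by (simp add: sum_distrib_left mult.left_commute)

lemma bdot_zero_left: "bdot 0 z = 0"
  unfolding bdot_def by simp

lemma bdot_zero_right: "bdot z 0 = 0"
  unfolding bdot_def by simp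

lemma bdot_diff_left: "bdot (x - y) z = bdot x z - bdot y z"
  unfolding bdot_def by (simp add: left_diff_distrib sum_subtractf)

lemma bdot_diff_right: "bdot z (x - y) = bdot z x - bdot z y"
  unfolding bdot_def by (simp add: right_diff_distrib sum_subtractf)

lemmas bdot_simps = bdot_add_left bdot_add_right bdot_scale_left bdot_scale_right
  bdot_zero_left bdot_zero_right bdot_diff_left bdot_diff_right

lemma bdot_commute: "bdot x y = bdot y x"
  by (simp add: bdot_def mult.commute)

lemma bdot_axis: "bdot x (axis k 1) = x $ k" "bdot (axis k 1) x = x $ k"
  by (simp_all add: bdot_def axis_def if_distrib[of "\<lambda>y. _ * y"] if_distrib[of "\<lambda>y. y * _"] cong: if_cong)

lemma subspace_annihilator: "vec.subspace {X. bdot h X = 0}"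
  by (auto simp: vec.subspace_def bdot_simps)

lemma annihilator_subset_proportional:
  assumes h: "h \<noteq> 0" and sub: "{X. bdot h X = 0} \<subseteq> {X. bdot h' X = 0}"
  shows "\<exists>c. h' = c *s h"
proof -
  obtain k where k: "h $ k \<noteq> 0" using h by (auto simp: vec_eq_iff)
  have "h' $ i = (h' $ k / h $ k) * h $ i" for i
  proof -
    \<comment> \<open>For a fixed pivot k these vectors span the annihilator of h.\<close>
    have "bdot h (h $ k *s axis i 1 - h $ i *s axis k 1) = 0"
      by (simp add: bdot_simps bdot_axis)
    then have "bdot h' (h $ k *s axis i 1 - h $ i *s axis k 1) = 0" using sub by blast
    then show ?thesis using k by (simp add: bdot_simps bdot_axis field_simps)
  qed
  then show ?thesis unfolding vec_eq_iff vector_smult_component by blast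
qed

lemma dim_annihilator:
  fixes h :: "complex ^ 'n::finite"
  assumes "h \<noteq> 0"
  shows "vec.dim {X. bdot h X = 0} + 1 = CARD('n)"
proof -
  obtain k where k: "h $ k \<noteq> 0" using assms by (auto simp: vec_eq_iff)
  let ?H = "{X. bdot h X = 0}"
  have sp: "vec.span ?H = ?H" using subspace_annihilator by (metis vec.span_eq_iff)
  have "X \<in> vec.span (insert (axis k 1) ?H)" for X
  proof -
    have "X - (bdot h X / h $ k) *s axis k 1 \<in> vec.span ?H"
      unfolding sp using k by (simp add: bdot_simps bdot_axis)
    then show ?thesis unfolding vec.span_breakdown_eq by (rule exI)
  qed
  then have "vec.span (insert (axis k 1) ?H) = UNIV" by blast
  then have "vec.dim (insert (axis k 1) ?H) = CARD('n)"
    by (metis vec.dim_span vec_dim_card)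
  moreover have "axis k 1 \<notin> vec.span ?H" unfolding sp using k by (simp add: bdot_axis)
  ultimately show ?thesis by (simp add: vec.dim_insert)
qed

lemma hyperplane_coords_iff: "u \<in> hyperplane_coords H \<longleftrightarrow> u \<noteq> 0 \<and> H = {X. bdot u X = 0}"
  by (simp add: hyperplane_coords_def bdot_def)

lemma hyperplane_coords_annihilator:
  "h \<noteq> 0 \<Longrightarrow> h \<in> hyperplane_coords {X. bdot h X = 0}"
  by (simp add: hyperplane_coords_iff)

lemma proj_coords_hyperplane: "proj_coords hyperplane_coords"
  unfolding proj_coords_def
proof (intro allI ballI)
  fix H and u u' :: "complex ^ 'n::finite"
  assume "u \<in> hyperplane_coords H" "u' \<in> hyperplane_coords H"
  then have u: "u \<noteq> 0" "H = {X. bdot u X = 0}" "u' \<noteq> 0" "H = {X. bdot u' X = 0}"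
    by (simp_all add: hyperplane_coords_iff)
  then obtain c where "u' = c *s u"
    using annihilator_subset_proportional[of u u'] by auto
  moreover have "c \<noteq> 0" using calculation u(3) by auto
  ultimately show "\<exists>c. c \<noteq> 0 \<and> u' = c *s u" by blast
qed

section \<open>Indexed bases and Pluecker coordinates\<close>

lemma independent_family_iff:
  fixes b :: "'m::finite \<Rightarrow> complex ^ 'n::finite"
  shows "inj b \<and> vec.independent (range b) \<longleftrightarrow>
    (\<forall>c. (\<Sum>i\<in>UNIV. c i *s b i) = 0 \<longrightarrow> (\<forall>i. c i = 0))" (is "?l \<longleftrightarrow> ?r")
proof
  assume l: ?l
  show ?r
  proof (intro allI impI)
    fix c i assume c: "(\<Sum>i\<in>UNIV. c i *s b i) = 0"
    have inv: "inv b (b i) = i" for i using l by simp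
    have "(\<Sum>x\<in>range b. c (inv b x) *s x) = 0"
      using l c by (simp add: sum.reindex inv)
    then have "\<forall>x\<in>range b. c (inv b x) = 0"
      using l vec.independentD[of "range b" "range b" "\<lambda>x. c (inv b x)"] by auto
    then show "c i = 0" by (metis inv rangeI)
  qed
next
  assume r: ?r
  have inj: "inj b"
  proof (rule injI)
    fix i j assume bij: "b i = b j"
    show "i = j"
    proof (rule ccontr)
      assume "i \<noteq> j" note ij = bij this
      define c :: "'m \<Rightarrow> complex" where "c k = (if k = i then 1 else if k = j then -1 else 0)" for k
      have "(\<Sum>k\<in>UNIV. c k *s b k) = (\<Sum>k\<in>{i,j}. c k *s b k)"
        by (rule sum.mono_neutral_right) (auto simp: c_def)
      also have "\<dots> = 0" using ij by (simp add: c_def)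
      finally have "c i = 0" using r by blast
      then show False by (simp add: c_def)
    qed
  qed
  moreover have "vec.independent (range b)"
  proof
    assume "vec.dependent (range b)"
    then obtain u x where u: "x \<in> range b" "u x \<noteq> 0" "(\<Sum>x\<in>range b. u x *s x) = 0"
      using vec.dependent_finite[of "range b"] by auto
    then have "(\<Sum>i\<in>UNIV. u (b i) *s b i) = 0" using inj by (simp add: sum.reindex)
    then show False using r u by fastforce
  qed
  ultimately show ?l by blast
qed

lemma span_family:
  fixes b :: "'m::finite \<Rightarrow> complex ^ 'n::finite"
  shows "x \<in> vec.span (range b) \<longleftrightarrow> (\<exists>c. x = (\<Sum>i\<in>UNIV. c i *s b i))"
proof
  have "vec.subspace {x. \<exists>c. x = (\<Sum>i\<in>UNIV. c i *s b i)}"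
    unfolding vec.subspace_def
  proof (safe, goal_cases)
    case 1 show ?case by (rule exI[of _ "\<lambda>_. 0"]) simp
  next
    case (2 x y c d) show ?case
      by (rule exI[of _ "\<lambda>i. c i + d i"]) (simp add: vec.scale_left_distrib sum.distrib)
  next
    case (3 k y c) show ?case
      by (rule exI[of _ "\<lambda>i. k * c i"]) (simp add: vec.scale_sum_right vec_eq_iff mult.assoc)
  qed
  moreover have "range b \<subseteq> {x. \<exists>c. x = (\<Sum>i\<in>UNIV. c i *s b i)}"
  proof safe
    fix i
    have "(\<Sum>k\<in>UNIV. (if k = i then 1 else 0) *s b k) = b i"
      by (simp add: if_distrib[of "\<lambda>c. c *s _"] cong: if_cong)
    then show "\<exists>c. b i = (\<Sum>i\<in>UNIV. c i *s b i)" by metis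
  qed
  ultimately show "x \<in> vec.span (range b) \<Longrightarrow> \<exists>c. x = (\<Sum>i\<in>UNIV. c i *s b i)"
    using vec.span_minimal by blast
qed (blast intro: vec.span_sum vec.span_scale vec.span_base)

lemma pluecker_coordsI:
  assumes "\<And>c i. (\<Sum>i\<in>UNIV. c i *s b i) = 0 \<Longrightarrow> c i = 0" "vec.span (range b) = L"
  shows "(\<chi> \<phi>. det (\<chi> i j. b i $ \<phi> j)) \<in> pluecker_coords L"
  unfolding pluecker_coords_def using independent_family_iff[of b] assms by blast

lemma basis_family:
  fixes L :: "(complex ^ 'n::finite) set"
  assumes "vec.subspace L" "vec.dim L = CARD('m::finite)"
  shows "\<exists>b :: 'm \<Rightarrow> complex ^ 'n. inj b \<and> vec.independent (range b) \<and> vec.span (range b) = L"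
proof -
  obtain B where B: "B \<subseteq> L" "vec.independent B" "L \<subseteq> vec.span B" "card B = CARD('m)"
    using vec.basis_exists assms(2) by metis
  then have "finite B" using vec.finiteI_independent by blast
  then obtain b where b: "bij_betw b (UNIV :: 'm set) B"
    using B(4) finite_same_card_bij[of "UNIV :: 'm set" B] by auto
  then have "range b = B" "inj b" by (auto simp: bij_betw_def)
  moreover have "vec.span B = L" using B assms(1) by (metis vec.span_minimal subset_antisym)
  ultimately show ?thesis using B by auto
qed

lemma pluecker_coords_nonempty:
  fixes L :: "(complex ^ ('i::finite + 'm::finite)) set"
  assumes "vec.subspace L" "vec.dim L = CARD('m)"
  shows "pluecker_coords L \<noteq> {}"
  unfolding pluecker_coords_def using basis_family[OF assms] by blast

text \<open>Two bases of the same space differ by an invertible matrix, and its determinant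
  multiplies all maximal minors at once.\<close>

lemma proj_coords_pluecker: "proj_coords pluecker_coords"
  unfolding proj_coords_def
proof (intro allI ballI)
  fix L :: "(complex ^ ('i::finite + 'm::finite)) set" and u u'
  assume "u \<in> pluecker_coords L" "u' \<in> pluecker_coords L"
  then obtain b b' :: "'m \<Rightarrow> complex ^ ('i + 'm)" where
    b: "inj b" "vec.independent (range b)" "vec.span (range b) = L" "u = (\<chi> \<phi>. det (\<chi> i j. b i $ \<phi> j))" and
    b': "inj b'" "vec.independent (range b')" "vec.span (range b') = L" "u' = (\<chi> \<phi>. det (\<chi> i j. b' i $ \<phi> j))"
    unfolding pluecker_coords_def by blast
  have "\<forall>i. \<exists>c. b' i = (\<Sum>k\<in>UNIV. c k *s b k)" "\<forall>i. \<exists>c. b i = (\<Sum>k\<in>UNIV. c k *s b' k)"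
    unfolding span_family[symmetric]
    using b(3) b'(3) vec.span_base[of _ "range b"] vec.span_base[of _ "range b'"] by auto
  from choice[OF this(1)] choice[OF this(2)]
  obtain M M' where M: "\<And>i. b' i = (\<Sum>k\<in>UNIV. M i k *s b k)" and
    M': "\<And>i. b i = (\<Sum>k\<in>UNIV. M' i k *s b' k)" by blast
  have "(\<chi> i k. M' i k) ** (\<chi> i k. M i k) = mat 1"
  proof -
    have "(\<Sum>k\<in>UNIV. ((\<Sum>r\<in>UNIV. M' i r * M r k) - (if i = k then 1 else 0)) *s b k) = 0" for i
    proof -
      have "b i = (\<Sum>r\<in>UNIV. M' i r *s (\<Sum>k\<in>UNIV. M r k *s b k))"
        unfolding M[symmetric] by (rule M')
      also have "\<dots> = (\<Sum>k\<in>UNIV. (\<Sum>r\<in>UNIV. M' i r * M r k) *s b k)"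
        unfolding vec.scale_sum_right vec.scale_scale
        by (subst sum.swap) (simp add: vec.scale_sum_left)
      moreover have "(\<Sum>k\<in>UNIV. (if i = k then 1 else 0) *s b k) = b i"
        by (simp add: if_distrib[of "\<lambda>c. c *s _"] cong: if_cong)
      ultimately show ?thesis by (simp add: vec.scale_left_diff_distrib sum_subtractf)
    qed
    then have "(\<Sum>r\<in>UNIV. M' i r * M r k) - (if i = k then 1 else 0) = 0" for i k
      using conjI[OF b(1,2), unfolded independent_family_iff, rule_format,
        of "\<lambda>k. (\<Sum>r\<in>UNIV. M' i r * M r k) - (if i = k then 1 else 0)"] by blast
    then show ?thesis by (simp add: matrix_matrix_mult_def mat_def vec_eq_iff)
  qed
  then have "det (\<chi> i k. M' i k) * det (\<chi> i k. M i k) = 1" by (metis det_I det_mul)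
  then have "det (\<chi> i k. M i k) \<noteq> 0" by auto
  moreover have "u' = det (\<chi> i k. M i k) *s u"
  proof -
    have "(\<chi> i j. b' i $ \<phi> j) = (\<chi> i k. M i k) ** (\<chi> i j. b i $ \<phi> j)" for \<phi> :: "'m \<Rightarrow> 'i + 'm"
      by (simp add: matrix_matrix_mult_def vec_eq_iff M)
    then show ?thesis by (simp add: b(4) b'(4) vec_eq_iff det_mul)
  qed
  ultimately show "\<exists>c. c \<noteq> 0 \<and> u' = c *s u" by blast
qed

text \<open>The linear form on Pluecker coordinates attached to covectors \<open>\<rho> j\<close>,
  one for each column. As there is a coordinate for every column tuple, the coefficients need no
  antisymmetrisation.\<close>

definition pluecker_form :: "('m::finite \<Rightarrow> complex ^ ('i::finite + 'm)) \<Rightarrow> complex ^ ('m \<Rightarrow> 'i + 'm) \<Rightarrow> complex" where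
  "pluecker_form \<rho> u = (\<Sum>\<phi>\<in>UNIV. (\<Prod>j\<in>UNIV. \<rho> j $ \<phi> j) * u $ \<phi>)"

lemma hom_poly_pluecker_form: "hom_poly 1 (pluecker_form \<rho>)"
  unfolding pluecker_form_def[abs_def] by (intro hom_poly_sum hom_poly_cmult hom_poly.coord)

text \<open>Multilinearity of the determinant in its columns, each column being expanded in the
  coordinates of its covector. Conditions on determinants of a basis thereby become linear in the
  Pluecker coordinates.\<close>

lemma pluecker_form_eq:
  "pluecker_form \<rho> (\<chi> \<phi>. det (\<chi> i j. b i $ \<phi> j)) = det (\<chi> i j. bdot (\<rho> j) (b i))"
proof -
  have tr: "det (\<chi> j i. f i j) = det (\<chi> i j. f i j)" for f :: "'a \<Rightarrow> 'a \<Rightarrow> complex"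
    by (subst det_transpose[symmetric]) (simp add: transpose_def)
  have expand: "(\<Prod>j\<in>UNIV. \<Sum>r\<in>UNIV. f j r) = (\<Sum>\<phi>\<in>UNIV. \<Prod>j\<in>UNIV. f j (\<phi> j))"
    for f :: "'a \<Rightarrow> 'b + 'a \<Rightarrow> complex"
    using prod_sum_PiE[of "UNIV :: 'a set" "\<lambda>_. UNIV" f] by (simp add: PiE_UNIV_domain)
  have "det (\<chi> i j. bdot (\<rho> j) (b i)) = (\<Sum>p | p permutes (UNIV :: 'a set). of_int (sign p) *
      (\<Sum>\<phi>\<in>UNIV. \<Prod>j\<in>UNIV. \<rho> j $ \<phi> j * b (p j) $ \<phi> j))" (is "_ = ?m")
    unfolding tr[of "\<lambda>i j. bdot (\<rho> j) (b i)", symmetric]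
    by (simp only: det_def bdot_def vec_lambda_beta expand)
  moreover have "?m = pluecker_form \<rho> (\<chi> \<phi>. det (\<chi> i j. b i $ \<phi> j))"
  proof -
    have "pluecker_form \<rho> (\<chi> \<phi>. det (\<chi> i j. b i $ \<phi> j)) =
      (\<Sum>\<phi>\<in>UNIV. (\<Prod>j\<in>UNIV. \<rho> j $ \<phi> j) * det (\<chi> j i. b i $ \<phi> j))"
      by (simp add: pluecker_form_def tr[of "\<lambda>i j. b i $ _ j"])
    also have "\<dots> = (\<Sum>\<phi>\<in>UNIV. \<Sum>p | p permutes (UNIV :: 'a set). of_int (sign p) *
        (\<Prod>j\<in>UNIV. \<rho> j $ \<phi> j * b (p j) $ \<phi> j))"
      unfolding det_def by (simp add: sum_distrib_left prod.distrib algebra_simps)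
    also have "\<dots> = (\<Sum>p | p permutes (UNIV :: 'a set). \<Sum>\<phi>\<in>UNIV. of_int (sign p) *
        (\<Prod>j\<in>UNIV. \<rho> j $ \<phi> j * b (p j) $ \<phi> j))"
      by (rule sum.swap)
    finally show ?thesis by (simp only: sum_distrib_left)
  qed
  ultimately show ?thesis by simp
qed

section \<open>The section of \<open>L\<close> over the second factor\<close>

definition emb_pt :: "real ^ 'd::finite \<Rightarrow> complex ^ ('d option)" where
  "emb_pt x = (\<chi> k. case k of None \<Rightarrow> 1 | Some i \<Rightarrow> complex_of_real (x $ i))"

definition emb_dir :: "complex ^ 'd::finite \<Rightarrow> complex ^ ('d option)" where
  "emb_dir x = (\<chi> k. case k of None \<Rightarrow> 0 | Some i \<Rightarrow> x $ i)"

definition cvec :: "real ^ 'd::finite \<Rightarrow> complex ^ 'd" where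
  "cvec x = (\<chi> i. complex_of_real (x $ i))"

definition px :: "complex ^ ('i::finite + 'm::finite) \<Rightarrow> complex ^ 'i" where
  "px z = (\<chi> k. z $ Inl k)"

definition emb :: "complex ^ 'i::finite \<Rightarrow> complex ^ ('i + 'm::finite)" where
  "emb h = (\<chi> r. case r of Inl k \<Rightarrow> h $ k | Inr _ \<Rightarrow> 0)"

lemma px_nth [simp]: "px z $ k = z $ Inl k" by (simp add: px_def)
lemma emb_Inl [simp]: "emb h $ Inl k = h $ k" by (simp add: emb_def)
lemma emb_Inr [simp]: "emb h $ Inr j = 0" by (simp add: emb_def)
lemma emb_pt_nth [simp]: "emb_pt x $ None = 1" "emb_pt x $ Some i = complex_of_real (x $ i)"
  by (simp_all add: emb_pt_def)
lemma emb_dir_nth [simp]: "emb_dir w $ None = 0" "emb_dir w $ Some i = w $ i"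
  by (simp_all add: emb_dir_def)
lemma cvec_nth [simp]: "cvec x $ i = complex_of_real (x $ i)" by (simp add: cvec_def)

lemma px_linear: "px (x + y) = px x + px y" "px (c *s x) = c *s px x" "px 0 = 0" "px (x - y) = px x - px y"
  by (simp_all add: vec_eq_iff)

lemma px_emb [simp]: "px (emb h) = h" by (simp add: vec_eq_iff)

lemma vec_eq_sum_iff:
  fixes x y :: "complex ^ ('i::finite + 'm::finite)"
  shows "x = y \<longleftrightarrow> (\<forall>k. x $ Inl k = y $ Inl k) \<and> (\<forall>j. x $ Inr j = y $ Inr j)"
  unfolding vec_eq_iff using sum.exhaust by metis

lemma vec_eq_option_iff:
  fixes x y :: "complex ^ ('d::finite option)"
  shows "x = y \<longleftrightarrow> x $ None = y $ None \<and> (\<forall>i. x $ Some i = y $ Some i)"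
  unfolding vec_eq_iff using option.exhaust by metis

lemma sum_UNIV_option:
  fixes f :: "'d::finite option \<Rightarrow> 'b::comm_monoid_add"
  shows "(\<Sum>k\<in>UNIV. f k) = f None + (\<Sum>i\<in>UNIV. f (Some i))"
  by (simp add: UNIV_option_conv sum.reindex)

lemma bdot_option: "bdot x (y :: complex ^ ('d::finite option)) = x $ None * y $ None + (\<Sum>i\<in>UNIV. x $ Some i * y $ Some i)"
  by (simp add: bdot_def sum_UNIV_option)

lemma bdot_cvec: "bdot (cvec x) (cvec y) = complex_of_real (x \<bullet> y)"
  by (simp add: bdot_def inner_vec_def)

lemma bdot_eq_0_all: "(\<And>x. bdot x y = 0) \<Longrightarrow> y = 0"
  by (metis bdot_axis(2) vec_eq_iff zero_index)

text \<open>
  The pencil spanned by the two forms \<open>a\<^sub>1 x\<^sub>1\<^sup>2 + \<dots> + a\<^sub>d x\<^sub>d\<^sup>2 - x\<^sub>0\<^sup>2\<close> (for \<open>s = 1, t = 0\<close>) and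
  \<open>x\<^sub>1\<^sup>2 + \<dots> + x\<^sub>d\<^sup>2\<close> (for \<open>s = 0, t = 1\<close>); the dual of the confocal quadric of parameter \<open>\<mu>\<close>
  is the member \<open>s = 1, t = -\<mu>\<close>.
\<close>

definition wt :: "('d \<Rightarrow> real) \<Rightarrow> complex \<Rightarrow> complex \<Rightarrow> 'd option \<Rightarrow> complex" where
  "wt a s t k = (case k of None \<Rightarrow> - s | Some i \<Rightarrow> s * complex_of_real (a i) + t)"

definition polar :: "('d::finite \<Rightarrow> real) \<Rightarrow> complex \<Rightarrow> complex \<Rightarrow> complex ^ ('d option) \<Rightarrow> complex ^ ('d option)" where
  "polar a s t h = (\<chi> k. wt a s t k * h $ k)"

definition pen :: "('d::finite \<Rightarrow> real) \<Rightarrow> complex \<Rightarrow> complex \<Rightarrow> complex ^ ('d option) \<Rightarrow> complex ^ ('d option) \<Rightarrow> complex" where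
  "pen a s t x h = bdot x (polar a s t h)"

lemma polar_nth [simp]: "polar a s t h $ k = wt a s t k * h $ k" by (simp add: polar_def)

lemma wt_simps [simp]: "wt a s t None = - s" "wt a s t (Some i) = s * complex_of_real (a i) + t"
  by (simp_all add: wt_def)

lemma polar_linear: "polar a s t (x + y) = polar a s t x + polar a s t y"
  "polar a s t (c *s x) = c *s polar a s t x" "polar a s t 0 = 0"
  "polar a s t (x - y) = polar a s t x - polar a s t y"
  by (simp_all add: vec_eq_iff algebra_simps)

lemma pen_commute: "pen a s t x h = pen a s t h x"
  by (simp add: pen_def bdot_def mult_ac)

lemma pen_linear:
  "pen a s t (x + y) h = pen a s t x h + pen a s t y h"
  "pen a s t h (x + y) = pen a s t h x + pen a s t h y"
  "pen a s t (x - y) h = pen a s t x h - pen a s t y h"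
  "pen a s t h (x - y) = pen a s t h x - pen a s t h y"
  "pen a s t (c *s x) h = c * pen a s t x h"
  "pen a s t h (c *s x) = c * pen a s t h x"
  "pen a s t 0 h = 0" "pen a s t h 0 = 0"
  by (simp_all add: pen_def polar_linear bdot_simps)

lemma pen_split: "pen a s t x h = s * pen a 1 0 x h + t * pen a 0 1 x h"
proof -
  have "polar a s t h = s *s polar a 1 0 h + t *s polar a 0 1 h"
    by (simp add: vec_eq_option_iff algebra_simps)
  then show ?thesis by (simp add: pen_def bdot_simps)
qed

lemma pen_J: "pen a 0 1 x h = (\<Sum>i\<in>UNIV. x $ Some i * h $ Some i)"
  by (simp add: pen_def bdot_option)

lemma pen_A: "pen a 1 0 x h = (\<Sum>i\<in>UNIV. a i * (x $ Some i * h $ Some i)) - x $ None * h $ None"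
  by (simp add: pen_def bdot_option algebra_simps)

text \<open>The polar form of the pencil of quadrics through V; its members
  \<open>s = 0, t = 1\<close> and \<open>s = 1, t = 0\<close> are the two defining
  equations.\<close>

definition Qf :: "('d::finite \<Rightarrow> real) \<Rightarrow> ('m::finite \<Rightarrow> real) \<Rightarrow> complex \<Rightarrow> complex \<Rightarrow> complex ^ ('d option + 'm) \<Rightarrow> complex ^ ('d option + 'm) \<Rightarrow> complex" where
  "Qf a \<alpha> s t z z' = pen a s t (px z) (px z') - (\<Sum>j\<in>UNIV. (s * \<alpha> j + t) * (z $ Inr j * z' $ Inr j))"

lemma Qf_linear:
  "Qf a \<alpha> s t (x + y) h = Qf a \<alpha> s t x h + Qf a \<alpha> s t y h"
  "Qf a \<alpha> s t h (x + y) = Qf a \<alpha> s t h x + Qf a \<alpha> s t h y"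
  "Qf a \<alpha> s t (c *s x) h = c * Qf a \<alpha> s t x h"
  "Qf a \<alpha> s t h (c *s x) = c * Qf a \<alpha> s t h x"
  by (simp_all add: Qf_def pen_linear px_linear sum.distrib distrib_left distrib_right sum_distrib_left
      right_diff_distrib mult_ac)

lemma Qf_commute: "Qf a \<alpha> s t x y = Qf a \<alpha> s t y x"
  by (simp add: Qf_def pen_commute[of a s t "px x"] mult.commute)

lemma Qf_emb: "Qf a \<alpha> s t z (emb h) = pen a s t (px z) h"
  by (simp add: Qf_def)

lemma Qf_split: "Qf a \<alpha> s t x y = s * Qf a \<alpha> 1 0 x y + t * Qf a \<alpha> 0 1 x y"
  unfolding Qf_def pen_split[of a s t]
  by (simp add: algebra_simps sum.distrib sum_distrib_left)

lemma V_cone_iff: "z \<in> V_cone a \<alpha> \<longleftrightarrow> Qf a \<alpha> 0 1 z z = 0 \<and> Qf a \<alpha> 1 0 z z = 0"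
  by (auto simp: V_cone_def Qf_def pen_J pen_A power2_eq_square algebra_simps)

lemma isotropic_polarize:
  assumes "vec.subspace M" "M \<subseteq> V_cone a \<alpha>" "z \<in> M" "z' \<in> M"
  shows "Qf a \<alpha> s t z z' = 0"
proof -
  have "Qf a \<alpha> s t w w = 0" if "w \<in> M" for w
    using that assms(2) V_cone_iff[of w] Qf_split[of a \<alpha> s t w w] by auto
  from this[of z] this[of z'] this[of "z + z'"] show ?thesis
    using assms(1,3,4) Qf_commute[of a \<alpha> s t z' z] by (simp add: vec.subspace_add Qf_linear)
qed

text \<open>The line is given by a real point and a real direction; V, L and the reflected spaces
  are complex. Reality is used in \<open>norm_v\<close> and for the real quadrics in
  \<open>real_points\<close>.\<close>

locale confocal_line =
  fixes a :: "'d::finite \<Rightarrow> real" and \<alpha> :: "'m::finite \<Rightarrow> real"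
    and p v :: "real ^ 'd" and L :: "(complex ^ ('d option + 'm)) set"
  assumes card: "CARD('m) + 1 = CARD('d)"
    and inj_a: "inj a" and inj_\<alpha>: "inj \<alpha>" and \<alpha>_ne: "\<And>i j. \<alpha> j \<noteq> a i"
    and v: "v \<noteq> 0"
    and LF: "L \<in> F_set a \<alpha>"
    and star: "pi_star L = vec.span {emb_pt p, emb_dir (cvec v)}"
begin

abbreviation "e \<equiv> emb_pt p"
abbreviation "f \<equiv> emb_dir (cvec v)"
abbreviation "ell \<equiv> vec.span {e, f}"
abbreviation "penA \<equiv> pen a 1 0"
abbreviation "penJ \<equiv> pen a 0 1"
abbreviation "poles \<equiv> complex_of_real ` range a"

lemma subL: "vec.subspace L" and dimL: "vec.dim L = CARD('m)" and LV: "L \<subseteq> V_cone a \<alpha>"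
  using LF card by (auto simp: F_set_def)

lemma f_nz: "f \<noteq> 0"
  using v by (auto simp: vec_eq_option_iff vec_eq_iff)

lemma norm_v: "bdot (cvec v) (cvec v) \<noteq> 0"
  using v by (simp add: bdot_cvec)

lemma ell_iff: "X \<in> ell \<longleftrightarrow> (\<exists>\<sigma> \<tau>. X = \<sigma> *s e + \<tau> *s f)"
  unfolding vec.span_insert vec.span_singleton by (auto simp: algebra_simps)

lemma e_ell: "e \<in> ell" and f_ell: "f \<in> ell" and sub_ell: "vec.subspace ell"
  by (auto intro: vec.span_base)

lemma in_ell: "X \<in> ell \<longleftrightarrow> (\<forall>z\<in>L. bdot (px z) X = 0)"
  unfolding star[symmetric] by (auto simp: pi_star_def pi'_def bdot_def px_def)

lemma polar_in_ell: "polar a s t h \<in> ell \<longleftrightarrow> (\<forall>z\<in>L. pen a s t (px z) h = 0)"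
  by (simp add: in_ell pen_def)

lemmas scaleL = vec.subspace_scale[OF subL] and addL = vec.subspace_add[OF subL] and diffL = vec.subspace_diff[OF subL]
lemmas scale_ell = vec.subspace_scale[OF sub_ell] and add_ell = vec.subspace_add[OF sub_ell] and diff_ell = vec.subspace_diff[OF sub_ell]

lemma QL: "z \<in> L \<Longrightarrow> z' \<in> L \<Longrightarrow> Qf a \<alpha> s t z z' = 0"
  by (rule isotropic_polarize[OF subL LV])

lemma penL: "z \<in> L \<Longrightarrow> z' \<in> L \<Longrightarrow>
    pen a s t (px z) (px z') = (\<Sum>j\<in>UNIV. (s * \<alpha> j + t) * (z $ Inr j * z' $ Inr j))"
  using QL[of z z' s t] by (simp add: Qf_def)

lemma ell_infinity: "X \<in> ell \<Longrightarrow> X $ None = 0 \<Longrightarrow> \<exists>\<tau>. X = \<tau> *s f"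
  by (auto simp: ell_iff)

text \<open>The polar of h under the form with \<open>s = 0\<close> has no \<open>None\<close>
  component, so it is a multiple of the direction of the line. That direction is not isotropic, so
  isotropy kills the affine part of h, and the other form then kills the remaining
  coordinate.\<close>

lemma singular_zero:
  assumes J: "polar a 0 1 h \<in> ell" "penJ h h = 0" and A: "penA h h = 0"
  shows "h = 0"
proof -
  obtain \<tau> where \<tau>: "polar a 0 1 h = \<tau> *s f" using ell_infinity[OF J(1)] by auto
  then have h: "h $ Some i = \<tau> * v $ i" for i
    by (auto simp: vec_eq_option_iff)
  have "\<tau>\<^sup>2 * bdot (cvec v) (cvec v) = penJ h h"
    by (simp add: pen_J h bdot_def sum_distrib_left power2_eq_square mult_ac)
  then have "\<tau> = 0" using J(2) norm_v by auto
  then have "h $ Some i = 0" for i using h by simp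
  then show ?thesis using A by (simp add: pen_A vec_eq_option_iff)
qed

text \<open>An element with y = 0 would be isotropic for, and orthogonal to L under, the whole
  pencil. Hence L is a graph over the y-coordinates.\<close>

lemma py_inj:
  assumes z: "z \<in> L" "\<And>j. z $ Inr j = 0"
  shows "z = 0"
proof -
  have 0: "pen a s t (px z') (px z) = 0" if "z' \<in> L" for s t z'
    using penL[OF that z(1)] z(2) by simp
  then have "px z = 0"
    using z(1) by (intro singular_zero) (auto simp: polar_in_ell)
  then show ?thesis using z(2) unfolding vec_eq_sum_iff by (metis px_nth zero_index)
qed

lemma ex_section: "\<exists>S :: 'm \<Rightarrow> complex ^ ('d option + 'm).
    \<forall>j. S j \<in> L \<and> (\<forall>j'. S j $ Inr j' = (if j' = j then 1 else 0))"
proof -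
  obtain b :: "'m \<Rightarrow> complex ^ ('d option + 'm)" where
    b: "inj b" "vec.independent (range b)" "vec.span (range b) = L"
    using basis_family[OF subL dimL] by blast
  define T :: "complex ^ 'm \<Rightarrow> complex ^ 'm" where "T c = (\<chi> j. \<Sum>i\<in>UNIV. c $ i * b i $ Inr j)" for c
  have cL: "(\<Sum>i\<in>UNIV. c i *s b i) \<in> L" for c
    using span_family[of _ b] b(3) by blast
  have lin: "Vector_Spaces.linear (*s) (*s) T"
    by unfold_locales (auto simp: T_def vec_eq_iff algebra_simps sum.distrib sum_distrib_left)
  have "c = 0" if "T c = 0" for c
  proof -
    have "(\<Sum>i\<in>UNIV. c $ i *s b i) = 0"
      using that by (intro py_inj[OF cL]) (simp add: T_def vec_eq_iff)
    then have "c $ i = 0" for i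
      using independent_family_iff[of b] b(1,2) by blast
    then show ?thesis by (simp add: vec_eq_iff)
  qed
  then have "inj T" using vec.linear_inj_iff_eq_0[OF lin] by blast
  then have "surj T" using vec.linear_inj_imp_surj[OF lin] by blast
  have "\<exists>z. z \<in> L \<and> (\<forall>j'. z $ Inr j' = (if j' = j then 1 else 0))" for j
  proof -
    obtain c where "T c = axis j 1" using \<open>surj T\<close> by (metis surjD)
    then show ?thesis
      by (intro exI[of _ "\<Sum>i\<in>UNIV. c $ i *s b i"]) (auto simp: cL T_def vec_eq_iff axis_def)
  qed
  then show ?thesis by metis
qed

text \<open>The basis of L dual to the y-coordinates: coefficients with respect to it are read off
  as y-coordinates.\<close>

definition S :: "'m \<Rightarrow> complex ^ ('d option + 'm)" where
  "S = (SOME S. \<forall>j. S j \<in> L \<and> (\<forall>j'. S j $ Inr j' = (if j' = j then 1 else 0)))"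

lemma S_L: "S j \<in> L" and S_Inr: "S j $ Inr j' = (if j' = j then 1 else 0)"
  using someI_ex[OF ex_section] unfolding S_def by auto

lemma comb_L: "(\<Sum>j\<in>UNIV. c j *s S j) \<in> L"
  by (intro vec.subspace_sum[OF subL] scaleL S_L)

lemma comb_Inr: "(\<Sum>j\<in>UNIV. c j *s S j) $ Inr j' = c j'"
  by (simp add: S_Inr if_distrib[of "\<lambda>x. _ * x"] cong: if_cong)

lemma L_expand: "z \<in> L \<Longrightarrow> z = (\<Sum>j\<in>UNIV. z $ Inr j *s S j)"
proof -
  assume z: "z \<in> L"
  have "z - (\<Sum>j\<in>UNIV. z $ Inr j *s S j) = 0"
    by (intro py_inj vec.subspace_diff[OF subL z] comb_L)
      (simp only: vector_minus_component comb_Inr diff_self)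
  then show ?thesis unfolding right_minus_eq .
qed

lemma dot_zero_all_L:
  assumes "\<And>z'. z' \<in> L \<Longrightarrow> (\<Sum>j\<in>UNIV. c j * (z' $ Inr j * y j)) = 0"
  shows "c j * y j = 0"
proof -
  have "(\<Sum>j'\<in>UNIV. c j' * (S j $ Inr j' * y j')) = (\<Sum>j'\<in>UNIV. if j' = j then c j * y j else 0)"
    by (intro sum.cong) (auto simp: S_Inr)
  then show ?thesis using assms[OF S_L[of j]] by simp
qed

text \<open>For \<open>s = 0, t = 1\<close> all y-weights are 1, so on L this form is the standard
  one in y, which is nondegenerate.\<close>

lemma px_inj:
  assumes z: "z \<in> L" "px z = 0"
  shows "z = 0"
proof (rule py_inj[OF z(1)])
  fix j
  have "1 * z $ Inr j = 0"
    using penL[OF _ z(1), of _ 0 1] z(2) by (intro dot_zero_all_L) (simp add: pen_linear)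
  then show "z $ Inr j = 0" by simp
qed

lemma dim_pxL: "vec.dim (px ` L) = CARD('m)" and sub_pxL: "vec.subspace (px ` L)"
proof -
  have sum_px: "px (\<Sum>i\<in>UNIV. c i *s S i) = (\<Sum>i\<in>UNIV. c i *s px (S i))" for c
    by (simp add: vec_eq_iff)
  have span: "vec.span (range (\<lambda>j. px (S j))) = px ` L"
  proof (rule set_eqI)
    fix x
    have "(\<exists>c. x = px (\<Sum>i\<in>UNIV. c i *s S i)) \<longleftrightarrow> x \<in> px ` L"
    proof
      assume "x \<in> px ` L"
      then obtain z where z: "z \<in> L" "x = px z" by blast
      show "\<exists>c. x = px (\<Sum>i\<in>UNIV. c i *s S i)"
        by (rule exI[of _ "\<lambda>i. z $ Inr i"]) (simp only: z(2) flip: L_expand[OF z(1)])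
    qed (auto intro: comb_L)
    then show "x \<in> vec.span (range (\<lambda>j. px (S j))) \<longleftrightarrow> x \<in> px ` L"
      by (simp only: span_family sum_px)
  qed
  then show "vec.subspace (px ` L)" by (metis vec.subspace_span)
  have "c i = 0" if "(\<Sum>i\<in>UNIV. c i *s px (S i)) = 0" for c i
    using px_inj[OF comb_L, of c] comb_Inr[of c i] that by (simp add: sum_px)
  then have "inj (\<lambda>j. px (S j))" "vec.independent (range (\<lambda>j. px (S j)))"
    using independent_family_iff[of "\<lambda>j. px (S j)"] by blast+
  then show "vec.dim (px ` L) = CARD('m)"
    using vec.dim_span_eq_card_independent by (metis span card_image)
qed

text \<open>A degenerate member of the pencil has a radical of dimension one only, because the
  \<open>a i\<close> are distinct; it is the member at infinity (\<open>s = 0\<close>) or the one of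
  parameter \<open>a i\<close>.\<close>

lemma wt_zero_unique:
  assumes "wt a s t k = 0" "wt a s t k' = 0" "(s, t) \<noteq> (0, 0)"
  shows "k = k'"
  using assms inj_a by (cases k; cases k') (auto simp: inj_eq wt_def add_eq_0_iff)

text \<open>Where an x-weight vanishes no y-weight does, by \<open>\<alpha>_ne\<close>. So a
  degenerate member still restricts to a nondegenerate form on L.\<close>

lemma wt_zero_\<alpha>:
  assumes "wt a s t k = 0" "(s, t) \<noteq> (0, 0)"
  shows "s * \<alpha> j + t \<noteq> 0"
proof (cases k)
  case (Some i)
  then have *: "s * a i + t = 0" using assms(1) by simp
  show ?thesis
  proof
    assume "s * \<alpha> j + t = 0"
    then have "s * complex_of_real (\<alpha> j) = s * complex_of_real (a i)" using * by (metis add_right_cancel)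
    then have "s = 0" using \<alpha>_ne[of j i] by simp
    then show False using \<alpha>_ne[of j i] * assms(2) by auto
  qed
qed (use assms in auto)

lemma span_full:
  fixes B :: "(complex ^ ('d option)) set"
  assumes "vec.dim B = CARD('d) + 1" "\<And>x. x \<in> B \<Longrightarrow> bdot x y = 0"
  shows "y = 0"
proof -
  have "vec.span B = UNIV"
    using assms(1) vec_dim_card[where 'a=complex and 'n="'d option"]
    by (intro vec.subspace_dim_equal) (simp_all add: card_UNIV_option del: vec.dim_UNIV)
  moreover have "vec.span B \<subseteq> {x. bdot y x = 0}"
    using assms(2) by (intro vec.span_minimal subspace_annihilator) (auto simp: bdot_commute[of y])
  ultimately have "bdot x y = 0" for x by (auto simp: bdot_commute[of y])
  then show ?thesis by (rule bdot_eq_0_all)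
qed

text \<open>
  Otherwise \<open>px ` L\<close>, \<open>h\<close> and the radical of the form would span the whole space, all of it
  orthogonal to \<open>h\<close>.
\<close>

lemma degenerate_axis:
  assumes st: "(s, t) \<noteq> (0, 0)" and k: "wt a s t k = 0"
    and h: "polar a s t h \<in> ell" "pen a s t h h = 0"
  shows "\<exists>c. h = c *s axis k 1"
proof (rule ccontr)
  assume no: "\<not> (\<exists>c. h = c *s axis k 1)"
  have nz: "s * \<alpha> j + t \<noteq> 0" for j using wt_zero_\<alpha>[OF k st] .
  \<comment> \<open>On L the form is diagonal in y with the nonzero weights
    \<open>s * \<alpha> j + t\<close>, hence nondegenerate.\<close>
  have kill: "x = 0" if x: "x \<in> px ` L" "\<And>z'. z' \<in> L \<Longrightarrow> pen a s t (px z') x = 0" for x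
  proof -
    obtain z where z: "z \<in> L" "x = px z" using x(1) by blast
    have "(s * \<alpha> j + t) * z $ Inr j = 0" for j
      using penL[OF _ z(1), of _ s t] x(2) z(2) by (intro dot_zero_all_L) simp
    then have "z = 0" using nz py_inj[OF z(1)] by auto
    then show ?thesis using z(2) by (simp add: px_linear)
  qed
  have ax0: "polar a s t (axis k 1) = 0" using k by (auto simp: vec_eq_iff axis_def)
  have h0: "pen a s t (px z') h = 0" if "z' \<in> L" for z' using h(1) that polar_in_ell by blast
  have "h \<notin> vec.span (px ` L)"
  proof
    assume "h \<in> vec.span (px ` L)"
    then have "h \<in> px ` L" using sub_pxL by (metis vec.span_eq_iff)
    then have "h = 0" using kill h0 by blast
    then show False using no by (metis vec.scale_zero_left)
  qed
  moreover have "axis k 1 \<notin> vec.span (insert h (px ` L))"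
  proof
    assume "axis k 1 \<in> vec.span (insert h (px ` L))"
    then obtain c where "axis k 1 - c *s h \<in> vec.span (px ` L)"
      unfolding vec.span_breakdown_eq by blast
    then have c: "axis k 1 - c *s h \<in> px ` L" using sub_pxL by (metis vec.span_eq_iff)
    have "axis k 1 - c *s h = 0"
      by (rule kill[OF c]) (use h0 ax0 in \<open>simp add: pen_linear pen_def[of a s t _ "axis k 1"] bdot_simps\<close>)
    then have eq: "axis k 1 = c *s h" by simp
    then have "c \<noteq> 0" by (metis axis_eq_0_iff vec.scale_zero_left zero_neq_one)
    then have "h = (1 / c) *s axis k 1" using eq by simp
    then show False using no by blast
  qed
  ultimately have "vec.dim (insert (axis k 1) (insert h (px ` L))) = CARD('d) + 1"
    using dim_pxL card by (simp add: vec.dim_insert)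
  then have "polar a s t h = 0"
  proof (rule span_full)
    fix x assume "x \<in> insert (axis k 1) (insert h (px ` L))"
    then show "bdot x (polar a s t h) = 0"
      using h(2) h0 pen_commute[of a s t "axis k 1" h] ax0
      by (auto simp: pen_def[symmetric]) (simp add: pen_def bdot_simps)
  qed
  then have "wt a s t k' * h $ k' = 0" for k' by (simp add: vec_eq_iff)
  then have "h $ k' = 0" if "k' \<noteq> k" for k' using wt_zero_unique[OF k _ st] that by (metis mult_eq_0_iff)
  then have "h = h $ k *s axis k 1" by (simp add: vec_eq_iff axis_def)
  then show False using no by blast
qed

text \<open>Coordinates of the polar hyperplane of X with respect to the quadric of parameter \<mu>,
  inverse to \<open>polar a 1 (- \<mu>)\<close> away from the poles. The weight -1 at
  \<open>None\<close> produces the minus sign in the tangent equation.\<close>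

definition hP :: "complex \<Rightarrow> complex ^ ('d option) \<Rightarrow> complex ^ ('d option)" where
  "hP \<mu> X = (\<chi> k. X $ k / wt a 1 (- \<mu>) k)"

lemma wt_regular: "\<mu> \<notin> poles \<Longrightarrow> wt a 1 (- \<mu>) k \<noteq> 0"
  by (cases k) auto

lemma polar_hP: "\<mu> \<notin> poles \<Longrightarrow> polar a 1 (- \<mu>) (hP \<mu> X) = X"
  by (simp add: vec_eq_iff hP_def wt_regular)

lemma hP_polar: "\<mu> \<notin> poles \<Longrightarrow> hP \<mu> (polar a 1 (- \<mu>) h) = h"
  by (simp add: vec_eq_iff hP_def wt_regular)

lemma hP_linear: "hP \<mu> (x + y) = hP \<mu> x + hP \<mu> y" "hP \<mu> (c *s x) = c *s hP \<mu> x"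
  by (simp_all add: vec_eq_iff hP_def add_divide_distrib)

lemma bdot_hP_commute: "bdot x (hP \<mu> y) = bdot y (hP \<mu> x)"
  by (simp add: bdot_def hP_def mult_ac)

lemma conf_quadric_iff: "X \<in> conf_quadric a \<mu> \<longleftrightarrow> bdot X (hP \<mu> X) = 0"
  by (auto simp: conf_quadric_def bdot_option hP_def power2_eq_square)

lemma tangent_hyperplane_eq: "tangent_hyperplane a \<mu> P = {X. bdot (hP \<mu> P) X = 0}"
  by (auto simp: tangent_hyperplane_def bdot_option hP_def)

text \<open>On such a quadric, polarity would carry the line into its own annihilator, which by
  dimension is the image of L under \<open>px\<close>. Preimages in L have y-coordinates supported
  where \<open>\<alpha> j\<close> equals \<mu>, which is at most one index, while the line has two
  independent points.\<close>

lemma ell_not_in_quadric: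
  assumes \<mu>: "\<mu> \<notin> poles"
  shows "\<exists>X\<in>ell. bdot X (hP \<mu> X) \<noteq> 0"
proof (rule ccontr)
  assume "\<not> ?thesis"
  then have iso: "bdot X (hP \<mu> X) = 0" if "X \<in> ell" for X using that by blast
  have iso2: "bdot X (hP \<mu> Y) = 0" if "X \<in> ell" "Y \<in> ell" for X Y
    using iso[of X] iso[of Y] iso[of "X + Y"] that add_ell
    by (simp add: hP_linear bdot_simps bdot_hP_commute[of Y \<mu> X])
  have L0: "bdot (px z) X = 0" if "z \<in> L" "X \<in> ell" for z X using that in_ell by blast
  have ker: "(\<alpha> j - \<mu>) * z $ Inr j = 0" if z: "z \<in> L" "px z = hP \<mu> X" "X \<in> ell" for z X j
  proof -
    have "pen a 1 (- \<mu>) (px z') (px z) = 0" if "z' \<in> L" for z'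
      using L0[OF that z(3)] \<mu> by (simp add: z(2) pen_def polar_hP)
    then have "(1 * \<alpha> j + - \<mu>) * z $ Inr j = 0"
      using penL[OF _ z(1), of _ 1 "-\<mu>"] by (intro dot_zero_all_L) simp
    then show ?thesis by simp
  qed
  have "\<exists>Y\<in>ell. hP \<mu> Y \<notin> px ` L"
  proof (rule ccontr)
    assume "\<not> ?thesis"
    then obtain z z' where z: "z \<in> L" "px z = hP \<mu> e" "z' \<in> L" "px z' = hP \<mu> f"
      using e_ell f_ell by (metis imageE)
    \<comment> \<open>Two vectors supported on the same single index are linearly dependent.\<close>
    have "\<exists>c c'. (c, c') \<noteq> (0, 0) \<and> (\<forall>j. c * z $ Inr j + c' * z' $ Inr j = 0)"
    proof (cases "\<exists>j. z' $ Inr j \<noteq> 0")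
      case True
      then obtain j where j: "z' $ Inr j \<noteq> 0" by blast
      have "z' $ Inr j * z $ Inr j' + - (z $ Inr j) * z' $ Inr j' = 0" for j'
      proof (cases "j' = j")
        case False
        have "complex_of_real (\<alpha> j) = \<mu>" using ker[OF z(3,4) f_ell, of j] j by simp
        then have "complex_of_real (\<alpha> j') \<noteq> \<mu>" using inj_\<alpha> False by (auto simp: inj_eq)
        then show ?thesis using ker[OF z(3,4) f_ell, of j'] ker[OF z(1,2) e_ell, of j'] by simp
      qed simp
      then show ?thesis using j by (intro exI[of _ "z' $ Inr j"] exI[of _ "- (z $ Inr j)"]) auto
    next
      case False
      then show ?thesis by (intro exI[of _ 0] exI[of _ 1]) auto
    qed
    then obtain c c' where c: "(c, c') \<noteq> (0, 0)" "\<And>j. c * z $ Inr j + c' * z' $ Inr j = 0" by blast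
    have "c *s z + c' *s z' = 0"
      by (intro py_inj addL scaleL z) (simp add: c)
    then have "px (c *s z + c' *s z') = 0" by (simp add: px_linear)
    then have "hP \<mu> (c *s e + c' *s f) = 0" by (simp add: px_linear z hP_linear)
    then have "c *s e + c' *s f = 0" using polar_hP[OF \<mu>] by (metis polar_linear(3))
    moreover from arg_cong[OF this, of "\<lambda>X. X $ None"] have "c = 0" by simp
    ultimately show False using c(1) f_nz by simp
  qed
  then obtain Y where Y: "Y \<in> ell" "hP \<mu> Y \<notin> px ` L" by blast
  \<comment> \<open>This space has codimension one and is annihilated by all points of the line,
    which forces \<open>e\<close> and \<open>f\<close> to be proportional.\<close>
  let ?B = "vec.span (insert (hP \<mu> Y) (px ` L))"
  have dimB: "vec.dim ?B = CARD('d)"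
    using Y(2) sub_pxL dim_pxL card by (simp add: vec.dim_insert vec.span_eq_iff[THEN iffD2])
  have Beq: "?B = {x. bdot X x = 0}" if X: "X \<in> ell" "X \<noteq> 0" for X
  proof (rule vec.subspace_dim_equal)
    show "?B \<subseteq> {x. bdot X x = 0}"
      using L0[OF _ X(1)] iso2[OF X(1) Y(1)]
      by (intro vec.span_minimal subspace_annihilator) (auto simp: bdot_commute[of X "px _"])
    show "vec.dim {x. bdot X x = 0} \<le> vec.dim ?B"
      using dim_annihilator[OF X(2)] dimB by (simp add: card_UNIV_option)
  qed (simp_all add: subspace_annihilator)
  have "e \<noteq> 0" by (auto simp: vec_eq_option_iff)
  then have "{x. bdot f x = 0} \<subseteq> {x. bdot e x = 0}"
    using Beq[OF e_ell] Beq[OF f_ell f_nz] by simp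
  then obtain c where "e = c *s f" using annihilator_subset_proportional[OF f_nz] by blast
  then show False by (simp add: vec_eq_option_iff)
qed

end

section \<open>Reflection of \<open>L\<close> in a hyperplane\<close>

lemma hyperplane_split:
  fixes M A :: "(complex ^ 'n::finite) set"
  assumes "vec.subspace M" "vec.subspace A" "A \<subseteq> M" "vec.dim A + 1 = vec.dim M" "w \<in> M" "w \<notin> A" "x \<in> M"
  shows "\<exists>c. x - c *s w \<in> A"
proof -
  have A: "vec.span A = A" using assms(2) by (rule vec.span_eq_iff[THEN iffD2])
  have "vec.span (insert w A) = M"
  proof (rule vec.subspace_dim_equal)
    show "vec.span (insert w A) \<subseteq> M" using assms by (intro vec.span_minimal) auto
    show "vec.dim M \<le> vec.dim (vec.span (insert w A))"
      using assms(4,6) A by (simp add: vec.dim_insert del: vec.span_eq_iff)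
  qed (use assms in auto)
  then show ?thesis using assms(7) A by (metis vec.span_breakdown_eq)
qed

lemma dim_hyperplane_in:
  fixes M A :: "(complex ^ 'n::finite) set"
  assumes "vec.subspace M" "vec.subspace A" "A \<subseteq> M" "w \<in> M" "w \<notin> A" "\<And>x. x \<in> M \<Longrightarrow> \<exists>c. x - c *s w \<in> A"
  shows "vec.dim M = vec.dim A + 1"
proof -
  have A: "vec.span A = A" using assms(2) by (rule vec.span_eq_iff[THEN iffD2])
  have "M \<subseteq> vec.span (insert w A)" using assms(6) A by (metis subsetI vec.span_breakdown_eq)
  moreover have "vec.span (insert w A) \<subseteq> M" using assms by (intro vec.span_minimal) auto
  ultimately have "vec.dim M = vec.dim (insert w A)" by (metis subset_antisym vec.dim_span)
  then show ?thesis using assms(5) A by (simp add: vec.dim_insert del: vec.span_eq_iff)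
qed

lemma det_eq_0_iff_kernel:
  fixes A :: "complex ^ 'n::finite ^ 'n"
  shows "det A = 0 \<longleftrightarrow> (\<exists>x. x \<noteq> 0 \<and> A *v x = 0)"
  using invertible_det_nz[of A] invertible_left_inverse[of A] matrix_left_invertible_ker[of A] by metis

lemma det_eq_0_iff_kernel_left:
  fixes A :: "complex ^ 'n::finite ^ 'n"
  shows "det A = 0 \<longleftrightarrow> (\<exists>x. x \<noteq> 0 \<and> (\<forall>j. (\<Sum>i\<in>UNIV. x $ i * A $ i $ j) = 0))"
  using det_eq_0_iff_kernel[of "transpose A"] unfolding det_transpose
  by (simp add: vec_eq_iff matrix_vector_mult_def transpose_def mult.commute)

context confocal_line
begin

text \<open>
  Coordinate vectors of the points of the Cayley curve. For regular parameters \<open>\<mu> = - t / s\<close> the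
  point of contact is the polar of \<open>h\<close>; \<open>s = 0\<close> and \<open>\<mu> = a i\<close> only contribute the points of
  \<open>degenerate_axis\<close>.
\<close>

definition on_cay :: "complex ^ ('d option) \<Rightarrow> bool" where
  "on_cay h \<longleftrightarrow> h \<noteq> 0 \<and> (\<exists>s t. (s, t) \<noteq> (0, 0) \<and> polar a s t h \<in> ell \<and> pen a s t h h = 0)"

text \<open>By \<open>L_meet_refl\<close>, among points of the Cayley curve this excludes exactly
  those whose reflected space is L itself.\<close>

definition generic :: "complex ^ ('d option) \<Rightarrow> bool" where
  "generic h \<longleftrightarrow> (\<exists>s t. \<exists>z\<in>L. pen a s t (px z) h \<noteq> 0)"

text \<open>Since the pencil vanishes on L, the value of a member at \<open>z + c *s emb h\<close>
  is c times this linear expression. The factor c belongs to L, the remaining factor to the residual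
  space.\<close>

definition residual :: "complex \<Rightarrow> complex \<Rightarrow> complex ^ ('d option) \<Rightarrow> complex ^ ('d option + 'm) \<Rightarrow> complex \<Rightarrow> complex" where
  "residual s t h z c = 2 * pen a s t (px z) h + c * pen a s t h h"

text \<open>
  If \<open>h\<close> is not isotropic this is the image of \<open>L\<close> under the reflection in the hyperplane of \<open>h\<close>;
  the description as the residual intersection of \<open>V\<close> with the span of \<open>L\<close> and \<open>h\<close> makes sense
  for all \<open>h\<close>.
\<close>

definition refl :: "complex ^ ('d option) \<Rightarrow> (complex ^ ('d option + 'm)) set" where
  "refl h = {z + c *s emb h | z c. z \<in> L \<and> (\<forall>s t. residual s t h z c = 0)}"

lemma residual_add: "residual s t h (x + y) (c + d) = residual s t h x c + residual s t h y d"
  and residual_scale: "residual s t h (k *s x) (k * c) = k * residual s t h x c"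
  by (simp_all add: residual_def px_linear pen_linear algebra_simps)

lemma residual_split: "residual s t h z c = s * residual 1 0 h z c + t * residual 0 1 h z c"
  unfolding residual_def pen_split[of a s t] by (simp add: algebra_simps)

lemma not_all_zero:
  assumes h: "h \<noteq> 0" and 0: "\<And>s t z. z \<in> L \<Longrightarrow> pen a s t (px z) h = 0" "\<And>s t. pen a s t h h = 0"
  shows False
  using singular_zero[of h] h 0 polar_in_ell by blast

text \<open>The member witnessing \<open>on_cay\<close> has identically vanishing residual, so the
  residuals of all members are multiples of one linear form. A single member that is not identically
  zero therefore already defines \<open>refl h\<close>.\<close>

lemma residual_proportional:
  assumes h: "on_cay h" and 1: "residual s1 t1 h z1 c1 \<noteq> 0" "z1 \<in> L" and z: "residual s1 t1 h z c = 0" "z \<in> L"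
  shows "residual s t h z c = 0"
proof -
  obtain s0 t0 where st: "(s0, t0) \<noteq> (0, 0)" "polar a s0 t0 h \<in> ell" "pen a s0 t0 h h = 0"
    using h by (auto simp: on_cay_def)
  have F0: "residual s0 t0 h w k = 0" if "w \<in> L" for w k
    using st that polar_in_ell by (simp add: residual_def)
  \<comment> \<open>The determinant of the two parameter pairs. If it were zero, the member
    \<open>s1, t1\<close> would be proportional to the witness and have zero residual; otherwise
    Cramer's rule recovers the two generators.\<close>
  define D where "D = s0 * t1 - t0 * s1"
  have eqs: "s0 * residual 1 0 h w k + t0 * residual 0 1 h w k = 0" if "w \<in> L" for w k
    using F0[OF that] residual_split[of s0 t0] by metis
  have "D \<noteq> 0"
  proof
    assume D: "D = 0"
    have e1: "s0 * residual 1 0 h z1 c1 + t0 * residual 0 1 h z1 c1 = 0" using eqs[OF 1(2)] .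
    have "s0 * (s1 * residual 1 0 h z1 c1 + t1 * residual 0 1 h z1 c1) = s1 * (s0 * residual 1 0 h z1 c1 + t0 * residual 0 1 h z1 c1) + D * residual 0 1 h z1 c1"
      "t0 * (s1 * residual 1 0 h z1 c1 + t1 * residual 0 1 h z1 c1) = t1 * (s0 * residual 1 0 h z1 c1 + t0 * residual 0 1 h z1 c1) - D * residual 1 0 h z1 c1"
      by (simp_all add: D_def algebra_simps)
    then have "s0 * residual s1 t1 h z1 c1 = 0" "t0 * residual s1 t1 h z1 c1 = 0"
      using D e1 residual_split[of s1 t1 h z1 c1] by simp_all
    then show False using 1(1) st(1) by simp
  qed
  moreover have "s1 * residual 1 0 h z c + t1 * residual 0 1 h z c = 0" using z(1) residual_split[of s1 t1 h z c] by simp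
  moreover have "D * residual 1 0 h z c = t1 * (s0 * residual 1 0 h z c + t0 * residual 0 1 h z c) - t0 * (s1 * residual 1 0 h z c + t1 * residual 0 1 h z c)"
    "D * residual 0 1 h z c = s0 * (s1 * residual 1 0 h z c + t1 * residual 0 1 h z c) - s1 * (s0 * residual 1 0 h z c + t0 * residual 0 1 h z c)"
    by (simp_all add: D_def algebra_simps)
  ultimately have "residual 1 0 h z c = 0" "residual 0 1 h z c = 0"
    unfolding eqs[OF z(2), of c] by (simp_all only: mult_zero_right diff_self mult_eq_0_iff simp_thms)
  then show ?thesis using residual_split[of s t h z c] by simp
qed

lemma subspace_refl: "vec.subspace (refl h)"
  unfolding vec.subspace_def
proof (intro conjI ballI allI)
  show "0 \<in> refl h" unfolding refl_def
    using vec.subspace_0[OF subL] by (auto simp: residual_def px_linear pen_linear intro!: exI[of _ 0])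
next
  fix x y assume "x \<in> refl h" "y \<in> refl h"
  then obtain z c w d where *: "x = z + c *s emb h" "y = w + d *s emb h" "z \<in> L" "w \<in> L"
    "\<forall>s t. residual s t h z c = 0" "\<forall>s t. residual s t h w d = 0" unfolding refl_def by blast
  have "x + y = (z + w) + (c + d) *s emb h" using * by (simp add: vec.scale_left_distrib)
  moreover have "\<forall>s t. residual s t h (z + w) (c + d) = 0" using * by (simp add: residual_add)
  ultimately show "x + y \<in> refl h" unfolding refl_def using vec.subspace_add[OF subL *(3,4)] by blast
next
  fix k x assume "x \<in> refl h"
  then obtain z c where *: "x = z + c *s emb h" "z \<in> L" "\<forall>s t. residual s t h z c = 0" unfolding refl_def by blast
  have "k *s x = k *s z + (k * c) *s emb h" using * by (simp add: vec.scale_right_distrib)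
  moreover have "\<forall>s t. residual s t h (k *s z) (k * c) = 0" using * by (simp add: residual_scale)
  ultimately show "k *s x \<in> refl h" unfolding refl_def using vec.subspace_scale[OF subL *(2)] by blast
qed

lemma refl_scale:
  assumes "k \<noteq> 0"
  shows "refl (k *s h) = refl h"
proof -
  have sub: "refl (k *s h) \<subseteq> refl h" if k: "k \<noteq> 0" for k h
  proof
    fix x assume "x \<in> refl (k *s h)"
    then obtain z c where *: "x = z + c *s emb (k *s h)" "z \<in> L" "\<And>s t. residual s t (k *s h) z c = 0"
      unfolding refl_def by blast
    have "x = z + (c * k) *s emb h" using *(1) by (simp add: vec_eq_sum_iff)
    moreover have "residual s t h z (c * k) = 0" for s t
    proof -
      have "k * residual s t h z (c * k) = residual s t (k *s h) z c" by (simp add: residual_def pen_linear algebra_simps)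
      then show ?thesis using *(3)[of s t] k by simp
    qed
    ultimately show "x \<in> refl h" unfolding refl_def using *(2) by blast
  qed
  show ?thesis using sub[of k h] sub[of "1 / k" "k *s h"] assms by auto
qed

lemma refl_V_cone: "refl h \<subseteq> V_cone a \<alpha>"
proof
  fix x assume "x \<in> refl h"
  then obtain z c where *: "x = z + c *s emb h" "z \<in> L" "\<forall>s t. residual s t h z c = 0" unfolding refl_def by blast
  have "Qf a \<alpha> s t x x = c * residual s t h z c" for s t
    unfolding *(1) Qf_linear
    using QL[OF *(2,2), of s t] Qf_emb[of a \<alpha> s t z h] Qf_emb[of a \<alpha> s t "emb h" h] Qf_commute[of a \<alpha> s t "emb h" z]
    by (simp add: residual_def algebra_simps)
  then show "x \<in> V_cone a \<alpha>" using *(3) by (simp add: V_cone_iff)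
qed

section \<open>Polynomial bases of the reflected space\<close>

lemma px_uminus: "px (- z) = - px z" by (simp add: vec_eq_iff)

lemma pen_uminus: "pen a s t (- x) h = - pen a s t x h"
  using pen_linear(3)[of a s t 0 x h] by (simp add: pen_linear)

text \<open>The image of \<open>S i\<close> under the reflection in h for the chosen form,
  multiplied by its denominator.\<close>

definition B1 :: "complex \<Rightarrow> complex \<Rightarrow> complex ^ ('d option) \<Rightarrow> 'm \<Rightarrow> complex ^ ('d option + 'm)" where
  "B1 s t h i = pen a s t h h *s S i - (2 * pen a s t (px (S i)) h) *s emb h"

text \<open>Replaces \<open>B1\<close> where h may be isotropic. For \<open>i \<noteq> k\<close> the
  vectors lie in L and are orthogonal to h; the vector at \<open>k\<close> solves the residual
  equation outside L. All need only the pivot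
  \<open>pen a s t (px (S k)) h \<noteq> 0\<close>.\<close>

definition B2 :: "'m \<Rightarrow> complex \<Rightarrow> complex \<Rightarrow> complex ^ ('d option) \<Rightarrow> 'm \<Rightarrow> complex ^ ('d option + 'm)" where
  "B2 k s t h i = (if i = k then (2 * pen a s t (px (S k)) h) *s emb h - pen a s t h h *s S k
     else pen a s t (px (S k)) h *s S i - pen a s t (px (S i)) h *s S k)"

lemma pen_expand: "z \<in> L \<Longrightarrow> pen a s t (px z) h = (\<Sum>i\<in>UNIV. z $ Inr i * pen a s t (px (S i)) h)"
proof -
  assume z: "z \<in> L"
  have "px z = (\<Sum>i\<in>UNIV. z $ Inr i *s px (S i))"
    by (subst L_expand[OF z]) (simp add: vec_eq_iff)
  then have "pen a s t (px z) h = (\<Sum>k\<in>UNIV. \<Sum>i\<in>UNIV. z $ Inr i * (S i $ Inl k * polar a s t h $ k))"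
    by (simp add: pen_def bdot_def sum_distrib_right mult.assoc)
  also have "\<dots> = (\<Sum>i\<in>UNIV. z $ Inr i * pen a s t (px (S i)) h)"
    by (subst sum.swap) (simp add: pen_def bdot_def sum_distrib_left)
  finally show ?thesis .
qed

lemma B1_in:
  assumes "on_cay h" "pen a s t h h \<noteq> 0"
  shows "B1 s t h i \<in> refl h"
proof -
  let ?z = "pen a s t h h *s S i" and ?c = "- (2 * pen a s t (px (S i)) h)"
  have z: "?z \<in> L" by (intro scaleL S_L)
  have "residual s t h 0 1 \<noteq> 0" using assms(2) by (simp add: residual_def px_linear pen_linear)
  moreover have "residual s t h ?z ?c = 0" by (simp add: residual_def px_linear pen_linear)
  ultimately have "residual s' t' h ?z ?c = 0" for s' t'
    using residual_proportional[OF assms(1) _ _ _ z] vec.subspace_0[OF subL] by blast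
  moreover have "B1 s t h i = ?z + ?c *s emb h" by (simp add: B1_def vec_eq_iff)
  ultimately show ?thesis unfolding refl_def using z by blast
qed

lemma B2_in:
  assumes "on_cay h" "pen a s t (px (S k)) h \<noteq> 0"
  shows "B2 k s t h i \<in> refl h"
proof -
  let ?b = "\<lambda>i. pen a s t (px (S i)) h"
  define z where "z = (if i = k then - pen a s t h h *s S k else ?b k *s S i - ?b i *s S k)"
  define c where "c = (if i = k then 2 * ?b k else 0)"
  have z: "z \<in> L" unfolding z_def
    using S_L diffL scaleL by presburger
  have "residual s t h (S k) 0 \<noteq> 0" using assms(2) by (simp add: residual_def)
  moreover have "residual s t h z c = 0" by (simp add: z_def c_def residual_def px_linear px_uminus pen_uminus pen_linear)
  ultimately have "residual s' t' h z c = 0" for s' t'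
    using residual_proportional[OF assms(1) _ S_L _ z] by blast
  moreover have "B2 k s t h i = z + c *s emb h" by (simp add: B2_def z_def c_def vec_eq_iff)
  ultimately show ?thesis unfolding refl_def using z by blast
qed

lemma B1_comb: "(\<Sum>i\<in>UNIV. c i *s B1 s t h i) =
   pen a s t h h *s (\<Sum>i\<in>UNIV. c i *s S i) - (2 * (\<Sum>i\<in>UNIV. c i * pen a s t (px (S i)) h)) *s emb h"
  by (simp add: B1_def vec_eq_iff right_diff_distrib sum_subtractf sum_distrib_left sum_distrib_right mult_ac)

lemma B2_comb: "(\<Sum>i\<in>UNIV. c i *s B2 k s t h i) =
   pen a s t (px (S k)) h *s (\<Sum>i\<in>UNIV. c i *s S i) - (\<Sum>i\<in>UNIV. c i * pen a s t (px (S i)) h) *s S k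
   + c k *s ((2 * pen a s t (px (S k)) h) *s emb h - pen a s t h h *s S k)" (is "?l = ?r")
proof -
  let ?b = "\<lambda>i. pen a s t (px (S i)) h"
  let ?d = "(2 * ?b k) *s emb h - pen a s t h h *s S k"
  have B: "B2 k s t h i = ?b k *s S i - ?b i *s S k + (if i = k then ?d else 0)" for i
    by (simp add: B2_def)
  have "?l = (\<Sum>i\<in>UNIV. c i *s (?b k *s S i - ?b i *s S k + (if i = k then ?d else 0)))"
    by (simp only: B)
  also have "\<dots> = (\<Sum>i\<in>UNIV. ?b k *s (c i *s S i) - (c i * ?b i) *s S k + (if i = k then c k *s ?d else 0))"
    by (intro sum.cong) (auto simp: vec_eq_iff algebra_simps)
  also have "\<dots> = (\<Sum>i\<in>UNIV. ?b k *s (c i *s S i)) - (\<Sum>i\<in>UNIV. (c i * ?b i) *s S k) + c k *s ?d"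
    by (simp add: sum.distrib sum_subtractf)
  also have "\<dots> = ?r" by (simp only: vec.scale_sum_right vec.scale_sum_left)
  finally show ?thesis .
qed

lemma B1_basis:
  assumes h: "on_cay h" and q: "pen a s t h h \<noteq> 0"
  shows "(\<Sum>i\<in>UNIV. c i *s B1 s t h i) = 0 \<Longrightarrow> c i = 0" "vec.span (range (B1 s t h)) = refl h"
proof -
  let ?q = "pen a s t h h"
  show "c i = 0" if "(\<Sum>i\<in>UNIV. c i *s B1 s t h i) = 0"
    using arg_cong[OF that[unfolded B1_comb], of "\<lambda>x. x $ Inr i"] q comb_Inr[of c i] by simp
  show "vec.span (range (B1 s t h)) = refl h"
  proof
    show "vec.span (range (B1 s t h)) \<subseteq> refl h"
      using B1_in[OF h q] by (intro vec.span_minimal subspace_refl) auto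
    show "refl h \<subseteq> vec.span (range (B1 s t h))"
    proof
      fix x assume "x \<in> refl h"
      then obtain z c where *: "x = z + c *s emb h" "z \<in> L" "\<forall>s t. residual s t h z c = 0" unfolding refl_def by blast
      have "(\<Sum>i\<in>UNIV. (z $ Inr i / ?q) *s S i) = (1 / ?q) *s (\<Sum>i\<in>UNIV. z $ Inr i *s S i)"
        by (simp add: vec.scale_sum_right)
      then have 1: "(\<Sum>i\<in>UNIV. (z $ Inr i / ?q) *s S i) = (1 / ?q) *s z" using L_expand[OF *(2)] by metis
      have 2: "(\<Sum>i\<in>UNIV. z $ Inr i / ?q * pen a s t (px (S i)) h) = pen a s t (px z) h / ?q"
        by (simp add: pen_expand[OF *(2)] sum_divide_distrib)
      have "2 * pen a s t (px z) h = - (c * ?q)" using *(3) by (simp add: residual_def eq_neg_iff_add_eq_0)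
      then have "x = (\<Sum>i\<in>UNIV. (z $ Inr i / ?q) *s B1 s t h i)"
        unfolding B1_comb 1 2 using q *(1) by (simp add: vec_eq_iff)
      then show "x \<in> vec.span (range (B1 s t h))"
        unfolding span_family by (rule exI[of _ "\<lambda>i. z $ Inr i / ?q"])
    qed
  qed
qed

lemma B2_basis:
  assumes h: "on_cay h" and q: "pen a s t (px (S k)) h \<noteq> 0"
  shows "(\<Sum>i\<in>UNIV. c i *s B2 k s t h i) = 0 \<Longrightarrow> c i = 0" "vec.span (range (B2 k s t h)) = refl h"
proof -
  let ?b = "\<lambda>i. pen a s t (px (S i)) h" and ?q = "pen a s t h h"
  show "c i = 0" if c: "(\<Sum>i\<in>UNIV. c i *s B2 k s t h i) = 0"
  proof -
    have j: "c j = 0" if "j \<noteq> k" for j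
      using arg_cong[OF c[unfolded B2_comb], of "\<lambda>x. x $ Inr j"] q comb_Inr[of c j] that by (simp add: S_Inr)
    have "(\<Sum>i\<in>UNIV. c i *s B2 k s t h i) = (\<Sum>i\<in>{k}. c i *s B2 k s t h i)"
      using j by (intro sum.mono_neutral_right) auto
    then have ck: "c k *s B2 k s t h k = 0" using c by simp
    have "c k = 0"
    proof (rule ccontr)
      assume "c k \<noteq> 0"
      then have 0: "B2 k s t h k = 0" using ck by simp
      have "B2 k s t h k $ Inr k = 0" using 0 by simp
      then have q0: "?q = 0" by (simp add: B2_def S_Inr)
      have "B2 k s t h k $ Inl r = 0" for r using 0 by simp
      then have "h $ r = 0" for r using q q0 by (simp add: B2_def)
      then have "h = 0" by (simp add: vec_eq_iff)
      then show False using h by (simp add: on_cay_def)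
    qed
    then show ?thesis using j by (cases "i = k") auto
  qed
  show "vec.span (range (B2 k s t h)) = refl h"
  proof
    show "vec.span (range (B2 k s t h)) \<subseteq> refl h"
      using B2_in[OF h q] by (intro vec.span_minimal subspace_refl) auto
    show "refl h \<subseteq> vec.span (range (B2 k s t h))"
    proof
      fix x assume "x \<in> refl h"
      then obtain z c where *: "x = z + c *s emb h" "z \<in> L" "\<forall>s t. residual s t h z c = 0" unfolding refl_def by blast
      \<comment> \<open>Only the vector of \<open>B2\<close> at index k contains
        \<open>emb h\<close>, so the coefficient there is forced to be
        \<open>c / (2 * pen a s t (px (S k)) h)\<close>; y is the correction at this index. The
        component along \<open>S k\<close> then agrees by the residual equation.\<close>
      define y where "y = c / (2 * ?b k) - z $ Inr k / ?b k"
      define d where "d i = z $ Inr i / ?b k + (if i = k then y else 0)" for i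
      have dk: "d k = c / (2 * ?b k)" by (simp add: d_def y_def)
      have "(\<Sum>i\<in>UNIV. d i *s S i) = (\<Sum>i\<in>UNIV. (1 / ?b k) *s (z $ Inr i *s S i) + (if i = k then y *s S k else 0))"
        by (intro sum.cong) (auto simp: d_def vec.scale_left_distrib)
      also have "\<dots> = (1 / ?b k) *s (\<Sum>i\<in>UNIV. z $ Inr i *s S i) + y *s S k"
        by (simp add: sum.distrib vec.scale_sum_right)
      finally have 1: "(\<Sum>i\<in>UNIV. d i *s S i) = (1 / ?b k) *s z + y *s S k" using L_expand[OF *(2)] by metis
      have "(\<Sum>i\<in>UNIV. d i * ?b i) = (\<Sum>i\<in>UNIV. z $ Inr i * ?b i / ?b k + (if i = k then y * ?b k else 0))"
        by (intro sum.cong) (auto simp: d_def algebra_simps)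
      also have "\<dots> = pen a s t (px z) h / ?b k + y * ?b k"
        by (simp add: sum.distrib pen_expand[OF *(2)] sum_divide_distrib)
      finally have 2: "(\<Sum>i\<in>UNIV. d i * ?b i) = pen a s t (px z) h / ?b k + y * ?b k" .
      have 3: "pen a s t (px z) h = - (c * ?q) / 2" using *(3) by (simp add: residual_def eq_neg_iff_add_eq_0 field_simps)
      have "x = (\<Sum>i\<in>UNIV. d i *s B2 k s t h i)"
        unfolding B2_comb 1 2 3 dk using q *(1) by (simp add: vec_eq_iff field_simps)
      then show "x \<in> vec.span (range (B2 k s t h))" unfolding span_family by (rule exI[of _ d])
    qed
  qed
qed

text \<open>The loci where \<open>B1\<close> and \<open>B2\<close> are bases cover the Cayley curve;
  a point outside all of them would contradict \<open>not_all_zero\<close>.\<close>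

lemma on_cay_pivot:
  assumes "on_cay h"
  shows "\<exists>s t. pen a s t h h \<noteq> 0 \<or> (\<exists>k. pen a s t (px (S k)) h \<noteq> 0)"
proof (rule ccontr)
  assume no: "\<not> ?thesis"
  show False
  proof (rule not_all_zero)
    show "h \<noteq> 0" using assms by (simp add: on_cay_def)
    show "pen a s t (px z) h = 0" if "z \<in> L" for s t z using no by (simp add: pen_expand[OF that])
  qed (use no in blast)
qed

lemma generic_pivot: "generic h \<Longrightarrow> \<exists>s t k. pen a s t (px (S k)) h \<noteq> 0"
  unfolding generic_def using pen_expand by (metis (no_types, lifting) mult_zero_right sum.neutral)

lemma dim_refl: "on_cay h \<Longrightarrow> vec.dim (refl h) = CARD('m)"
proof -
  assume h: "on_cay h"
  have dim: "vec.dim (refl h) = CARD('m)"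
    if c: "\<And>c i. (\<Sum>i\<in>UNIV. c i *s b i) = 0 \<Longrightarrow> c i = 0" "vec.span (range b) = refl h" for b :: "'m \<Rightarrow> _"
  proof -
    have "inj b" "vec.independent (range b)"
      using independent_family_iff[of b] c(1) by blast+
    then show ?thesis using vec.dim_span_eq_card_independent[of "range b"] c(2) by (simp add: card_image)
  qed
  obtain s t where "pen a s t h h \<noteq> 0 \<or> (\<exists>k. pen a s t (px (S k)) h \<noteq> 0)" using on_cay_pivot[OF h] by blast
  then show ?thesis
  proof (elim disjE exE)
    assume "pen a s t h h \<noteq> 0"
    from B1_basis[OF h this] show ?thesis by (rule dim)
  next
    fix k assume "pen a s t (px (S k)) h \<noteq> 0"
    from B2_basis[OF h this] show ?thesis by (rule dim)
  qed
qed

lemma refl_F: "on_cay h \<Longrightarrow> refl h \<in> F_set a \<alpha>"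
  using subspace_refl refl_V_cone dim_refl card by (simp add: F_set_def)

lemma hom_poly_pen_left: "hom_poly 1 (\<lambda>h. pen a s t x h)"
  unfolding pen_def polar_def
  by (rule hom_poly_bdot) (simp only: vec_lambda_beta, intro hom_poly_cmult hom_poly.coord)

lemma hom_poly_pen: "hom_poly 2 (\<lambda>h. pen a s t h h)"
proof -
  have "hom_poly (1 + 1) (\<lambda>h. h $ k * (wt a s t k * h $ k))" for k
    by (intro hom_poly.mult hom_poly_cmult hom_poly.coord)
  note this[unfolded one_add_one]
  then show ?thesis unfolding pen_def bdot_def polar_nth by (rule hom_poly_sum)
qed

lemma hom_poly_emb: "hom_poly 1 (\<lambda>h. emb h $ r)"
  using hom_poly.coord hom_poly_zero[of 1] by (cases r) (simp_all only: emb_Inl emb_Inr)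

lemma hom_poly_pen_emb: "hom_poly 2 (\<lambda>h. (2 * pen a s t x h) * emb h $ r)"
proof -
  have "hom_poly (1 + 1) (\<lambda>h. (2 * pen a s t x h) * emb h $ r)"
    by (intro hom_poly.mult hom_poly_cmult hom_poly_pen_left hom_poly_emb)
  then show ?thesis by (simp only: one_add_one)
qed

lemma hom_poly_B1: "hom_poly 2 (\<lambda>h. B1 s t h i $ r)"
  unfolding B1_def vector_minus_component vector_smult_component
  by (intro hom_poly_diff hom_poly_multc hom_poly_pen hom_poly_pen_emb)

lemma hom_poly_B2: "hom_poly (if i = k then 2 else 1) (\<lambda>h. B2 k s t h i $ r)"
proof (cases "i = k")
  case True
  then show ?thesis
    unfolding B2_def if_P[OF True] vector_minus_component vector_smult_component
    by (intro hom_poly_diff hom_poly_multc hom_poly_pen hom_poly_pen_emb)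
next
  case False
  then show ?thesis
    unfolding B2_def if_not_P[OF False] vector_minus_component vector_smult_component
    by (intro hom_poly_diff hom_poly_multc hom_poly_pen_left)
qed

text \<open>The local formula that makes j regular at every point, including isotropic h and those h
  with reflected space L: the coordinates are the minors of \<open>B1\<close> or of
  \<open>B2\<close>.\<close>

lemma refl_local:
  assumes h: "on_cay h"
  shows "\<exists>e' q e G. hom_poly e' q \<and> q h \<noteq> 0 \<and> (\<forall>\<phi>. hom_poly e (\<lambda>u. G u $ \<phi>)) \<and>
    (\<forall>h'. on_cay h' \<longrightarrow> q h' \<noteq> 0 \<longrightarrow> G h' \<in> pluecker_coords (refl h'))"
proof -
  obtain s t where "pen a s t h h \<noteq> 0 \<or> (\<exists>k. pen a s t (px (S k)) h \<noteq> 0)" using on_cay_pivot[OF h] by blast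
  then consider "pen a s t h h \<noteq> 0" | k where "pen a s t (px (S k)) h \<noteq> 0" by blast
  then show ?thesis
  proof cases
    case 1
    show ?thesis
    proof (intro exI conjI allI impI)
      show "hom_poly 2 (\<lambda>h. pen a s t h h)" by (rule hom_poly_pen)
      show "pen a s t h h \<noteq> 0" by fact
      show "hom_poly (\<Sum>i\<in>(UNIV::'m set). 2) (\<lambda>u. (\<chi> \<phi>. det (\<chi> i j. B1 s t u i $ \<phi> j)) $ \<phi>)" for \<phi> :: "'m \<Rightarrow> 'd option + 'm"
        unfolding vec_lambda_beta by (intro hom_poly_det hom_poly_B1)
    next
      fix h' assume "on_cay h'" "pen a s t h' h' \<noteq> 0"
      then show "(\<chi> \<phi>. det (\<chi> i j. B1 s t h' i $ \<phi> j)) \<in> pluecker_coords (refl h')"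
        using B1_basis[of h'] by (intro pluecker_coordsI) auto
    qed
  next
    case 2
    show ?thesis
    proof (intro exI conjI allI impI)
      show "hom_poly 1 (\<lambda>h. pen a s t (px (S k)) h)" by (rule hom_poly_pen_left)
      show "pen a s t (px (S k)) h \<noteq> 0" by fact
      show "hom_poly (\<Sum>i\<in>UNIV. if i = k then 2 else 1) (\<lambda>u. (\<chi> \<phi>. det (\<chi> i j. B2 k s t u i $ \<phi> j)) $ \<phi>)" for \<phi> :: "'m \<Rightarrow> 'd option + 'm"
        unfolding vec_lambda_beta by (intro hom_poly_det hom_poly_B2)
    next
      fix h' assume "on_cay h'" "pen a s t (px (S k)) h' \<noteq> 0"
      then show "(\<chi> \<phi>. det (\<chi> i j. B2 k s t h' i $ \<phi> j)) \<in> pluecker_coords (refl h')"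
        using B2_basis[of h'] by (intro pluecker_coordsI) auto
    qed
  qed
qed

section \<open>Spaces meeting L in codimension one\<close>

definition T :: "(complex ^ ('d option + 'm)) set set" where
  "T = {L' \<in> F_set a \<alpha>. vec.dim (L \<inter> L') + 2 = CARD('d)}"

lemma T_F: "L' \<in> T \<Longrightarrow> L' \<in> F_set a \<alpha>" by (simp add: T_def)

lemma F_dim: "L' \<in> F_set a \<alpha> \<Longrightarrow> vec.dim L' = CARD('m)"
  and F_sub: "L' \<in> F_set a \<alpha> \<Longrightarrow> vec.subspace L'"
  and F_V: "L' \<in> F_set a \<alpha> \<Longrightarrow> L' \<subseteq> V_cone a \<alpha>"
  using card by (auto simp: F_set_def)

lemma card_m_pos: "CARD('m) \<ge> 1"
  by (simp add: Suc_leI)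

lemma T_iff: "L' \<in> T \<longleftrightarrow> L' \<in> F_set a \<alpha> \<and> vec.dim (L \<inter> L') + 1 = CARD('m)"
  using card by (auto simp: T_def)

text \<open>The projection along L onto the subspace y = 0. Its kernel is L, so it serves as the
  quotient map modulo L.\<close>

definition theta :: "complex ^ ('d option + 'm) \<Rightarrow> complex ^ ('d option)" where
  "theta z = px (z - (\<Sum>j\<in>UNIV. z $ Inr j *s S j))"

lemma theta_nth: "theta z $ k = z $ Inl k - (\<Sum>j\<in>UNIV. z $ Inr j * S j $ Inl k)"
  by (simp add: theta_def)

lemma theta_linear: "theta (x + y) = theta x + theta y" "theta (c *s x) = c *s theta x"
  "theta (x - y) = theta x - theta y"
  by (simp_all add: vec_eq_iff theta_nth algebra_simps sum.distrib sum_subtractf sum_distrib_left)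

lemma theta_decomp: "z = (\<Sum>j\<in>UNIV. z $ Inr j *s S j) + emb (theta z)"
  unfolding vec_eq_sum_iff
  by (simp add: theta_nth S_Inr if_distrib[of "\<lambda>x. _ * x"] cong: if_cong)

lemma theta_L: "z \<in> L \<Longrightarrow> theta z = 0"
  using L_expand[of z] by (simp add: theta_def px_linear)

lemma theta_0_L:
  assumes "theta z = 0" shows "z \<in> L"
proof -
  have "emb (theta z) = (0 :: complex ^ ('d option + 'm))" using assms by (simp add: vec_eq_sum_iff)
  then have "z = (\<Sum>j\<in>UNIV. z $ Inr j *s S j)" using theta_decomp[of z] by simp
  then show ?thesis using comb_L[of "\<lambda>j. z $ Inr j"] by metis
qed

lemma theta_emb: "theta (emb h) = h"
  by (simp add: vec_eq_iff theta_nth)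

lemma theta_comb: "z \<in> L \<Longrightarrow> theta (z + c *s emb h) = c *s h"
  by (simp add: theta_linear theta_L theta_emb)

lemma L_meet_refl: "on_cay h \<Longrightarrow> L \<inter> refl h = {z \<in> L. \<forall>s t. pen a s t (px z) h = 0}"
proof -
  assume h: "on_cay h"
  have "(\<forall>s t. pen a s t (px x) h = 0)" if x: "x \<in> L" "x \<in> refl h" for x
  proof -
    obtain z c where *: "x = z + c *s emb h" "z \<in> L" "\<forall>s t. residual s t h z c = 0"
      using x(2) unfolding refl_def by blast
    have "c *s h = 0" using theta_comb[OF *(2)] theta_L[OF x(1)] *(1) by metis
    then have "c = 0" using h by (auto simp: on_cay_def)
    then show ?thesis using * by (simp add: residual_def)
  qed
  moreover have "x \<in> refl h" if "x \<in> L" "\<forall>s t. pen a s t (px x) h = 0" for x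
    unfolding refl_def using that by (intro CollectI exI[of _ x] exI[of _ 0]) (auto simp: residual_def)
  ultimately show ?thesis by blast
qed

text \<open>On L the conditions defining the intersection reduce to one linear equation by
  \<open>residual_proportional\<close>, and genericity makes this equation nonzero.\<close>

lemma refl_T:
  assumes h: "on_cay h" "generic h"
  shows "refl h \<in> T"
proof -
  obtain s t k where k: "pen a s t (px (S k)) h \<noteq> 0" using generic_pivot[OF h(2)] by blast
  have "vec.dim L = vec.dim (L \<inter> refl h) + 1"
  proof (rule dim_hyperplane_in[OF subL _ _ S_L[of k]])
    show "vec.subspace (L \<inter> refl h)" by (intro vec.subspace_inter subL subspace_refl)
    show "S k \<notin> L \<inter> refl h" using L_meet_refl[OF h(1)] k by blast
  next
    fix x assume x: "x \<in> L"
    define c where "c = pen a s t (px x) h / pen a s t (px (S k)) h"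
    have y: "x - c *s S k \<in> L" using x S_L diffL scaleL by blast
    have 0: "residual s t h (x - c *s S k) 0 = 0"
      using k by (simp add: residual_def px_linear pen_linear c_def)
    have "residual s t h (S k) 0 \<noteq> 0" using k by (simp add: residual_def)
    then have "residual s' t' h (x - c *s S k) 0 = 0" for s' t'
      using residual_proportional[OF h(1) _ S_L 0 y] by blast
    then show "\<exists>c. x - c *s S k \<in> L \<inter> refl h" using y unfolding L_meet_refl[OF h(1)]
      by (auto simp: residual_def)
  qed simp
  then show ?thesis using refl_F[OF h(1)] dimL by (simp add: T_iff)
qed

text \<open>Let h be the class modulo L of a vector w of L' outside L. Isotropy of L' makes h
  orthogonal to the common hyperplane of L and L' under the whole pencil, so orthogonality to all of
  L is a single condition on the member. The member solving it also makes h isotropic, again because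
  w is isotropic.\<close>

lemma T_is_refl:
  assumes "L' \<in> T"
  shows "\<exists>h. on_cay h \<and> generic h \<and> refl h = L'"
proof -
  have F: "L' \<in> F_set a \<alpha>" and dimI: "vec.dim (L \<inter> L') + 1 = CARD('m)" using assms T_iff by auto
  have subI: "vec.subspace (L \<inter> L')" by (intro vec.subspace_inter subL F_sub[OF F])
  have "\<not> L' \<subseteq> L \<inter> L'" "\<not> L \<subseteq> L \<inter> L'"
    using vec.dim_subset dimI dimL F_dim[OF F] by (metis Suc_eq_plus1 Suc_n_not_le_n)+
  then obtain w z1 where w: "w \<in> L'" "w \<notin> L" and z1: "z1 \<in> L" "z1 \<notin> L'" by blast
  define h where "h = theta w"
  have h0: "h \<noteq> 0" using theta_0_L w(2) by (auto simp: h_def)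
  define z0 where "z0 = (\<Sum>j\<in>UNIV. w $ Inr j *s S j)"
  have z0: "z0 \<in> L" and wz: "w = z0 + emb h"
    using comb_L theta_decomp[of w] by (auto simp: z0_def h_def)
  have Q': "Qf a \<alpha> s t x y = 0" if "x \<in> L'" "y \<in> L'" for s t x y
    using isotropic_polarize[OF F_sub[OF F] F_V[OF F] that] .
  have u0: "pen a s t (px u) h = 0" if "u \<in> L \<inter> L'" for s t u
    using Q'[of u w s t] QL[of u z0 s t] that w(1) z0 by (simp add: wz Qf_linear Qf_emb)
  have ww: "2 * pen a s t (px z0) h + pen a s t h h = 0" for s t
    using Q'[OF w(1) w(1), of s t] QL[OF z0 z0, of s t] Qf_commute[of a \<alpha> s t "emb h" z0]
    by (simp add: wz Qf_linear Qf_emb px_linear pen_linear)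
  have zz: "\<exists>c. \<forall>s t. pen a s t (px z) h = c * pen a s t (px z1) h" if z: "z \<in> L" for z
  proof -
    obtain c where "z - c *s z1 \<in> L \<inter> L'"
      using hyperplane_split[OF subL subI _ _ z1(1) _ z] dimI dimL z1(2) by auto
    then have "pen a s t (px (z - c *s z1)) h = 0" for s t using u0 by blast
    then show ?thesis by (intro exI[of _ c]) (simp add: px_linear pen_linear)
  qed
  have nz: "\<exists>s t. pen a s t (px z1) h \<noteq> 0"
  proof (rule ccontr)
    assume "\<not> ?thesis"
    then have 0: "pen a s t (px z) h = 0" if "z \<in> L" for s t z using zz[OF that] by auto
    show False by (rule not_all_zero[OF h0 0]) (use ww 0[OF z0] in auto)
  qed
  \<comment> \<open>The member with parameters \<open>J1\<close> and \<open>- A1\<close> is the one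
    under which h is orthogonal to \<open>z1\<close>, hence to L.\<close>
  define J1 where "J1 = penJ (px z1) h"
  define A1 where "A1 = penA (px z1) h"
  have "pen a s t (px z1) h = s * A1 + t * J1" for s t
    unfolding J1_def A1_def by (rule pen_split)
  then have "(J1, - A1) \<noteq> (0, 0)" using nz by auto
  moreover have z10: "pen a J1 (- A1) (px z1) h = 0"
    unfolding pen_split[of a J1 "- A1"] J1_def[symmetric] A1_def[symmetric] by simp
  then have Lz: "pen a J1 (- A1) (px z) h = 0" if "z \<in> L" for z using zz[OF that] by auto
  then have "polar a J1 (- A1) h \<in> ell" by (simp add: polar_in_ell)
  moreover have "pen a J1 (- A1) h h = 0" using ww[of J1 "-A1"] Lz[OF z0] by simp
  ultimately have on_cay: "on_cay h" unfolding on_cay_def using h0 by blast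
  have generic: "generic h" using nz z1(1) by (auto simp: generic_def)
  have "L' \<subseteq> refl h"
  proof
    fix x assume x: "x \<in> L'"
    obtain c where c: "x - c *s w \<in> L \<inter> L'"
      using hyperplane_split[OF F_sub[OF F] subI _ _ w(1) _ x] dimI F_dim[OF F] w(2) by auto
    define y where "y = x - c *s w"
    have y: "y \<in> L \<inter> L'" using c by (simp add: y_def)
    have "x = (y + c *s z0) + c *s emb h" by (simp add: y_def wz vec_eq_iff algebra_simps)
    moreover have "y + c *s z0 \<in> L"
      using y z0 addL scaleL by blast
    moreover have "residual s t h (y + c *s z0) c = 0" for s t
    proof -
      have "residual s t h (y + c *s z0) c =
          2 * pen a s t (px y) h + c * (2 * pen a s t (px z0) h + pen a s t h h)"
        by (simp add: residual_def px_linear pen_linear algebra_simps)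
      then show ?thesis using u0[OF y, of s t] ww[of s t] by simp
    qed
    ultimately show "x \<in> refl h" unfolding refl_def by blast
  qed
  then have "L' = refl h"
    using vec.subspace_dim_equal[OF F_sub[OF F] subspace_refl] F_dim[OF F] dim_refl[OF on_cay] by auto
  then show ?thesis using on_cay generic by blast
qed

lemma theta_refl: "x \<in> refl h \<Longrightarrow> \<exists>c. theta x = c *s h"
  unfolding refl_def using theta_comb by blast

lemma theta_refl_nz:
  assumes "on_cay h" "generic h"
  shows "\<exists>x\<in>refl h. \<exists>c. c \<noteq> 0 \<and> theta x = c *s h"
proof -
  obtain s t k where k: "pen a s t (px (S k)) h \<noteq> 0" using generic_pivot[OF assms(2)] by blast
  have "theta (B2 k s t h k) = (2 * pen a s t (px (S k)) h) *s h"
    using theta_L[OF S_L[of k]] by (simp add: B2_def theta_linear theta_emb)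
  then show ?thesis using B2_in[OF assms(1) k] k by (metis mult_eq_0_iff zero_neq_numeral)
qed

text \<open>The inverse of j on \<open>T\<close>: modulo L the space \<open>refl h\<close> consists
  of multiples of h. Taking the annihilator avoids choosing a vector.\<close>

definition plane_of :: "(complex ^ ('d option + 'm)) set \<Rightarrow> (complex ^ ('d option)) set" where
  "plane_of L' = {X. \<forall>x\<in>L'. bdot (theta x) X = 0}"

lemma plane_of_refl:
  assumes "on_cay h" "generic h"
  shows "plane_of (refl h) = {X. bdot h X = 0}"
proof -
  have "bdot h X = 0" if X: "X \<in> plane_of (refl h)" for X
  proof -
    obtain x c where "x \<in> refl h" "c \<noteq> 0" "theta x = c *s h" using theta_refl_nz[OF assms] by blast
    then show ?thesis using X by (auto simp: plane_of_def bdot_simps)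
  qed
  moreover have "X \<in> plane_of (refl h)" if "bdot h X = 0" for X
    using that theta_refl[of _ h] by (auto simp: plane_of_def bdot_simps) (metis bdot_scale_left mult_zero_right)
  ultimately show ?thesis by blast
qed

section \<open>Recovering the hyperplane from Pluecker coordinates\<close>

definition rho :: "'d option \<Rightarrow> complex ^ ('d option + 'm)" where
  "rho k = (\<chi> r. case r of Inl k' \<Rightarrow> if k' = k then 1 else 0 | Inr j \<Rightarrow> - (S j $ Inl k))"

lemma sum_UNIV_sum:
  fixes g :: "'i::finite + 'j::finite \<Rightarrow> complex"
  shows "(\<Sum>r\<in>UNIV. g r) = (\<Sum>k\<in>UNIV. g (Inl k)) + (\<Sum>j\<in>UNIV. g (Inr j))"
  using sum.Plus[of "UNIV :: 'i set" "UNIV :: 'j set" g] by (simp add: comp_def)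

lemma bdot_rho: "bdot (rho k) z = theta z $ k"
  by (simp add: bdot_def rho_def sum_UNIV_sum theta_nth sum_negf mult.commute
      if_distrib[of "\<lambda>x. x * _"] if_distrib[of "\<lambda>x. _ * x"] cong: if_cong)

lemma theta_sum: "theta (\<Sum>i\<in>UNIV. c i *s b i) $ k = (\<Sum>i\<in>UNIV. c i * theta (b i) $ k)"
  unfolding bdot_rho[symmetric] bdot_def by (simp add: sum_distrib_left mult_ac) (rule sum.swap)

text \<open>Column \<open>j0\<close> of the matrix of y-coordinates is exchanged for coordinate k of
  \<open>theta\<close>. On \<open>refl h\<close>, where \<open>theta\<close> takes values in
  multiples of h, the determinant is \<open>h $ k\<close> times a factor that does not depend on
  k.\<close>

definition rho1 :: "'m \<Rightarrow> 'd option \<Rightarrow> 'm \<Rightarrow> complex ^ ('d option + 'm)" where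
  "rho1 j0 k j = (if j = j0 then rho k else axis (Inr j) 1)"

text \<open>Two columns are exchanged for coordinates of \<open>theta\<close>, so the determinant
  vanishes whenever \<open>theta\<close> has rank at most one.\<close>

definition rho2 :: "'m \<Rightarrow> 'd option \<Rightarrow> 'm \<Rightarrow> 'd option \<Rightarrow> 'm \<Rightarrow> complex ^ ('d option + 'm)" where
  "rho2 j0 k j1 k' j = (if j = j1 then rho k' else rho1 j0 k j)"

lemma bdot_rho1: "bdot (rho1 j0 k j) z = (if j = j0 then theta z $ k else z $ Inr j)"
  by (simp add: rho1_def bdot_rho bdot_axis)

lemma bdot_rho2: "bdot (rho2 j0 k j1 k' j) z = (if j = j1 then theta z $ k' else bdot (rho1 j0 k j) z)"
  by (simp add: rho2_def bdot_rho)

lemma pluecker_cases: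
  assumes "u \<in> pluecker_coords L'"
  obtains b :: "'m \<Rightarrow> complex ^ ('d option + 'm)" where "inj b" "vec.independent (range b)" "vec.span (range b) = L'"
    "\<And>\<rho>. pluecker_form \<rho> u = det (\<chi> i j. bdot (\<rho> j) (b i))"
proof -
  obtain b :: "'m \<Rightarrow> complex ^ ('d option + 'm)" where b: "inj b" "vec.independent (range b)" "vec.span (range b) = L'"
    "u = (\<chi> \<phi>. det (\<chi> i j. b i $ \<phi> j))" using assms unfolding pluecker_coords_def by blast
  show ?thesis by (rule that[OF b(1-3)]) (simp only: b(4) pluecker_form_eq)
qed

text \<open>
  The vector of the forms \<open>rho1 j0 k\<close>, for fixed \<open>j0\<close>, recovers the hyperplane from the
  Pluecker coordinates of the reflected space.
\<close>

definition recover :: "'m \<Rightarrow> complex ^ ('m \<Rightarrow> 'd option + 'm) \<Rightarrow> complex ^ ('d option)" where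
  "recover j0 u = (\<chi> k. pluecker_form (rho1 j0 k) u)"

lemma recover_multiple:
  assumes "u \<in> pluecker_coords (refl h)"
  shows "\<exists>c. recover j0 u = c *s h"
proof -
  obtain b :: "'m \<Rightarrow> complex ^ ('d option + 'm)" where b: "vec.span (range b) = refl h"
    "\<And>\<rho>. pluecker_form \<rho> u = det (\<chi> i j. bdot (\<rho> j) (b i))"
    using pluecker_cases[OF assms] by metis
  have "\<forall>i. \<exists>c. theta (b i) = c *s h"
    using theta_refl b(1) by (metis rangeI vec.span_base)
  then obtain \<beta> where \<beta>: "\<And>i. theta (b i) = \<beta> i *s h" by metis
  have "recover j0 u $ k = det (\<chi> j i. if j = j0 then \<beta> i else b i $ Inr j) * h $ k" for k
  proof -
    have "recover j0 u $ k = det (\<chi> i j. if j = j0 then theta (b i) $ k else b i $ Inr j)"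
      by (simp add: recover_def b(2) bdot_rho1)
    also have "\<dots> = det (transpose (\<chi> i j. if j = j0 then theta (b i) $ k else b i $ Inr j))"
      by (simp add: det_transpose)
    also have "transpose (\<chi> i j. if j = j0 then theta (b i) $ k else b i $ Inr j) =
        (\<chi> j. if j = j0 then h $ k *s (\<chi> i. \<beta> i) else (\<chi> i. b i $ Inr j))"
      by (simp add: transpose_def vec_eq_iff \<beta>)
    also have "det \<dots> = h $ k * det (\<chi> j. if j = j0 then (\<chi> i. \<beta> i) else (\<chi> i. b i $ Inr j))"
      by (rule det_row_mul)
    also have "(\<chi> j. if j = j0 then (\<chi> i. \<beta> i) else (\<chi> i. b i $ Inr j)) =
        (\<chi> j i. if j = j0 then \<beta> i else b i $ Inr j)"
      by (simp add: vec_eq_iff)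
    finally show ?thesis by (simp add: mult.commute)
  qed
  then show ?thesis
    by (intro exI[of _ "det (\<chi> j i. if j = j0 then \<beta> i else b i $ Inr j)"]) (simp add: vec_eq_iff)
qed

text \<open>The y-coordinates together with \<open>theta\<close> determine a vector, so adding the
  column \<beta> to the matrix of y-coordinates gives full rank. As \<beta> is nonzero by
  genericity, it can be exchanged for some y-column without losing rank.\<close>

lemma recover_nz:
  assumes h: "on_cay h" "generic h" and u: "u \<in> pluecker_coords (refl h)"
  shows "\<exists>j0. recover j0 u \<noteq> 0"
proof -
  obtain b :: "'m \<Rightarrow> complex ^ ('d option + 'm)" where b: "inj b" "vec.independent (range b)" "vec.span (range b) = refl h"
    "\<And>\<rho>. pluecker_form \<rho> u = det (\<chi> i j. bdot (\<rho> j) (b i))"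
    using pluecker_cases[OF u] by metis
  obtain k where k: "h $ k \<noteq> 0" using h(1) by (auto simp: on_cay_def vec_eq_iff)
  define \<beta> where "\<beta> i = theta (b i) $ k" for i
  define A where "A = (\<chi> i j. b i $ Inr j)"
  have inj: "x = 0" if x: "\<And>j. (\<Sum>i\<in>UNIV. x $ i * b i $ Inr j) = 0" "(\<Sum>i\<in>UNIV. x $ i * \<beta> i) = 0" for x :: "complex ^ 'm"
  proof -
    define z where "z = (\<Sum>i\<in>UNIV. x $ i *s b i)"
    have zr: "z \<in> refl h" unfolding z_def b(3)[symmetric] span_family by blast
    have z0: "z $ Inr j = 0" for j using x(1) by (simp add: z_def)
    then have "theta z = px z" by (simp add: theta_def)
    have th_k: "theta z $ k = (\<Sum>i\<in>UNIV. x $ i * \<beta> i)"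
      by (simp only: z_def theta_sum \<beta>_def)
    obtain c where "theta z = c *s h" using theta_refl[OF zr] by blast
    then have "theta z = 0" using th_k x(2) k by (simp add: vec_eq_iff)
    then have "z = 0" using theta_0_L py_inj z0 by blast
    then show ?thesis using independent_family_iff[of b] b(1,2) by (simp add: z_def vec_eq_iff)
  qed
  have "(\<chi> i. \<beta> i) \<noteq> (0 :: complex ^ 'm)"
  proof
    assume 0: "(\<chi> i. \<beta> i) = (0 :: complex ^ 'm)"
    obtain x c where xc: "x \<in> refl h" "c \<noteq> 0" "theta x = c *s h" using theta_refl_nz[OF h] by blast
    obtain y where y: "x = (\<Sum>i\<in>UNIV. y i *s b i)" using xc(1) b(3) span_family by blast
    have "theta x $ k = 0" using 0 unfolding y theta_sum by (simp add: \<beta>_def vec_eq_iff)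
    then show False using xc k by simp
  qed
  note \<beta>0 = this
  \<comment> \<open>A relation between the y-columns and \<beta>; any y-column with nonzero
    coefficient in it can be the exchanged one.\<close>
  have "\<exists>c \<kappa>. c \<noteq> 0 \<and> A *v c = \<kappa> *s (\<chi> i. \<beta> i)"
  proof (cases "det A = 0")
    case True
    then show ?thesis using det_eq_0_iff_kernel[of A] by (metis vec.scale_zero_left)
  next
    case False
    then obtain c where c: "A *v c = (\<chi> i. \<beta> i)" using cramer[of A] by blast
    then have "c \<noteq> 0" using \<beta>0 by (metis matrix_vector_mult_0_right)
    then show ?thesis using c by (metis vec.scale_one)
  qed
  then obtain c \<kappa> where c: "c \<noteq> 0" "A *v c = \<kappa> *s (\<chi> i. \<beta> i)" by blast
  then obtain j0 where j0: "c $ j0 \<noteq> 0" by (auto simp: vec_eq_iff)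
  have ci: "(\<Sum>j\<in>UNIV. b i $ Inr j * c $ j) = \<kappa> * \<beta> i" for i
    using arg_cong[OF c(2), of "\<lambda>x. x $ i"] by (simp add: A_def matrix_vector_mult_def)
  have "det (\<chi> i j. if j = j0 then \<beta> i else b i $ Inr j) \<noteq> 0"
  proof
    assume "det (\<chi> i j. if j = j0 then \<beta> i else b i $ Inr j) = 0"
    then obtain x :: "complex ^ 'm" where x: "x \<noteq> 0" "\<And>j. (\<Sum>i\<in>UNIV. x $ i * (if j = j0 then \<beta> i else b i $ Inr j)) = 0"
      unfolding det_eq_0_iff_kernel_left by auto
    have 1: "(\<Sum>i\<in>UNIV. x $ i * \<beta> i) = 0" using x(2)[of j0] by simp
    have 2: "(\<Sum>i\<in>UNIV. x $ i * b i $ Inr j) = 0" if "j \<noteq> j0" for j using x(2)[of j] that by simp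
    have "(\<Sum>j\<in>UNIV. c $ j * (\<Sum>i\<in>UNIV. x $ i * b i $ Inr j)) = (\<Sum>i\<in>UNIV. x $ i * (\<Sum>j\<in>UNIV. b i $ Inr j * c $ j))"
      unfolding sum_distrib_left by (subst sum.swap) (simp add: mult_ac)
    also have "\<dots> = \<kappa> * (\<Sum>i\<in>UNIV. x $ i * \<beta> i)" by (simp only: ci) (simp add: sum_distrib_left mult_ac)
    also have "\<dots> = 0" using 1 by simp
    finally have "(\<Sum>j\<in>UNIV. c $ j * (\<Sum>i\<in>UNIV. x $ i * b i $ Inr j)) = 0" .
    moreover have "(\<Sum>j\<in>UNIV. c $ j * (\<Sum>i\<in>UNIV. x $ i * b i $ Inr j)) = (\<Sum>j\<in>{j0}. c $ j * (\<Sum>i\<in>UNIV. x $ i * b i $ Inr j))"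
      using 2 by (intro sum.mono_neutral_right) auto
    ultimately have "(\<Sum>i\<in>UNIV. x $ i * b i $ Inr j0) = 0" using j0 by simp
    then have "(\<Sum>i\<in>UNIV. x $ i * b i $ Inr j) = 0" for j using 2 by (cases "j = j0") auto
    then show False using inj 1 x(1) by blast
  qed
  then have "recover j0 u $ k \<noteq> 0" by (simp add: recover_def b(4) bdot_rho1 \<beta>_def cong: if_cong)
  then show ?thesis by (metis zero_index)
qed

lemma det_rho2_T:
  assumes "L' \<in> T" "u \<in> pluecker_coords L'" "j0 \<noteq> j1"
  shows "pluecker_form (rho2 j0 k j1 k') u = 0"
proof -
  obtain h where h: "refl h = L'" using T_is_refl[OF assms(1)] by blast
  obtain b :: "'m \<Rightarrow> complex ^ ('d option + 'm)" where b: "vec.span (range b) = refl h"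
    "\<And>\<rho>. pluecker_form \<rho> u = det (\<chi> i j. bdot (\<rho> j) (b i))"
    using pluecker_cases[OF assms(2)] h by metis
  have "\<forall>i. \<exists>c. theta (b i) = c *s h"
    using theta_refl b(1) by (metis rangeI vec.span_base)
  then obtain \<beta> where \<beta>: "\<And>i. theta (b i) = \<beta> i *s h" by metis
  \<comment> \<open>Columns j0 and j1 are \<open>h $ k\<close> and \<open>h $ k'\<close> times the
    same vector \<beta>. This is the relation between them, and when \<open>h $ k\<close> is zero,
    column j0 is already zero.\<close>
  define c :: "complex ^ 'm" where "c = (if h $ k = 0 then axis j0 1 else
    (\<chi> j. if j = j0 then h $ k' else if j = j1 then - (h $ k) else 0))"
  have "c $ j0 \<noteq> 0 \<or> c $ j1 \<noteq> 0" using assms(3) by (auto simp: c_def axis_def)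
  then have "c \<noteq> 0" by auto
  moreover have "(\<chi> i j. bdot (rho2 j0 k j1 k' j) (b i)) *v c = 0"
  proof -
    have "(\<Sum>j\<in>UNIV. bdot (rho2 j0 k j1 k' j) (b i) * c $ j) = 0" for i
    proof -
      have "(\<Sum>j\<in>UNIV. bdot (rho2 j0 k j1 k' j) (b i) * c $ j) = (\<Sum>j\<in>{j0, j1}. bdot (rho2 j0 k j1 k' j) (b i) * c $ j)"
        by (intro sum.mono_neutral_right) (auto simp: c_def axis_def)
      also have "\<dots> = 0" using assms(3) by (auto simp: c_def axis_def bdot_rho2 bdot_rho1 \<beta>)
      finally show ?thesis .
    qed
    then show ?thesis by (simp add: vec_eq_iff matrix_vector_mult_def)
  qed
  ultimately show ?thesis unfolding b(2) det_eq_0_iff_kernel by blast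
qed

section \<open>The closure of the set of spaces meeting L in codimension one\<close>

abbreviation "RDK \<equiv> RDK_curve a \<alpha> L"

lemma RDK_iff: "L' \<in> RDK \<longleftrightarrow> L' \<in> F_set a \<alpha> \<and> pluecker_coords L' \<noteq> {} \<and>
    (\<forall>e f. hom_poly e f \<longrightarrow> (\<exists>u\<in>pluecker_coords L'. f u \<noteq> 0) \<longrightarrow> (\<exists>s\<in>T. \<exists>u\<in>pluecker_coords s. f u \<noteq> 0))"
proof -
  have "T \<inter> F_set a \<alpha> = T" by (auto simp: T_def)
  then show ?thesis
    unfolding RDK_curve_def T_def[symmetric] zariski_closure_iff[OF proj_coords_pluecker] by simp
qed

lemma T_RDK: "T \<subseteq> RDK"
  unfolding subset_iff RDK_iff
  using T_F F_sub F_dim pluecker_coords_nonempty by blast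

text \<open>
  These relations say that \<open>theta\<close> has rank at most one on every member of the closure of \<open>T\<close>;
  by Cramer's rule, a member on which some \<open>rho1\<close> form is nonzero lies in \<open>T\<close>.
\<close>

lemma det_rho2_RDK:
  assumes "L' \<in> RDK" "u \<in> pluecker_coords L'" "j0 \<noteq> j1"
  shows "pluecker_form (rho2 j0 k j1 k') u = 0"
proof (rule ccontr)
  assume "\<not> ?thesis"
  then obtain s w where "s \<in> T" "w \<in> pluecker_coords s" "pluecker_form (rho2 j0 k j1 k') w \<noteq> 0"
    using assms(1,2) hom_poly_pluecker_form unfolding RDK_iff by blast
  then show False using det_rho2_T assms(3) by blast
qed

lemma recover_imp_T:
  assumes L': "L' \<in> RDK" and u: "u \<in> pluecker_coords L'" and k: "recover j0 u $ k \<noteq> 0"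
  shows "L' \<in> T"
proof -
  have F: "L' \<in> F_set a \<alpha>" using L' by (simp add: RDK_iff)
  obtain b :: "'m \<Rightarrow> complex ^ ('d option + 'm)" where b: "vec.span (range b) = L'"
    "\<And>\<rho>. pluecker_form \<rho> u = det (\<chi> i j. bdot (\<rho> j) (b i))"
    using pluecker_cases[OF u] by metis
  define A where "A = (\<chi> i j. bdot (rho1 j0 k j) (b i))"
  have A0: "det A \<noteq> 0" using k by (simp add: recover_def b(2) A_def)
  have "\<exists>c. \<forall>i. theta (b i) $ k' = c * theta (b i) $ k" for k'
  proof -
    define w where "w = (\<chi> i. theta (b i) $ k')"
    \<comment> \<open>The numerators in Cramer's rule are values of \<open>rho2\<close> forms and
      vanish except at j0, so coordinate k' of \<open>theta\<close> is a fixed multiple of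
      coordinate k.\<close>
    define x where "x = (\<chi> j1. det (\<chi> i j. if j = j1 then w $ i else A $ i $ j) / det A)"
    have Ax: "A *v x = w" using cramer[OF A0] x_def by blast
    have "x $ j1 = 0" if "j1 \<noteq> j0" for j1
    proof -
      have "(\<chi> i j. if j = j1 then w $ i else A $ i $ j) = (\<chi> i j. bdot (rho2 j0 k j1 k' j) (b i))"
        by (simp add: vec_eq_iff bdot_rho2 A_def w_def)
      then show ?thesis using det_rho2_RDK[OF L' u, of j0 j1 k k'] that by (simp add: x_def b(2))
    qed
    then have "(A *v x) $ i = (\<Sum>j\<in>{j0}. A $ i $ j * x $ j)" for i
      unfolding matrix_vector_mult_def vec_lambda_beta by (intro sum.mono_neutral_right) auto
    then have "theta (b i) $ k' = x $ j0 * theta (b i) $ k" for i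
      using arg_cong[OF Ax, of "\<lambda>y. y $ i"] by (simp add: w_def A_def bdot_rho1 mult.commute)
    then show ?thesis by blast
  qed
  then obtain h where h: "\<And>k' i. theta (b i) $ k' = h k' * theta (b i) $ k" by metis
  have all: "theta x = theta x $ k *s (\<chi> k'. h k')" if "x \<in> L'" for x
  proof -
    have "x \<in> vec.span (range b)" unfolding b(1) by (rule that)
    then obtain y where y: "x = (\<Sum>i\<in>UNIV. y i *s b i)" unfolding span_family by (elim exE)
    have lin: "theta x $ k' = (\<Sum>i\<in>UNIV. y i * theta (b i) $ k')" for k'
      unfolding y by (rule theta_sum)
    have "theta x $ k' = theta x $ k * h k'" for k'
    proof -
      have "y i * theta (b i) $ k' = y i * theta (b i) $ k * h k'" for i
        unfolding h[of i k'] by (simp only: mult.commute mult.left_commute)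
      then show ?thesis unfolding lin[of k'] lin[of k] sum_distrib_right by (rule sum.cong[OF refl])
    qed
    then show ?thesis unfolding vec_eq_iff vector_smult_component vec_lambda_beta by blast
  qed
  have "\<exists>i. theta (b i) $ k \<noteq> 0"
  proof (rule ccontr)
    assume "\<not> ?thesis"
    then have "A *v axis j0 1 = 0" by (simp add: A_def vec_eq_iff matrix_vector_mult_def bdot_rho1 axis_def
        if_distrib[of "\<lambda>x. _ * x"] cong: if_cong)
    then show False using A0 det_eq_0_iff_kernel[of A] by (metis axis_eq_0_iff zero_neq_one)
  qed
  then obtain i where i: "theta (b i) $ k \<noteq> 0" by blast
  have bi: "b i \<in> L'" using b(1) by (metis rangeI vec.span_base)
  have "vec.dim L' = vec.dim (L \<inter> L') + 1"
  proof (rule dim_hyperplane_in[OF F_sub[OF F] _ _ bi])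
    show "vec.subspace (L \<inter> L')" by (intro vec.subspace_inter subL F_sub[OF F])
    show "b i \<notin> L \<inter> L'" using theta_L i by force
  next
    fix x assume x: "x \<in> L'"
    define c where "c = theta x $ k / theta (b i) $ k"
    have y: "x - c *s b i \<in> L'"
      using x bi vec.subspace_diff[OF F_sub[OF F]] vec.subspace_scale[OF F_sub[OF F]] by blast
    have "theta (x - c *s b i) $ k = 0" using i by (simp add: theta_linear c_def)
    then have "theta (x - c *s b i) = 0" using all[OF y] by (metis vec.scale_zero_left)
    then show "\<exists>c. x - c *s b i \<in> L \<inter> L'" using y theta_0_L by blast
  qed simp
  then show ?thesis using F F_dim[OF F] by (simp add: T_iff)
qed

end

section \<open>Density of the generic tangent hyperplanes\<close>

text \<open>The product of the two roots is \<open>a / c\<close>, so the smaller one has squared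
  norm at most that of the product.\<close>

lemma small_root:
  fixes a b c :: complex
  assumes "c \<noteq> 0"
  shows "\<exists>t. a + 2 * b * t + c * t\<^sup>2 = 0 \<and> (norm t)\<^sup>2 \<le> norm (a / c)"
proof -
  define y where "y = csqrt (b\<^sup>2 - a * c)"
  have y2: "y * y = b * b - a * c" using power2_csqrt[of "b\<^sup>2 - a * c"] by (simp add: y_def power2_eq_square)
  define t1 where "t1 = (- b + y) / c"
  define t2 where "t2 = (- b - y) / c"
  have ct: "c * t1 = - b + y" "c * t2 = - b - y" using assms by (simp_all add: t1_def t2_def)
  have sq: "c * (a + 2 * b * t + c * t\<^sup>2) = a * c + 2 * b * (c * t) + (c * t) * (c * t)" for t
    by (simp add: power2_eq_square algebra_simps)
  have "c * (a + 2 * b * t1 + c * t1\<^sup>2) = 0" "c * (a + 2 * b * t2 + c * t2\<^sup>2) = 0"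
    unfolding sq ct using y2 by (simp_all add: algebra_simps)
  then have 1: "a + 2 * b * t1 + c * t1\<^sup>2 = 0" "a + 2 * b * t2 + c * t2\<^sup>2 = 0" using assms by simp_all
  have "c * (c * (t1 * t2)) = (c * t1) * (c * t2)" by (simp add: mult_ac)
  also have "\<dots> = c * a" unfolding ct using y2 by (simp add: algebra_simps)
  finally have "t1 * t2 = a / c" using assms by (simp add: field_simps)
  then have "norm t1 * norm t2 = norm (a / c)" by (metis norm_mult)
  then have "(norm t1)\<^sup>2 \<le> norm (a / c) \<or> (norm t2)\<^sup>2 \<le> norm (a / c)"
    by (metis linear mult_left_mono mult_right_mono norm_ge_zero power2_eq_square)
  then show ?thesis using 1 by blast
qed

lemma eventually_avoids_finite:
  fixes x :: "nat \<Rightarrow> 'a"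
  assumes "inj x" "finite B"
  shows "eventually (\<lambda>n. x n \<notin> B) sequentially"
proof -
  have "finite {n. x n \<in> B}" using finite_vimageI[OF assms(2,1)] by (simp add: vimage_def)
  then show ?thesis by (metis (mono_tags, lifting) eventually_cofinite cofinite_eq_sequentially mem_Collect_eq not_not Collect_cong)
qed

lemma hom_poly_tendsto:
  assumes "hom_poly dg F" "(x \<longlongrightarrow> l) net"
  shows "((\<lambda>n. F (x n)) \<longlongrightarrow> F l) net"
  using hom_poly_continuous[OF assms(1), of UNIV] assms(2)
  by (intro isCont_tendsto_compose[of l F]) (auto simp: continuous_on_eq_continuous_at)

lemma scaleR_eq_scale: "r *\<^sub>R h = complex_of_real r *s (h :: complex ^ 'n::finite)"
  by (simp add: vec_eq_iff scaleR_conv_of_real[where 'a = complex])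

context confocal_line
begin

lemma hP_nz: "\<mu> \<notin> poles \<Longrightarrow> X \<noteq> 0 \<Longrightarrow> hP \<mu> X \<noteq> 0"
  using polar_hP polar_linear(3) by metis

lemma pen_hP: "\<mu> \<notin> poles \<Longrightarrow> pen a 1 (- \<mu>) x (hP \<mu> X) = bdot x X"
  by (simp add: pen_def polar_hP)

lemma on_cay_hP:
  assumes "\<mu> \<notin> poles" "X \<in> ell" "X \<noteq> 0" "bdot X (hP \<mu> X) = 0"
  shows "on_cay (hP \<mu> X)"
  unfolding on_cay_def
  using hP_nz[OF assms(1,3)] pen_hP[OF assms(1), of "hP \<mu> X" X] assms
  by (intro conjI exI[of _ 1] exI[of _ "- \<mu>"]) (auto simp: polar_hP bdot_commute[of _ X])

lemma ex_on_quadric: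
  assumes "\<mu> \<notin> poles"
  shows "\<exists>X\<in>ell. X \<noteq> 0 \<and> bdot X (hP \<mu> X) = 0"
proof (cases "bdot f (hP \<mu> f) = 0")
  case True
  then show ?thesis using f_ell f_nz by blast
next
  case False
  obtain t where t: "bdot e (hP \<mu> e) + 2 * bdot e (hP \<mu> f) * t + bdot f (hP \<mu> f) * t\<^sup>2 = 0"
    using small_root[OF False] by blast
  have "e + t *s f \<in> ell" using ell_iff[of "e + t *s f"] by (metis vec.scale_one)
  moreover have "e + t *s f \<noteq> 0" by (auto simp: vec_eq_option_iff)
  moreover have "bdot (e + t *s f) (hP \<mu> (e + t *s f)) = 0"
    using t bdot_hP_commute[of f \<mu> e] by (simp add: hP_linear bdot_simps power2_eq_square algebra_simps)
  ultimately show ?thesis by blast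
qed

text \<open>
  In a basis of the line starting with the given point, the constant coefficient of the equation
  for the points on a nearby quadric is small, hence so is the product of its roots.
\<close>

lemma dense_regular:
  assumes \<mu>: "\<mu> \<notin> poles" and P: "P \<in> ell" "P \<noteq> 0" "bdot P (hP \<mu> P) = 0"
    and F: "hom_poly dg F" "F (hP \<mu> P) \<noteq> 0" and B: "finite B" "poles \<subseteq> B"
  shows "\<exists>\<mu>' P'. \<mu>' \<notin> B \<and> P' \<in> ell \<and> P' \<noteq> 0 \<and> bdot P' (hP \<mu>' P') = 0 \<and> F (hP \<mu>' P') \<noteq> 0"
proof -
  obtain X where X: "X \<in> ell" "bdot X (hP \<mu> X) \<noteq> 0" using ell_not_in_quadric[OF \<mu>] by blast
  define m where "m n = \<mu> + 1 / of_nat (Suc n)" for n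
  have "inj m" by (auto simp: m_def inj_def)
  then have evB: "eventually (\<lambda>n. m n \<notin> B) sequentially" using eventually_avoids_finite B(1) by blast
  have m: "m \<longlonglongrightarrow> \<mu>"
    using tendsto_add[OF tendsto_const LIMSEQ_inverse_real_of_nat[THEN tendsto_of_real, where 'a=complex]]
    by (simp add: m_def[abs_def] inverse_eq_divide)
  have hPlim: "(\<lambda>n. hP (m n) (Y n)) \<longlonglongrightarrow> hP \<mu> l" if "Y \<longlonglongrightarrow> l" for Y l
  proof (rule vec_tendstoI)
    fix k
    have "(\<lambda>n. wt a 1 (- m n) k) \<longlonglongrightarrow> wt a 1 (- \<mu>) k"
      by (cases k) (auto intro!: tendsto_intros m)
    then show "(\<lambda>n. hP (m n) (Y n) $ k) \<longlonglongrightarrow> hP \<mu> l $ k"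
      unfolding hP_def vec_lambda_beta by (intro tendsto_divide tendsto_vec_nth that wt_regular[OF \<mu>])
  qed
  have bl: "(\<lambda>n. bdot Y (hP (m n) Z)) \<longlonglongrightarrow> bdot Y (hP \<mu> Z)" for Y Z
    unfolding bdot_def by (intro tendsto_sum tendsto_mult tendsto_const tendsto_vec_nth hPlim)
  define c where "c n = bdot X (hP (m n) X)" for n
  define b where "b n = bdot P (hP (m n) X)" for n
  define d where "d n = bdot P (hP (m n) P)" for n
  have c: "c \<longlonglongrightarrow> bdot X (hP \<mu> X)" and d: "d \<longlonglongrightarrow> 0"
    using bl[of X X] bl[of P P] P(3) by (simp_all add: c_def[abs_def] d_def[abs_def])
  have evc: "eventually (\<lambda>n. c n \<noteq> 0) sequentially"
    using tendsto_imp_eventually_ne[OF c X(2)] .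
  have "\<forall>n. \<exists>t. c n \<noteq> 0 \<longrightarrow> d n + 2 * b n * t + c n * t\<^sup>2 = 0 \<and> (norm t)\<^sup>2 \<le> norm (d n / c n)"
    using small_root by blast
  then obtain t where t: "\<And>n. c n \<noteq> 0 \<Longrightarrow> d n + 2 * b n * t n + c n * (t n)\<^sup>2 = 0"
    "\<And>n. c n \<noteq> 0 \<Longrightarrow> (norm (t n))\<^sup>2 \<le> norm (d n / c n)" by metis
  have dc: "(\<lambda>n. norm (d n / c n)) \<longlonglongrightarrow> 0"
    using tendsto_norm[OF tendsto_divide[OF d c X(2)]] by simp
  have "(\<lambda>n. (norm (t n))\<^sup>2) \<longlonglongrightarrow> 0"
    by (rule tendsto_sandwich[OF _ _ tendsto_const dc]) (use evc t(2) in \<open>auto elim: eventually_mono\<close>)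
  then have "(\<lambda>n. sqrt ((norm (t n))\<^sup>2)) \<longlonglongrightarrow> sqrt 0" by (rule tendsto_real_sqrt)
  then have t0: "t \<longlonglongrightarrow> 0" by (simp add: tendsto_norm_zero_iff)
  define Q where "Q n = P + t n *s X" for n
  have "Q \<longlonglongrightarrow> P"
  proof (rule vec_tendstoI)
    fix k
    have "(\<lambda>n. P $ k + t n * X $ k) \<longlonglongrightarrow> P $ k + 0 * X $ k" by (intro tendsto_intros t0)
    then show "(\<lambda>n. Q n $ k) \<longlonglongrightarrow> P $ k" by (simp add: Q_def)
  qed
  then have "(\<lambda>n. F (hP (m n) (Q n))) \<longlonglongrightarrow> F (hP \<mu> P)"
    by (intro hom_poly_tendsto[OF F(1)] hPlim)
  then have evF: "eventually (\<lambda>n. F (hP (m n) (Q n)) \<noteq> 0) sequentially"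
    using tendsto_imp_eventually_ne F(2) by blast
  obtain n where n: "m n \<notin> B" "c n \<noteq> 0" "F (hP (m n) (Q n)) \<noteq> 0"
    using eventually_happens[OF eventually_conj[OF evB eventually_conj[OF evc evF]]] by auto
  have "Q n \<in> ell" unfolding Q_def using P(1) X(1) sub_ell vec.subspace_add vec.subspace_scale by blast
  moreover have "Q n \<noteq> 0"
  proof
    assume 0: "Q n = 0"
    then have Peq: "P = - t n *s X" by (simp add: Q_def eq_neg_iff_add_eq_0)
    then have "t n \<noteq> 0" using P(2) by auto
    have "bdot P (hP \<mu> P) = (t n)\<^sup>2 * bdot X (hP \<mu> X)"
      unfolding Peq hP_linear bdot_simps by (simp add: power2_eq_square)
    then show False using P(3) X(2) \<open>t n \<noteq> 0\<close> by simp
  qed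
  moreover have "bdot (Q n) (hP (m n) (Q n)) = 0"
    using t(1)[OF n(2)] bdot_hP_commute[of X "m n" P]
    by (simp add: Q_def hP_linear bdot_simps power2_eq_square b_def c_def d_def algebra_simps)
  ultimately show ?thesis using n by blast
qed

text \<open>
  A limit of normalized coordinate vectors, which exists by compactness, is a multiple of the
  basis vector by \<open>degenerate_axis\<close>.
\<close>

lemma dense_degenerate:
  assumes st: "(s, t) \<noteq> (0, 0)" and k: "wt a s t k = 0" and h: "h \<noteq> 0" "h = c *s axis k 1"
    and F: "hom_poly dg F" "F h \<noteq> 0" and B: "finite B" "poles \<subseteq> B"
    and sn: "sn \<longlonglongrightarrow> s" "tn \<longlonglongrightarrow> t" "\<And>n. sn n \<noteq> 0" "inj (\<lambda>n. - (tn n / sn n))"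
  shows "\<exists>\<mu>' P'. \<mu>' \<notin> B \<and> P' \<in> ell \<and> P' \<noteq> 0 \<and> bdot P' (hP \<mu>' P') = 0 \<and> F (hP \<mu>' P') \<noteq> 0"
proof (rule ccontr)
  assume no: "\<not> ?thesis"
  define m where "m n = - (tn n / sn n)" for n
  have evB: "eventually (\<lambda>n. m n \<notin> B) sequentially"
    using eventually_avoids_finite[OF sn(4) B(1)] by (simp add: m_def)
  then obtain N where N: "\<And>n. n \<ge> N \<Longrightarrow> m n \<notin> B" by (auto simp: eventually_sequentially)
  have "\<forall>n. \<exists>X. X \<in> ell \<and> X \<noteq> 0 \<and> bdot X (hP (m (n + N)) X) = 0"
    using ex_on_quadric N B(2) by (metis le_add2 subsetD)
  then obtain X where X: "\<And>n. X n \<in> ell" "\<And>n. X n \<noteq> 0" "\<And>n. bdot (X n) (hP (m (n + N)) (X n)) = 0" by metis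
  have reg: "m (n + N) \<notin> poles" for n using N[of "n + N"] B(2) by (metis le_add2 subsetD)
  \<comment> \<open>The vectors \<open>hP\<close> may blow up as the parameter tends to a pole or to
    infinity, so they are normalised to the unit sphere.\<close>
  define g where "g n = (1 / norm (hP (m (n + N)) (X n))) *\<^sub>R hP (m (n + N)) (X n)" for n
  have hnz: "hP (m (n + N)) (X n) \<noteq> 0" for n using hP_nz[OF reg X(2)] .
  have g1: "norm (g n) = 1" for n using hnz[of n] by (simp add: g_def)
  have gF: "F (g n) = 0" for n
    using no N[of "n + N"] X[of n] unfolding g_def scaleR_eq_scale hom_poly_scale[OF F(1)] by auto
  \<comment> \<open>Rescaling the member by \<open>sn\<close> keeps its coefficients convergent even
    when the limiting member has s = 0.\<close>
  have gst: "pen a (sn (n + N)) (tn (n + N)) x (g n) =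
     sn (n + N) * (complex_of_real (1 / norm (hP (m (n + N)) (X n))) * bdot x (X n))" for n x
  proof -
    have "pen a (sn (n + N)) (tn (n + N)) x y = sn (n + N) * pen a 1 (- m (n + N)) x y" for y
      using sn(3)[of "n + N"] unfolding pen_split[of a _ "tn (n + N)"] pen_split[of a 1 "- m (n + N)"]
      by (simp add: m_def field_simps)
    then show ?thesis unfolding g_def scaleR_eq_scale by (simp add: pen_linear(6) pen_hP[OF reg])
  qed
  have g2: "pen a (sn (n + N)) (tn (n + N)) (px z) (g n) = 0" if "z \<in> L" for z n
    using gst[of n "px z"] in_ell[of "X n"] X(1) that by simp
  have g3: "pen a (sn (n + N)) (tn (n + N)) (g n) (g n) = 0" for n
    unfolding gst using X(3)[of n]
    by (simp add: g_def scaleR_eq_scale bdot_simps bdot_commute[of _ "X n"])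
  have "\<forall>n. g n \<in> sphere 0 1" using g1 by simp
  then obtain l r where r: "strict_mono r" "(g \<circ> r) \<longlonglongrightarrow> l" "l \<in> sphere 0 1"
    using compact_sphere[of 0 1, unfolded compact_def] by metis
  have shift: "(\<lambda>n. r n + N) = (\<lambda>n. n + N) \<circ> r" by auto
  have "strict_mono (\<lambda>n. r n + N)" using r(1) by (simp add: strict_mono_def)
  then have sr: "(\<lambda>n. sn (r n + N)) \<longlonglongrightarrow> s" "(\<lambda>n. tn (r n + N)) \<longlonglongrightarrow> t"
    using LIMSEQ_subseq_LIMSEQ[OF sn(1)] LIMSEQ_subseq_LIMSEQ[OF sn(2)] by (auto simp: comp_def)
  have lim: "(\<lambda>n. pen a (sn (r n + N)) (tn (r n + N)) (x n) (g (r n))) \<longlonglongrightarrow> pen a s t x0 l" if "x \<longlonglongrightarrow> x0" for x x0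
  proof -
    have gl: "(\<lambda>n. g (r n)) \<longlonglongrightarrow> l" using r(2) by (simp add: comp_def)
    have "(\<lambda>n. wt a (sn (r n + N)) (tn (r n + N)) k) \<longlonglongrightarrow> wt a s t k" for k
      by (cases k) (auto intro!: tendsto_intros sr)
    then show ?thesis unfolding pen_def bdot_def polar_nth
      by (intro tendsto_sum tendsto_mult tendsto_vec_nth gl that)
  qed
  have "pen a s t (px z) l = 0" if "z \<in> L" for z
    using lim[OF tendsto_const, of "px z"] LIMSEQ_unique[OF _ tendsto_const] g2[OF that] by simp
  then have "polar a s t l \<in> ell" by (simp add: polar_in_ell)
  moreover have "pen a s t l l = 0"
    using lim[of "\<lambda>n. g (r n)" l] r(2) g3 LIMSEQ_unique[OF _ tendsto_const] by (simp add: comp_def)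
  ultimately obtain c' where c': "l = c' *s axis k 1" using degenerate_axis[OF st k] by blast
  have "c' \<noteq> 0" using r(3) c' by auto
  moreover have "c \<noteq> 0" using h by auto
  moreover have "l = (c' / c) *s h" using c' h(2) \<open>c \<noteq> 0\<close> by simp
  ultimately have "F l \<noteq> 0" using F(2) hom_poly_scale[OF F(1)] by simp
  moreover have "(\<lambda>n. F (g (r n))) \<longlonglongrightarrow> F l"
    using hom_poly_tendsto[OF F(1) r(2)] by (simp add: comp_def)
  then have "F l = 0" using gF LIMSEQ_unique[OF _ tendsto_const] by simp
  ultimately show False by blast
qed

text \<open>By \<open>degenerate_axis\<close> a witnessing member with a zero weight forces h to be
  a coordinate vector. Otherwise \<open>- t / s\<close> is a regular parameter and the rescaled
  polar of h is the point of contact.\<close>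

lemma on_cay_regular:
  assumes h: "on_cay h" and no: "\<And>k. \<nexists>c. h = c *s axis k 1"
  shows "\<exists>\<mu> P. \<mu> \<notin> poles \<and> P \<in> ell \<and> P \<noteq> 0 \<and> bdot P (hP \<mu> P) = 0 \<and> h = hP \<mu> P"
proof -
  obtain s t where st: "(s, t) \<noteq> (0, 0)" "polar a s t h \<in> ell" "pen a s t h h = 0" and h0: "h \<noteq> 0"
    using h by (auto simp: on_cay_def)
  have w: "wt a s t k \<noteq> 0" for k using degenerate_axis[OF st(1) _ st(2,3)] no by blast
  have s: "s \<noteq> 0" using w[of None] by simp
  have reg: "- t / s \<notin> poles"
  proof
    assume "- t / s \<in> poles"
    then obtain i where "- t / s = complex_of_real (a i)" by blast
    then have "s * complex_of_real (a i) = - t" using s by (simp add: field_simps)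
    then show False using w[of "Some i"] by simp
  qed
  define P where "P = polar a 1 (t / s) h"
  have eq: "polar a s t h = s *s P" using s by (simp add: P_def vec_eq_option_iff field_simps)
  have hP: "h = hP (- t / s) P" using hP_polar[OF reg, of h] by (simp add: P_def)
  have "(1 / s) *s (s *s P) \<in> ell" using st(2) sub_ell vec.subspace_scale unfolding eq by blast
  then have "P \<in> ell" using s by simp
  moreover have "P \<noteq> 0" using hP h0 by (auto simp: hP_def vec_eq_iff)
  moreover have "bdot P h = 0" using st(3) s unfolding pen_def eq by (simp add: bdot_simps bdot_commute)
  ultimately show ?thesis using reg hP by metis
qed

lemma dense_on_cay:
  assumes h: "on_cay h" and F: "hom_poly dg F" "F h \<noteq> 0" and B: "finite B" "poles \<subseteq> B"
  shows "\<exists>\<mu>' P'. \<mu>' \<notin> B \<and> P' \<in> ell \<and> P' \<noteq> 0 \<and> bdot P' (hP \<mu>' P') = 0 \<and> F (hP \<mu>' P') \<noteq> 0"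
proof (cases "\<exists>k c. h = c *s axis k 1")
  case False
  then show ?thesis using on_cay_regular[OF h] dense_regular[OF _ _ _ _ F(1) _ B] F(2) by blast
next
  case True
  then obtain k c where c: "h = c *s axis k 1" by blast
  have h0: "h \<noteq> 0" using h by (simp add: on_cay_def)
  have suc: "(\<lambda>n. 1 / of_nat (Suc n) :: complex) \<longlonglongrightarrow> 0"
    using LIMSEQ_inverse_real_of_nat[THEN tendsto_of_real, where 'a=complex] by (simp add: inverse_eq_divide)
  show ?thesis
  proof (cases k)
    case None
    show ?thesis
      \<comment> \<open>The member at infinity is approached through the parameters -1, -2, -3 and
        so on.\<close>
      by (rule dense_degenerate[OF _ _ h0 c F B, of 0 1 "\<lambda>n. 1 / of_nat (Suc n)" "\<lambda>_. 1"])
        (use None suc in \<open>auto simp: inj_def simp del: of_nat_Suc\<close>)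
  next
    case (Some i)
    show ?thesis
    \<comment> \<open>The pole \<open>a i\<close> is approached through the parameters
      \<open>a i - 1 / of_nat (Suc n)\<close>.\<close>
    proof (rule dense_degenerate[OF _ _ h0 c F B, of 1 "- complex_of_real (a i)" "\<lambda>n. 1" "\<lambda>n. - complex_of_real (a i) + 1 / of_nat (Suc n)"])
      have "(\<lambda>n. - complex_of_real (a i) + 1 / of_nat (Suc n)) \<longlonglongrightarrow> - complex_of_real (a i) + 0"
        by (intro tendsto_intros suc)
      then show "(\<lambda>n. - complex_of_real (a i) + 1 / of_nat (Suc n)) \<longlonglongrightarrow> - complex_of_real (a i)" by simp
    qed (use Some in \<open>auto simp: inj_def\<close>)
  qed
qed

section \<open>Nondegenerate tangent hyperplanes and finiteness of the exceptions\<close>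

definition gram :: "complex ^ ('d option) \<Rightarrow> complex" where
  "gram h = penJ f f * penJ h h - (penJ f h)\<^sup>2"

text \<open>
  Where this form does not vanish, the tangent hyperplane determines its point of contact with
  the line and its normal is neither isotropic nor orthogonal to the line; nonvanishing of the
  Gram determinant makes the reflected line the only solution of the angle condition.
\<close>

definition nondeg :: "complex ^ ('d option) \<Rightarrow> complex" where
  "nondeg h = h $ None * penJ h h * penJ f h * gram h"

lemma hom_poly_nondeg: "\<exists>dg. hom_poly dg nondeg"
proof -
  have "hom_poly 2 (\<lambda>h. (penJ f h)\<^sup>2)"
    using hom_poly_power[OF hom_poly_pen_left, of 2 0 1 f] by simp
  then have "hom_poly 2 gram"
    unfolding gram_def[abs_def] by (intro hom_poly_diff hom_poly_cmult hom_poly_pen)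
  then have "hom_poly (1 + 2 + 1 + 2) nondeg"
    unfolding nondeg_def[abs_def] by (intro hom_poly.mult hom_poly.coord hom_poly_pen hom_poly_pen_left)
  then show ?thesis by blast
qed

text \<open>
  \<open>aa\<close>, \<open>bb\<close>, \<open>cc\<close> are the coefficients, cleared of the denominator \<open>PP\<close>, of the equation for the
  intersection of the line with the quadric of parameter \<open>\<mu>\<close>, and \<open>EE\<close> is its discriminant;
  the two tangent hyperplanes are \<open>htil \<mu> y\<close> with \<open>y\<^sup>2 = EE \<mu>\<close>.
\<close>

definition PP :: "complex poly" where "PP = (\<Prod>i\<in>UNIV. [:complex_of_real (a i), -1:])"
definition PPk :: "'d \<Rightarrow> complex poly" where "PPk i = (\<Prod>i'\<in>UNIV - {i}. [:complex_of_real (a i'), -1:])"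

definition cc :: "complex poly" where "cc = (\<Sum>i\<in>UNIV. smult (complex_of_real ((v $ i)\<^sup>2)) (PPk i))"
definition bb :: "complex poly" where "bb = (\<Sum>i\<in>UNIV. smult (complex_of_real (p $ i * v $ i)) (PPk i))"
definition aa :: "complex poly" where "aa = (\<Sum>i\<in>UNIV. smult (complex_of_real ((p $ i)\<^sup>2)) (PPk i)) - PP"
definition EE :: "complex poly" where "EE = bb\<^sup>2 - aa * cc"

lemma poly_PP: "poly PP \<mu> = (complex_of_real (a i) - \<mu>) * poly (PPk i) \<mu>"
  unfolding PP_def PPk_def poly_prod by (subst prod.remove[of _ i]) auto

lemma poly_PP_nz: "\<mu> \<notin> poles \<Longrightarrow> poly PP \<mu> \<noteq> 0"
  unfolding PP_def poly_prod by auto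

lemma poly_PPk: "\<mu> \<notin> poles \<Longrightarrow> poly (PPk i) \<mu> = poly PP \<mu> / (complex_of_real (a i) - \<mu>)"
proof -
  assume "\<mu> \<notin> poles"
  then have "complex_of_real (a i) - \<mu> \<noteq> 0" by auto
  then show ?thesis using poly_PP[of \<mu> i] by simp
qed

lemma forms_poly:
  assumes "\<mu> \<notin> poles"
  shows "poly cc \<mu> = poly PP \<mu> * bdot f (hP \<mu> f)"
    "poly bb \<mu> = poly PP \<mu> * bdot e (hP \<mu> f)"
    "poly aa \<mu> = poly PP \<mu> * bdot e (hP \<mu> e)"
  unfolding cc_def bb_def aa_def bdot_option poly_sum poly_smult poly_diff poly_PPk[OF assms]
  by (simp_all add: hP_def sum_distrib_left algebra_simps power2_eq_square)

definition htil :: "complex \<Rightarrow> complex \<Rightarrow> complex ^ ('d option)" where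
  "htil \<mu> y = (\<chi> k. case k of None \<Rightarrow> - (poly cc \<mu> * poly PP \<mu>)
     | Some i \<Rightarrow> ((poly cc \<mu> * p $ i - poly bb \<mu> * v $ i) + y * v $ i) * poly (PPk i) \<mu>)"

text \<open>The point of contact is the root \<open>(y - bb) / cc\<close> of the quadratic equation,
  scaled by \<open>cc\<close>; the extra factor \<open>PP\<close> clears the denominators of
  \<open>hP\<close>.\<close>

lemma htil_eq:
  assumes "\<mu> \<notin> poles"
  shows "htil \<mu> y = hP \<mu> (poly PP \<mu> *s (poly cc \<mu> *s e + (y - poly bb \<mu>) *s f))"
  unfolding vec_eq_option_iff htil_def hP_def 
  by (simp add: poly_PPk[OF assms] algebra_simps add_divide_distrib diff_divide_distrib)

lemma quad_expand: "bdot (\<sigma> *s e + \<tau> *s f) (hP \<mu> (\<sigma> *s e + \<tau> *s f)) =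
    \<sigma>\<^sup>2 * bdot e (hP \<mu> e) + 2 * \<sigma> * \<tau> * bdot e (hP \<mu> f) + \<tau>\<^sup>2 * bdot f (hP \<mu> f)"
  using bdot_hP_commute[of f \<mu> e] by (simp add: hP_linear bdot_simps power2_eq_square algebra_simps)

lemma htil_on_quadric:
  assumes \<mu>: "\<mu> \<notin> poles" and c: "poly cc \<mu> \<noteq> 0" and y: "y\<^sup>2 = poly EE \<mu>"
  shows "\<exists>X\<in>ell. X \<noteq> 0 \<and> bdot X (hP \<mu> X) = 0 \<and> htil \<mu> y = hP \<mu> X"
proof (intro bexI conjI)
  let ?P = "poly PP \<mu>" and ?c = "poly cc \<mu>" and ?b = "poly bb \<mu>" and ?a = "poly aa \<mu>"
  let ?Y = "?c *s e + (y - ?b) *s f"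
  show "htil \<mu> y = hP \<mu> (?P *s ?Y)" by (rule htil_eq[OF \<mu>])
  show "?P *s ?Y \<in> ell" using ell_iff by (intro scale_ell) blast
  have "(?P *s ?Y) $ None \<noteq> 0" using c poly_PP_nz[OF \<mu>] by simp
  then show "?P *s ?Y \<noteq> 0" by (metis zero_index)
  have "?P * bdot ?Y (hP \<mu> ?Y) = ?c\<^sup>2 * ?a + 2 * ?c * (y - ?b) * ?b + (y - ?b)\<^sup>2 * ?c"
    unfolding quad_expand by (simp add: forms_poly[OF \<mu>] power2_eq_square algebra_simps)
  also have "\<dots> = ?c * (y\<^sup>2 - (?b\<^sup>2 - ?a * ?c))" by (simp add: power2_eq_square algebra_simps)
  also have "\<dots> = 0" using y by (simp add: EE_def)
  finally have "bdot ?Y (hP \<mu> ?Y) = 0" using poly_PP_nz[OF \<mu>] by simp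
  then show "bdot (?P *s ?Y) (hP \<mu> (?P *s ?Y)) = 0" by (simp only: hP_linear(2) bdot_scale_left bdot_scale_right mult_zero_right)
qed

lemma htil_cover:
  assumes \<mu>: "\<mu> \<notin> poles" and c: "poly cc \<mu> \<noteq> 0"
    and X: "X \<in> ell" "X \<noteq> 0" "bdot X (hP \<mu> X) = 0"
  shows "\<exists>y \<kappa>. y\<^sup>2 = poly EE \<mu> \<and> \<kappa> \<noteq> 0 \<and> hP \<mu> X = \<kappa> *s htil \<mu> y"
proof -
  let ?P = "poly PP \<mu>" and ?c = "poly cc \<mu>" and ?b = "poly bb \<mu>" and ?a = "poly aa \<mu>"
  have P0: "?P \<noteq> 0" using poly_PP_nz[OF \<mu>] .
  obtain \<sigma> \<tau> where X_eq: "X = \<sigma> *s e + \<tau> *s f" using X(1) ell_iff by blast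
  have "?P * bdot X (hP \<mu> X) = ?a * \<sigma>\<^sup>2 + 2 * ?b * \<sigma> * \<tau> + ?c * \<tau>\<^sup>2"
    unfolding X_eq quad_expand by (simp add: forms_poly[OF \<mu>] algebra_simps)
  then have eq: "?a * \<sigma>\<^sup>2 + 2 * ?b * \<sigma> * \<tau> + ?c * \<tau>\<^sup>2 = 0" using X(3) by simp
  have \<sigma>: "\<sigma> \<noteq> 0"
  proof
    assume "\<sigma> = 0"
    then have "\<tau> = 0" using eq c by simp
    then show False using \<open>\<sigma> = 0\<close> X(2) X_eq by simp
  qed
  \<comment> \<open>Completing the square turns the quadratic equation for the point into the
    equation \<open>EE\<close> for y.\<close>
  define y where "y = (?c * \<tau> + ?b * \<sigma>) / \<sigma>"
  have y\<sigma>: "y * \<sigma> = ?c * \<tau> + ?b * \<sigma>" using \<sigma> by (simp add: y_def)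
  have "(y * \<sigma>)\<^sup>2 = ?c * (?a * \<sigma>\<^sup>2 + 2 * ?b * \<sigma> * \<tau> + ?c * \<tau>\<^sup>2) + (?b\<^sup>2 - ?a * ?c) * \<sigma>\<^sup>2"
    unfolding y\<sigma> by (simp add: power2_eq_square algebra_simps)
  then have "y\<^sup>2 * \<sigma>\<^sup>2 = poly EE \<mu> * \<sigma>\<^sup>2" unfolding eq by (simp add: EE_def power_mult_distrib)
  then have "y\<^sup>2 = poly EE \<mu>" using \<sigma> by simp
  moreover have "hP \<mu> X = (\<sigma> / (?c * ?P)) *s htil \<mu> y"
  proof -
    have "(y - ?b) = ?c * \<tau> / \<sigma>" using \<sigma> by (simp add: y_def field_simps)
    then have "X = (\<sigma> / (?c * ?P)) *s (?P *s (?c *s e + (y - ?b) *s f))"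
      unfolding X_eq using \<sigma> c P0 by (simp add: vec_eq_iff field_simps)
    then show ?thesis unfolding htil_eq[OF \<mu>] by (metis hP_linear(2))
  qed
  ultimately show ?thesis using \<sigma> c P0 by (intro exI[of _ y] exI[of _ "\<sigma> / (?c * ?P)"]) simp
qed

text \<open>The coordinates of \<open>htil\<close> have the form A + y B, and products return to
  this form by reducing \<open>y\<^sup>2\<close> to \<open>EE\<close>.\<close>

lemma htil_poly:
  assumes "hom_poly dg F"
  shows "\<exists>A B. \<forall>\<mu> y. y\<^sup>2 = poly EE \<mu> \<longrightarrow> F (htil \<mu> y) = poly A \<mu> + y * poly B \<mu>"
  using assms
proof (induction rule: hom_poly.induct)
  case (const c)
  show ?case by (rule exI[of _ "[:c:]"], rule exI[of _ 0]) simp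
next
  case (coord k)
  show ?case
  proof (cases k)
    case None
    then show ?thesis by (intro exI[of _ "- (cc * PP)"] exI[of _ 0]) (simp add: htil_def)
  next
    case (Some i)
    then show ?thesis
      by (intro exI[of _ "(smult (p $ i) cc - smult (v $ i) bb) * PPk i"] exI[of _ "smult (v $ i) (PPk i)"])
        (simp add: htil_def algebra_simps)
  qed
next
  case (add dg F G)
  then obtain A B A' B' where
    AB: "\<And>\<mu> y. y\<^sup>2 = poly EE \<mu> \<Longrightarrow> F (htil \<mu> y) = poly A \<mu> + y * poly B \<mu>"
    "\<And>\<mu> y. y\<^sup>2 = poly EE \<mu> \<Longrightarrow> G (htil \<mu> y) = poly A' \<mu> + y * poly B' \<mu>" by blast
  show ?case by (intro exI[of _ "A + A'"] exI[of _ "B + B'"]) (simp add: AB algebra_simps)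
next
  case (mult dg F dg' G)
  then obtain A B A' B' where
    AB: "\<And>\<mu> y. y\<^sup>2 = poly EE \<mu> \<Longrightarrow> F (htil \<mu> y) = poly A \<mu> + y * poly B \<mu>"
    "\<And>\<mu> y. y\<^sup>2 = poly EE \<mu> \<Longrightarrow> G (htil \<mu> y) = poly A' \<mu> + y * poly B' \<mu>" by blast
  have "F (htil \<mu> y) * G (htil \<mu> y) = poly (A * A' + EE * B * B') \<mu> + y * poly (A * B' + B * A') \<mu>"
    if y: "y\<^sup>2 = poly EE \<mu>" for \<mu> y
    unfolding AB[OF y] poly_add poly_mult y[symmetric] by (simp add: power2_eq_square algebra_simps)
  then show ?case by blast
qed

text \<open>
  The roots of the norm \<open>A\<^sup>2 - E B\<^sup>2\<close> are the parameters for which the form vanishes at one of the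
  two points of the line on the quadric.
\<close>

lemma finite_bad_if:
  assumes F: "hom_poly dg F" and m: "m \<notin> poles" "poly cc m \<noteq> 0"
    and ok: "\<And>X. X \<in> ell \<Longrightarrow> X \<noteq> 0 \<Longrightarrow> bdot X (hP m X) = 0 \<Longrightarrow> F (hP m X) \<noteq> 0"
  shows "\<exists>B. finite B \<and> poles \<subseteq> B \<and>
    (\<forall>\<mu>. \<mu> \<notin> B \<longrightarrow> (\<forall>X\<in>ell. X \<noteq> 0 \<longrightarrow> bdot X (hP \<mu> X) = 0 \<longrightarrow> F (hP \<mu> X) \<noteq> 0))"
proof -
  obtain A B where AB: "\<And>\<mu> y. y\<^sup>2 = poly EE \<mu> \<Longrightarrow> F (htil \<mu> y) = poly A \<mu> + y * poly B \<mu>"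
    using htil_poly[OF F] by blast
  define N where "N = A\<^sup>2 - EE * B\<^sup>2"
  have N: "poly N \<mu> = F (htil \<mu> y) * F (htil \<mu> (- y))" if "y\<^sup>2 = poly EE \<mu>" for \<mu> y
  proof -
    have y: "(- y)\<^sup>2 = poly EE \<mu>" using that by simp
    show ?thesis
      unfolding AB[OF that] AB[OF y] by (simp add: N_def power2_eq_square algebra_simps flip: that)
  qed
  \<comment> \<open>Both points over m are used here: if the double cover splits, one good point
    would leave the other branch uncontrolled.\<close>
  have "poly N m \<noteq> 0"
  proof -
    define y where "y = csqrt (poly EE m)"
    have y: "y\<^sup>2 = poly EE m" "(- y)\<^sup>2 = poly EE m" by (simp_all add: y_def)
    show ?thesis using N[OF y(1)] ok htil_on_quadric[OF m y(1)] htil_on_quadric[OF m y(2)] by force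
  qed
  then have "N \<noteq> 0" "cc \<noteq> 0" using m(2) by auto
  then have fin: "finite ({\<mu>. poly N \<mu> = 0} \<union> {\<mu>. poly cc \<mu> = 0} \<union> poles)"
    using poly_roots_finite by auto
  show ?thesis
  proof (intro exI conjI allI impI ballI)
    show "finite ({\<mu>. poly N \<mu> = 0} \<union> {\<mu>. poly cc \<mu> = 0} \<union> poles)" by (rule fin)
  next
    fix \<mu> X assume \<mu>: "\<mu> \<notin> {\<mu>. poly N \<mu> = 0} \<union> {\<mu>. poly cc \<mu> = 0} \<union> poles"
      and X: "X \<in> ell" "X \<noteq> 0" "bdot X (hP \<mu> X) = 0"
    have \<mu>': "\<mu> \<notin> poles" "poly cc \<mu> \<noteq> 0" "poly N \<mu> \<noteq> 0" using \<mu> by blast+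
    obtain y \<kappa> where y: "y\<^sup>2 = poly EE \<mu>" "\<kappa> \<noteq> 0" "hP \<mu> X = \<kappa> *s htil \<mu> y"
      using htil_cover[OF \<mu>'(1,2) X] by blast
    then show "F (hP \<mu> X) \<noteq> 0"
      using N[OF y(1)] \<mu>'(3) hom_poly_scale[OF F] by auto
  qed blast
qed

text \<open>For these m the quadric is an ellipsoid with p in its interior. The line therefore meets
  it in real points only and crosses it transversally there.\<close>

lemma real_points:
  assumes m: "\<And>i. a i - m \<ge> 1 + p \<bullet> p"
    and X: "X \<in> ell" "X \<noteq> 0" "bdot X (hP (of_real m) X) = 0"
  shows "\<exists>\<kappa> n. \<kappa> \<noteq> 0 \<and> hP (of_real m) X = \<kappa> *s (emb_dir (cvec n) - axis None 1) \<and> v \<bullet> n \<noteq> 0"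
proof -
  have pos: "a i - m > 0" for i using m[of i] inner_ge_zero[of p] by linarith
  obtain \<sigma> \<tau> where X_eq: "X = \<sigma> *s e + \<tau> *s f" using X(1) ell_iff by blast
  define A0 where "A0 = (\<Sum>i\<in>UNIV. (p $ i)\<^sup>2 / (a i - m)) - 1"
  define B0 where "B0 = (\<Sum>i\<in>UNIV. p $ i * v $ i / (a i - m))"
  define C0 where "C0 = (\<Sum>i\<in>UNIV. (v $ i)\<^sup>2 / (a i - m))"
  have "(\<Sum>i\<in>UNIV. (p $ i)\<^sup>2 / (a i - m)) \<le> (\<Sum>i\<in>UNIV. (p $ i)\<^sup>2 / (1 + p \<bullet> p))"
    using m inner_ge_zero[of p] by (intro sum_mono divide_left_mono) (auto intro!: mult_pos_pos pos add_pos_nonneg)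
  also have "\<dots> = (p \<bullet> p) / (1 + p \<bullet> p)" by (simp add: sum_divide_distrib[symmetric] inner_vec_def power2_eq_square)
  also have "\<dots> < 1" using inner_ge_zero[of p] by (simp add: add_pos_nonneg)
  finally have A0: "A0 < 0" by (simp add: A0_def)
  obtain i where "v $ i \<noteq> 0" using v by (auto simp: vec_eq_iff)
  then have C0: "C0 > 0" unfolding C0_def
    using pos by (intro sum_pos2[of _ i]) (auto intro!: divide_pos_pos divide_nonneg_pos)
  have AC: "A0 * C0 < 0" using A0 C0 by (rule mult_neg_pos)
  define D0 where "D0 = B0\<^sup>2 - A0 * C0"
  have D0: "D0 > 0" using AC zero_le_power2[of B0] unfolding D0_def by linarith
  have forms: "bdot e (hP (of_real m) e) = of_real A0" "bdot e (hP (of_real m) f) = of_real B0"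
    "bdot f (hP (of_real m) f) = of_real C0"
    unfolding A0_def B0_def C0_def bdot_option hP_def by (simp_all add: power2_eq_square)
  have eq: "of_real A0 * \<sigma>\<^sup>2 + 2 * of_real B0 * \<sigma> * \<tau> + of_real C0 * \<tau>\<^sup>2 = 0"
    using X(3) unfolding X_eq quad_expand forms by (simp add: algebra_simps)
  have \<sigma>: "\<sigma> \<noteq> 0"
  proof
    assume "\<sigma> = 0"
    then have "\<tau> = 0" using eq C0 by simp
    then show False using \<open>\<sigma> = 0\<close> X(2) X_eq by simp
  qed
  define \<rho> where "\<rho> = \<tau> / \<sigma>"
  have "of_real A0 + 2 * of_real B0 * \<rho> + of_real C0 * \<rho>\<^sup>2 = 0"
    using eq \<sigma> by (simp add: \<rho>_def power2_eq_square field_simps)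
  moreover have "(of_real C0 * \<rho> + of_real B0)\<^sup>2 =
      of_real C0 * (of_real A0 + 2 * of_real B0 * \<rho> + of_real C0 * \<rho>\<^sup>2) + complex_of_real D0"
    by (simp add: D0_def power2_eq_square algebra_simps)
  \<comment> \<open>The quantity squared here turns out to be v . n, so a positive discriminant
    yields both reality and transversality.\<close>
  ultimately have "(of_real C0 * \<rho> + of_real B0)\<^sup>2 = (complex_of_real (sqrt D0))\<^sup>2"
    using D0 by (simp flip: of_real_power)
  then obtain w where w: "of_real C0 * \<rho> + of_real B0 = complex_of_real w" "w \<noteq> 0"
    unfolding power2_eq_iff using D0
    by (metis of_real_minus neg_equal_0_iff_equal real_sqrt_eq_zero_cancel_iff less_irrefl)
  define r where "r = (w - B0) / C0"
  have "complex_of_real C0 * \<rho> = complex_of_real C0 * complex_of_real r"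
    using w(1) C0 by (simp add: r_def eq_diff_eq)
  then have r: "\<rho> = of_real r" using C0 by simp
  define n where "n = (\<chi> i. (p $ i + r * v $ i) / (a i - m))"
  have \<tau>: "\<tau> = of_real r * \<sigma>" using r \<sigma> by (simp add: \<rho>_def field_simps)
  have "hP (of_real m) X = \<sigma> *s (emb_dir (cvec n) - axis None 1)"
    unfolding vec_eq_option_iff X_eq hP_def \<tau> by (simp add: n_def axis_def field_simps)
  moreover have "v \<bullet> n = B0 + r * C0"
    by (simp add: inner_vec_def n_def B0_def C0_def sum_distrib_left power2_eq_square add_divide_distrib algebra_simps sum.distrib)
  then have "v \<bullet> n = w" using C0 by (simp add: r_def)
  ultimately show ?thesis using \<sigma> w(2) by blast
qed

lemma pen_J_emb: "penJ (emb_dir (cvec x)) (emb_dir (cvec y)) = of_real (x \<bullet> y)"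
  "penJ x' (axis None 1) = 0" "penJ (axis None 1) x' = 0"
  by (simp_all add: pen_J inner_vec_def axis_def)

text \<open>For a real normal not orthogonal to v only the Gram factor can vanish, and this is the
  equality case of Cauchy-Schwarz.\<close>

lemma nondeg_real_zero:
  assumes "v \<bullet> n \<noteq> 0" "\<kappa> \<noteq> 0" "nondeg (\<kappa> *s (emb_dir (cvec n) - axis None 1)) = 0"
  shows "\<exists>c. c \<noteq> 0 \<and> n = c *\<^sub>R v"
proof -
  obtain dg where "hom_poly dg nondeg" using hom_poly_nondeg by blast
  then have 0: "nondeg (emb_dir (cvec n) - axis None 1) = 0"
    using hom_poly_scale[of dg nondeg \<kappa> "emb_dir (cvec n) - axis None 1"] assms(2,3) by simp
  have n0: "n \<noteq> 0" using assms(1) by auto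
  have eq: "nondeg (emb_dir (cvec n) - axis None 1) =
      - of_real ((n \<bullet> n) * (v \<bullet> n) * ((v \<bullet> v) * (n \<bullet> n) - (v \<bullet> n)\<^sup>2))"
    unfolding nondeg_def gram_def pen_linear pen_J_emb by (simp add: axis_def)
  have "(n \<bullet> n) * (v \<bullet> n) * ((v \<bullet> v) * (n \<bullet> n) - (v \<bullet> n)\<^sup>2) = 0"
    using 0 unfolding eq neg_equal_0_iff_equal of_real_eq_0_iff .
  then have G: "(v \<bullet> v) * (n \<bullet> n) = (v \<bullet> n)\<^sup>2" using n0 assms(1) by simp
  define w where "w = (v \<bullet> v) *\<^sub>R n - (v \<bullet> n) *\<^sub>R v"
  have "w \<bullet> w = (v \<bullet> v) * ((v \<bullet> v) * (n \<bullet> n) - (v \<bullet> n)\<^sup>2)"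
    by (simp add: w_def inner_diff_left inner_diff_right inner_commute power2_eq_square algebra_simps)
  then have "w = 0" using G by simp
  then have "(v \<bullet> v) *\<^sub>R n = (v \<bullet> n) *\<^sub>R v" by (simp add: w_def)
  then have "(1 / (v \<bullet> v)) *\<^sub>R ((v \<bullet> v) *\<^sub>R n) = ((v \<bullet> n) / (v \<bullet> v)) *\<^sub>R v" by simp
  then have "n = ((v \<bullet> n) / (v \<bullet> v)) *\<^sub>R v" using v by simp
  then show ?thesis using assms(1) v by (intro exI[of _ "(v \<bullet> n) / (v \<bullet> v)"]) auto
qed

text \<open>If v were an eigenvector, a line through the centre would be a principal axis i of the
  family. For another axis k, the member of parameter \<open>a k\<close> then has an isotropic
  vector with polar in the line that is no multiple of axis k, against
  \<open>degenerate_axis\<close>.\<close>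

lemma line_not_axis:
  assumes "axis None 1 \<in> ell"
  shows "(\<chi> i. (a i - m) * v $ i) \<noteq> \<tau> *\<^sub>R v"
proof
  assume "(\<chi> i. (a i - m) * v $ i) = \<tau> *\<^sub>R v"
  then have eq: "(a i - m) * v $ i = \<tau> * v $ i" for i by (simp add: vec_eq_iff)
  obtain i where i: "v $ i \<noteq> 0" using v by (auto simp: vec_eq_iff)
  have vk: "v $ k = 0" if "k \<noteq> i" for k
  proof (rule ccontr)
    assume "v $ k \<noteq> 0"
    then have "a k = a i" using eq[of k] eq[of i] i by simp
    then show False using inj_a that by (simp add: inj_eq)
  qed
  have "CARD('d) \<ge> 2" using card card_m_pos by linarith
  then have "\<not> UNIV \<subseteq> {i}" using card_mono[of "{i}" "UNIV :: 'd set"] by auto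
  then obtain k where k: "k \<noteq> i" by blast
  \<comment> \<open>Chosen so that h is isotropic: the weights at \<open>Some i\<close> and
    \<open>None\<close> are \<open>a i - a k\<close> and -1.\<close>
  define \<eta> where "\<eta> = csqrt (a i - a k)"
  define h where "h = axis (Some i) 1 + \<eta> *s axis None (1 :: complex)"
  have eqf: "polar a 1 (- a k) h = ((a i - a k) / v $ i) *s f + (- \<eta>) *s axis None 1"
    unfolding vec_eq_option_iff using i vk by (auto simp: h_def axis_def)
  have "polar a 1 (- a k) h \<in> ell"
    unfolding eqf by (intro add_ell scale_ell f_ell assms)
  moreover have "pen a 1 (- a k) h h = (a i - a k) - \<eta>\<^sup>2"
    by (simp add: pen_def bdot_option h_def axis_def power2_eq_square if_distrib[of "\<lambda>x. _ * x"] if_distrib[of "\<lambda>x. x * _"] cong: if_cong)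
  then have "pen a 1 (- a k) h h = 0" by (simp add: \<eta>_def)
  ultimately obtain c where "h = c *s axis (Some k) 1"
    using degenerate_axis[of 1 "- a k" "Some k" h] by auto
  then have "h $ Some i = (c *s axis (Some k) 1) $ Some i" by simp
  then show False using k by (simp add: h_def axis_def)
qed

text \<open>By \<open>finite_bad_if\<close> one parameter with only good points suffices. A bad
  point at a real parameter far below all \<open>a i\<close> means that the line is normal to the
  ellipsoid there; two such parameters would make the line a principal axis.\<close>

lemma finite_bad:
  "\<exists>B. finite B \<and> poles \<subseteq> B \<and>
    (\<forall>\<mu>. \<mu> \<notin> B \<longrightarrow> (\<forall>X\<in>ell. X \<noteq> 0 \<longrightarrow> bdot X (hP \<mu> X) = 0 \<longrightarrow> nondeg (hP \<mu> X) \<noteq> 0))"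
proof -
  \<comment> \<open>The bound required by \<open>real_points\<close>, so every
    \<open>m \<le> m0\<close> gives an ellipsoid around p.\<close>
  define m0 where "m0 = Min (range a) - 1 - p \<bullet> p"
  have low: "a i - m \<ge> 1 + p \<bullet> p" if "m \<le> m0" for i m
    using that Min_le[of "range a" "a i", OF finite_imageI[OF finite] rangeI] unfolding m0_def by linarith
  have reg: "complex_of_real m \<notin> poles" if "m \<le> m0" for m
    using low[OF that] inner_ge_zero[of p] by (smt (verit) image_iff of_real_eq_iff)
  have ccm: "poly cc (of_real m) \<noteq> 0" if "m \<le> m0" for m
  proof -
    have pos: "a i - m > 0" for i using low[OF that, of i] inner_ge_zero[of p] by linarith
    obtain i where "v $ i \<noteq> 0" using v by (auto simp: vec_eq_iff)
    then have "(\<Sum>i\<in>UNIV. (v $ i)\<^sup>2 / (a i - m)) > 0"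
      using pos by (intro sum_pos2[of _ i]) (auto intro!: divide_pos_pos divide_nonneg_pos)
    moreover have "bdot f (hP (of_real m) f) = of_real (\<Sum>i\<in>UNIV. (v $ i)\<^sup>2 / (a i - m))"
      unfolding bdot_option hP_def by (simp add: power2_eq_square)
    ultimately have "bdot f (hP (of_real m) f) \<noteq> 0" by (metis less_irrefl of_real_eq_0_iff)
    then show ?thesis using poly_PP_nz[OF reg[OF that]] unfolding forms_poly[OF reg[OF that]] by simp
  qed
  obtain dg where dg: "hom_poly dg nondeg" using hom_poly_nondeg by blast
  \<comment> \<open>A normal parallel to v determines the point of contact: its affine part is v
    with coordinates scaled by \<open>a i - m\<close>. The quadric equation then gives the square of
    its \<open>None\<close> coordinate.\<close>
  have bad: "\<exists>c. c \<noteq> 0 \<and> c *s axis None 1 + emb_dir (cvec (\<chi> i. (a i - m) * v $ i)) \<in> ell \<and>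
      c\<^sup>2 = of_real (\<Sum>i\<in>UNIV. (a i - m) * (v $ i)\<^sup>2)"
    if m: "m \<le> m0" and X: "X \<in> ell" "X \<noteq> 0" "bdot X (hP (of_real m) X) = 0" "nondeg (hP (of_real m) X) = 0" for m X
  proof -
    obtain \<kappa> n where n: "\<kappa> \<noteq> 0" "hP (of_real m) X = \<kappa> *s (emb_dir (cvec n) - axis None 1)" "v \<bullet> n \<noteq> 0"
      using real_points[OF low[OF m] X(1-3)] by blast
    obtain k where k: "k \<noteq> 0" "n = k *\<^sub>R v" using nondeg_real_zero[OF n(3,1)] X(4) n(2) by auto
    define Y where "Y = of_real (1 / k) *s axis None (1::complex) + emb_dir (cvec (\<chi> i. (a i - m) * v $ i))"
    have hX: "hP (of_real m) X = (\<kappa> * k) *s (f - of_real (1 / k) *s axis None 1)"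
      unfolding n(2) vec_eq_option_iff using k by (simp add: axis_def)
    have XY: "X = (\<kappa> * k) *s Y"
    proof -
      have "X = polar a 1 (- of_real m) (hP (of_real m) X)" by (rule polar_hP[OF reg[OF m], symmetric])
      also have "\<dots> = (\<kappa> * k) *s Y" unfolding hX Y_def vec_eq_option_iff using k by (simp add: axis_def)
      finally show ?thesis .
    qed
    have "(1 / (\<kappa> * k)) *s X \<in> ell" using X(1) scale_ell by blast
    then have Y: "Y \<in> ell" using XY n(1) k(1) by simp
    have "bdot Y (f - of_real (1 / k) *s axis None 1) = 0"
      using X(3)[unfolded hX, unfolded XY bdot_scale_left bdot_scale_right] n(1) k(1) by simp
    then have "of_real (1 / k) ^ 2 = complex_of_real (\<Sum>i\<in>UNIV. (a i - m) * (v $ i)\<^sup>2)"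
      by (simp add: Y_def bdot_option axis_def power2_eq_square mult.assoc)
    then show ?thesis using k(1) Y by (intro exI[of _ "of_real (1 / k)"]) (simp add: Y_def)
  qed
  have "\<exists>m\<le>m0. \<forall>X. X \<in> ell \<longrightarrow> X \<noteq> 0 \<longrightarrow> bdot X (hP (of_real m) X) = 0 \<longrightarrow> nondeg (hP (of_real m) X) \<noteq> 0"
  proof (rule ccontr)
    assume no: "\<not> ?thesis"
    define g where "g m = emb_dir (cvec (\<chi> i. (a i - m) * v $ i))" for m
    obtain X1 where X1: "X1 \<in> ell" "X1 \<noteq> 0" "bdot X1 (hP (of_real m0) X1) = 0" "nondeg (hP (of_real m0) X1) = 0"
      using no by blast
    obtain X2 where X2: "X2 \<in> ell" "X2 \<noteq> 0" "bdot X2 (hP (of_real (m0 - 1)) X2) = 0" "nondeg (hP (of_real (m0 - 1)) X2) = 0"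
      using no[simplified, rule_format, of "m0 - 1"] by auto
    obtain c1 where c1: "c1 *s axis None 1 + g m0 \<in> ell" "c1\<^sup>2 = of_real (\<Sum>i\<in>UNIV. (a i - m0) * (v $ i)\<^sup>2)"
      using bad[OF _ X1] by (auto simp: g_def)
    obtain c2 where c2: "c2 *s axis None 1 + g (m0 - 1) \<in> ell" "c2\<^sup>2 = of_real (\<Sum>i\<in>UNIV. (a i - (m0 - 1)) * (v $ i)\<^sup>2)"
      using bad[OF _ X2] by (auto simp: g_def)
    have "c2\<^sup>2 - c1\<^sup>2 = of_real (v \<bullet> v)"
      unfolding c1(2) c2(2) of_real_diff[symmetric] sum_subtractf[symmetric] inner_vec_def
      by (simp add: power2_eq_square algebra_simps)
    then have ne: "c2 - c1 \<noteq> 0" using v by auto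
    have in1: "(c2 *s axis None 1 + g (m0 - 1)) - (c1 *s axis None 1 + g m0) - f \<in> ell"
      using c1(1) c2(1) f_ell diff_ell by blast
    \<comment> \<open>Lowering the parameter by 1 changes \<open>g\<close> by exactly
      \<open>f\<close>, leaving a multiple of the centre.\<close>
    have "(c2 *s axis None 1 + g (m0 - 1)) - (c1 *s axis None 1 + g m0) - f = (c2 - c1) *s axis None 1"
      unfolding vec_eq_option_iff by (simp add: g_def axis_def algebra_simps)
    from vec.subspace_scale[OF sub_ell in1[unfolded this], of "1 / (c2 - c1)"]
    have "(1 / (c2 - c1)) *s ((c2 - c1) *s axis None 1) \<in> ell" .
    moreover have "(1 / (c2 - c1)) *s ((c2 - c1) *s axis None 1) = axis None (1 :: complex)"
      unfolding vector_smult_assoc using ne by simp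
    ultimately have ax: "axis None 1 \<in> ell" by metis
    have "(c1 *s axis None 1 + g m0) - c1 *s axis None 1 \<in> ell"
      using c1(1) ax diff_ell scale_ell by blast
    then have "g m0 \<in> ell" by simp
    moreover have "g m0 $ None = 0" by (simp add: g_def)
    ultimately obtain \<tau> where \<tau>: "g m0 = \<tau> *s f" using ell_infinity by metis
    obtain i where i: "v $ i \<noteq> 0" using v by (auto simp: vec_eq_iff)
    have \<tau>k: "of_real ((a k - m0) * v $ k) = \<tau> * of_real (v $ k)" for k
      using arg_cong[OF \<tau>, of "\<lambda>x. x $ Some k"] by (simp add: g_def)
    then have "\<tau> = of_real (a i - m0)" using i \<tau>k[of i] by simp
    then have "(a k - m0) * v $ k = (a i - m0) * v $ k" for k
      using \<tau>k[of k] by (metis of_real_eq_iff of_real_mult)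
    then have "(\<chi> k. (a k - m0) * v $ k) = (a i - m0) *\<^sub>R v" by (simp add: vec_eq_iff)
    then show False using line_not_axis[OF ax] by blast
  qed
  then show ?thesis using finite_bad_if[OF dg reg ccm] by blast
qed

section \<open>The generalized Cayley curve\<close>

abbreviation hplane :: "complex ^ ('d option) \<Rightarrow> (complex ^ ('d option)) set" where
  "hplane h \<equiv> {X. bdot h X = 0}"

abbreviation "cay \<equiv> cayley_curve a ell"

lemma coords_hplane: "u \<in> hyperplane_coords (hplane h) \<Longrightarrow> h \<noteq> 0 \<Longrightarrow> \<exists>c. c \<noteq> 0 \<and> u = c *s h"
  using proj_coords_hyperplane hyperplane_coords_annihilator unfolding proj_coords_def by blast

lemma on_cay_scale:
  assumes "on_cay h" "c \<noteq> 0"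
  shows "on_cay (c *s h)"
proof -
  obtain s t where "(s, t) \<noteq> (0, 0)" "polar a s t h \<in> ell" "pen a s t h h = 0" and "h \<noteq> 0"
    using assms(1) by (auto simp: on_cay_def)
  moreover from this have "polar a s t (c *s h) \<in> ell" "pen a s t (c *s h) (c *s h) = 0"
    by (simp_all add: polar_linear(2) pen_linear scale_ell)
  ultimately show ?thesis unfolding on_cay_def using assms(2) by (metis vec.scale_eq_0_iff)
qed

lemma minors_zero:
  fixes s t :: complex
  assumes "(s, t) \<noteq> (0, 0)" "s * x + t * y = 0" "s * x' + t * y' = 0"
  shows "x * y' = x' * y"
proof -
  have "s * (x * y' - x' * y) = y' * (s * x + t * y) - y * (s * x' + t * y')"
    "t * (x * y' - x' * y) = x * (s * x' + t * y') - x' * (s * x + t * y)"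
    by (simp_all add: algebra_simps)
  then show ?thesis using assms by auto
qed

text \<open>Existence of a witnessing member says that two rows of pencil values are proportional.
  Expressed by minors it becomes polynomial in h, so the condition is Zariski closed.\<close>

lemma on_cay_iff_minors:
  "on_cay h \<longleftrightarrow> h \<noteq> 0 \<and>
    (\<forall>z\<in>L. \<forall>z'\<in>L. penA (px z) h * penJ (px z') h - penA (px z') h * penJ (px z) h = 0) \<and>
    (\<forall>z\<in>L. penA (px z) h * penJ h h - penA h h * penJ (px z) h = 0)" (is "_ \<longleftrightarrow> ?r")
proof
  assume "on_cay h"
  then obtain s t where st: "(s, t) \<noteq> (0, 0)" "polar a s t h \<in> ell" "pen a s t h h = 0" "h \<noteq> 0"
    by (auto simp: on_cay_def)
  have 1: "s * penA (px z) h + t * penJ (px z) h = 0" if "z \<in> L" for z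
    using st(2) that pen_split[of a s t "px z" h] by (simp add: polar_in_ell)
  have 2: "s * penA h h + t * penJ h h = 0"
    using st(3) pen_split[of a s t h h] by simp
  show ?r using st(4) minors_zero[OF st(1) 1 1] minors_zero[OF st(1) 1 2] by simp
next
  assume r: ?r
  have *: "on_cay h" if "(x, y) \<noteq> (0, 0)" "\<And>z. z \<in> L \<Longrightarrow> y * penA (px z) h - x * penJ (px z) h = 0"
    "y * penA h h - x * penJ h h = 0" for x y
  proof -
    have "polar a y (- x) h \<in> ell"
      unfolding polar_in_ell using that(2) pen_split[of a y "- x" _ h] by simp
    moreover have "pen a y (- x) h h = 0" using that(3) pen_split[of a y "- x" h h] by simp
    moreover have "(y, - x) \<noteq> (0, 0)" using that(1) by auto
    ultimately show ?thesis unfolding on_cay_def using r by blast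
  qed
  show "on_cay h"
  proof (cases "\<exists>z\<in>L. (penA (px z) h, penJ (px z) h) \<noteq> (0, 0)")
    case True
    then obtain z where z: "z \<in> L" "(penA (px z) h, penJ (px z) h) \<noteq> (0, 0)" by blast
    have "penJ (px z) h * penA (px z') h - penA (px z) h * penJ (px z') h = 0" if "z' \<in> L" for z'
      using r that z(1) by (metis mult.commute)
    moreover have "penJ (px z) h * penA h h - penA (px z) h * penJ h h = 0"
      using r z(1) by (metis eq_iff_diff_eq_0 mult.commute)
    ultimately show ?thesis using *[OF z(2)] by blast
  next
    case False
    then have 0: "pen a s t (px z) h = 0" if "z \<in> L" for s t z
      using that pen_split[of a s t "px z" h] by simp
    \<comment> \<open>If all values on L vanish, the last column provides the ratio; it is nonzero
      because h cannot be singular for the whole pencil.\<close>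
    have "(penA h h, penJ h h) \<noteq> (0, 0)"
    proof
      assume "(penA h h, penJ h h) = (0, 0)"
      then have "pen a s t h h = 0" for s t using pen_split[of a s t h h] by simp
      then show False using not_all_zero[OF _ 0] r by blast
    qed
    then show ?thesis using *[of "penA h h" "penJ h h"] 0 by simp
  qed
qed

lemma hom_poly_minors:
  "hom_poly 2 (\<lambda>h. penA x h * penJ y h - penA y h * penJ x h)"
  "hom_poly 3 (\<lambda>h. penA x h * penJ h h - penA h h * penJ x h)"
proof -
  have "hom_poly (1 + 1) (\<lambda>h. penA x h * penJ y h - penA y h * penJ x h)"
    by (intro hom_poly_diff hom_poly.mult hom_poly_pen_left)
  then show "hom_poly 2 (\<lambda>h. penA x h * penJ y h - penA y h * penJ x h)"
    by (simp only: one_add_one)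
  have "hom_poly (1 + 2) (\<lambda>h. penA x h * penJ h h)" "hom_poly (2 + 1) (\<lambda>h. penA h h * penJ x h)"
    by (intro hom_poly.mult hom_poly_pen_left hom_poly_pen)+
  then have "hom_poly 3 (\<lambda>h. penA x h * penJ h h)" "hom_poly 3 (\<lambda>h. penA h h * penJ x h)"
    by (simp_all only: one_plus_numeral numeral_plus_one add_num_simps semiring_norm)
  then show "hom_poly 3 (\<lambda>h. penA x h * penJ h h - penA h h * penJ x h)"
    by (rule hom_poly_diff)
qed

lemma dense_good:
  assumes h: "on_cay h" and F: "hom_poly dg F" "F h \<noteq> 0"
  shows "\<exists>\<mu> P. \<mu> \<notin> poles \<and> P \<in> ell \<and> P \<noteq> 0 \<and> bdot P (hP \<mu> P) = 0 \<and>
    F (hP \<mu> P) \<noteq> 0 \<and> nondeg (hP \<mu> P) \<noteq> 0"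
proof -
  obtain B where B: "finite B" "poles \<subseteq> B"
    "\<forall>\<mu>. \<mu> \<notin> B \<longrightarrow> (\<forall>X\<in>ell. X \<noteq> 0 \<longrightarrow> bdot X (hP \<mu> X) = 0 \<longrightarrow> nondeg (hP \<mu> X) \<noteq> 0)"
    using finite_bad by blast
  show ?thesis using dense_on_cay[OF h F B(1,2)] B(2,3) by blast
qed

text \<open>The minors vanish on all tangent hyperplanes, hence on the closure. Conversely, by
  \<open>dense_good\<close> no form separates a point of \<open>on_cay\<close> from the regular
  tangent hyperplanes.\<close>

lemma cay_iff: "H \<in> cay \<longleftrightarrow> (\<exists>h. on_cay h \<and> H = hplane h)"
proof -
  let ?S = "{tangent_hyperplane a \<mu> P | \<mu> P. \<mu> \<notin> poles \<and> P \<in> ell \<and> P \<noteq> 0 \<and> P \<in> conf_quadric a \<mu>}"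
  let ?X = "{H :: (complex ^ ('d option)) set. vec.subspace H \<and> vec.dim H = CARD('d)}"
  note iff = zariski_closure_iff[OF proj_coords_hyperplane, of H ?X ?S, folded cayley_curve_def]
  have S_on_cay: "\<exists>h. on_cay h \<and> s = hplane h" if "s \<in> ?S" for s
    using that on_cay_hP unfolding tangent_hyperplane_eq conf_quadric_iff by blast
  have HX: "hplane h \<in> ?X" if "h \<noteq> 0" for h
    using dim_annihilator[OF that] subspace_annihilator[of h] by (simp add: card_UNIV_option)
  show ?thesis
  proof
    assume H: "H \<in> cay"
    then obtain u where u: "u \<in> hyperplane_coords H" using iff by blast
    then have uH: "u \<noteq> 0" "H = hplane u" by (simp_all add: hyperplane_coords_iff)
    have van: "F u = 0" if F: "hom_poly dg F" "\<And>h. on_cay h \<Longrightarrow> F h = 0" for dg F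
    proof (rule ccontr)
      assume "F u \<noteq> 0"
      then obtain s w where s: "s \<in> ?S" "w \<in> hyperplane_coords s" "F w \<noteq> 0"
        using H iff F(1) u by blast
      obtain h where h: "on_cay h" "s = hplane h" using S_on_cay[OF s(1)] by blast
      then obtain c where "c \<noteq> 0" "w = c *s h" using coords_hplane[of w h] s(2) by (auto simp: on_cay_def)
      then show False using F(2) on_cay_scale[OF h(1)] s(3) by blast
    qed
    have "on_cay u"
      unfolding on_cay_iff_minors
    proof (intro conjI ballI uH)
      fix z z' assume "z \<in> L" "z' \<in> L"
      then show "penA (px z) u * penJ (px z') u - penA (px z') u * penJ (px z) u = 0"
        by (intro van[OF hom_poly_minors(1)]) (simp add: on_cay_iff_minors)
    next
      fix z assume "z \<in> L"
      then show "penA (px z) u * penJ u u - penA u u * penJ (px z) u = 0"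
        by (intro van[OF hom_poly_minors(2)]) (simp add: on_cay_iff_minors)
    qed
    then show "\<exists>h. on_cay h \<and> H = hplane h" using uH by blast
  next
    assume "\<exists>h. on_cay h \<and> H = hplane h"
    then obtain h where h: "on_cay h" "H = hplane h" by blast
    then have h0: "h \<noteq> 0" by (simp add: on_cay_def)
    have "\<exists>s\<in>?S \<inter> ?X. \<exists>u\<in>hyperplane_coords s. F u \<noteq> 0"
      if F: "hom_poly dg F" "\<exists>u\<in>hyperplane_coords H. F u \<noteq> 0" for dg F
    proof -
      have "F h \<noteq> 0"
        using F proj_coords_nz[OF proj_coords_hyperplane F(1)] hyperplane_coords_annihilator[OF h0] h(2) by blast
      then obtain \<mu> P where P: "\<mu> \<notin> poles" "P \<in> ell" "P \<noteq> 0" "bdot P (hP \<mu> P) = 0" "F (hP \<mu> P) \<noteq> 0"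
        using dense_good[OF h(1) F(1)] by blast
      have nz: "hP \<mu> P \<noteq> 0" using hP_nz[OF P(1,3)] .
      have "hplane (hP \<mu> P) \<in> ?S" unfolding tangent_hyperplane_eq conf_quadric_iff using P by blast
      then show ?thesis using HX[OF nz] hyperplane_coords_annihilator[OF nz] P(5) by blast
    qed
    moreover have "hyperplane_coords H \<noteq> {}" using hyperplane_coords_annihilator[OF h0] h(2) by blast
    ultimately show "H \<in> cay" unfolding iff using HX[OF h0] h(2) by blast
  qed
qed

lemma cay_coords:
  assumes "H \<in> cay" "u \<in> hyperplane_coords H"
  shows "on_cay u" "H = hplane u"
proof -
  obtain h where h: "on_cay h" "H = hplane h" using assms(1) cay_iff by blast
  then have "h \<noteq> 0" by (simp add: on_cay_def)
  then obtain c where "c \<noteq> 0" "u = c *s h" using coords_hplane assms(2) h(2) by blast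
  then show "on_cay u" using on_cay_scale[OF h(1)] by blast
  show "H = hplane u" using assms(2) by (simp add: hyperplane_coords_iff)
qed

lemma cay_nonempty: "H \<in> cay \<Longrightarrow> hyperplane_coords H \<noteq> {}"
  using cay_iff hyperplane_coords_annihilator by (metis on_cay_def empty_iff)

lemma nondeg_gram: "nondeg h \<noteq> 0 \<Longrightarrow> polar a 0 1 h \<noteq> \<kappa> *s f"
proof
  assume k: "nondeg h \<noteq> 0" and eq: "polar a 0 1 h = \<kappa> *s f"
  have "h $ Some i = \<kappa> * v $ i" for i
    using arg_cong[OF eq, of "\<lambda>x. x $ Some i"] by simp
  then have "penJ h h = \<kappa>\<^sup>2 * penJ f f" "penJ f h = \<kappa> * penJ f f"
    by (simp_all add: pen_J sum_distrib_left power2_eq_square mult_ac)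
  then have "gram h = 0" by (simp add: gram_def power2_eq_square)
  then show False using k by (simp add: nondeg_def)
qed

text \<open>If h is not generic, it is orthogonal to L under the Euclidean form, so its normal is a
  point at infinity of the line and the Gram determinant vanishes.\<close>

lemma nondeg_generic: "nondeg h \<noteq> 0 \<Longrightarrow> generic h"
proof (rule ccontr)
  assume k: "nondeg h \<noteq> 0" "\<not> generic h"
  then have "polar a 0 1 h \<in> ell" unfolding polar_in_ell generic_def by blast
  then show False using ell_infinity[of "polar a 0 1 h"] nondeg_gram[OF k(1)] by auto
qed

lemma nondeg_regular:
  assumes "on_cay h" "nondeg h \<noteq> 0"
  shows "\<exists>\<mu> P. \<mu> \<notin> poles \<and> P \<in> ell \<and> P \<noteq> 0 \<and> bdot P (hP \<mu> P) = 0 \<and> h = hP \<mu> P"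
proof (rule on_cay_regular[OF assms(1)], rule notI)
  fix k assume "\<exists>c. h = c *s axis k 1"
  then obtain c where "h = c *s axis k 1" by blast
  then have "h $ None * penJ h h = 0" by (cases k) (simp_all add: pen_J axis_def)
  then show False using assms(2) by (simp add: nondeg_def)
qed

text \<open>The map j of the theorem. The chosen coordinate vector is irrelevant by
  \<open>refl_scale\<close>.\<close>

definition jmap :: "(complex ^ ('d option)) set \<Rightarrow> (complex ^ ('d option + 'm)) set" where
  "jmap H = refl (SOME h. h \<in> hyperplane_coords H)"

lemma jmap_hplane:
  assumes "h \<noteq> 0"
  shows "jmap (hplane h) = refl h"
proof -
  have "(SOME h'. h' \<in> hyperplane_coords (hplane h)) \<in> hyperplane_coords (hplane h)"
    by (rule someI[where P = "\<lambda>h'. h' \<in> hyperplane_coords (hplane h)", OF hyperplane_coords_annihilator[OF assms]])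
  then obtain c where "c \<noteq> 0" "(SOME h'. h' \<in> hyperplane_coords (hplane h)) = c *s h"
    using coords_hplane assms by blast
  then show ?thesis unfolding jmap_def by (simp add: refl_scale)
qed

text \<open>When h is not generic the reflected space is L, which is outside \<open>T\<close>, so
  the closure is needed. A form nonzero at \<open>refl h\<close> pulls back along the local formula
  to a form nonzero at h, and density supplies a generic hyperplane where it stays nonzero.\<close>

lemma refl_RDK:
  assumes h: "on_cay h"
  shows "refl h \<in> RDK"
  unfolding RDK_iff
proof (intro conjI allI impI)
  show F: "refl h \<in> F_set a \<alpha>" by (rule refl_F[OF h])
  show "pluecker_coords (refl h) \<noteq> {}" by (rule pluecker_coords_nonempty[OF F_sub[OF F] F_dim[OF F]])
  fix dg F assume F: "hom_poly dg F" "\<exists>u\<in>pluecker_coords (refl h). F u \<noteq> 0"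
  obtain e' q eG G where q: "hom_poly e' q" "q h \<noteq> 0" and G: "\<And>\<phi>. hom_poly eG (\<lambda>u. G u $ \<phi>)"
    "\<And>h'. on_cay h' \<Longrightarrow> q h' \<noteq> 0 \<Longrightarrow> G h' \<in> pluecker_coords (refl h')"
    using refl_local[OF h] by blast
  have "F (G h) \<noteq> 0"
    using F(2) proj_coords_nz[OF proj_coords_pluecker F(1)] G(2)[OF h q(2)] by blast
  then have nz: "q h * F (G h) \<noteq> 0" using q(2) by simp
  have "hom_poly (e' + dg * eG) (\<lambda>u. q u * F (G u))"
    by (intro hom_poly.mult q hom_poly_compose[OF F(1) G(1)])
  from dense_good[OF h this nz] obtain \<mu> P where P: "\<mu> \<notin> poles" "P \<in> ell" "P \<noteq> 0" "bdot P (hP \<mu> P) = 0"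
    "q (hP \<mu> P) * F (G (hP \<mu> P)) \<noteq> 0" "nondeg (hP \<mu> P) \<noteq> 0"
    by blast
  have "on_cay (hP \<mu> P)" using on_cay_hP P by blast
  then show "\<exists>s\<in>T. \<exists>u\<in>pluecker_coords s. F u \<noteq> 0"
    using refl_T nondeg_generic[OF P(6)] G(2)[of "hP \<mu> P"] P(5) by auto
qed

lemma regular_jmap:
  assumes "X \<subseteq> cay" "jmap ` X \<subseteq> Y"
  shows "regular_map hyperplane_coords pluecker_coords X Y jmap"
proof (rule regular_mapI[OF assms(2) _ proj_coords_hyperplane])
  fix H assume "H \<in> X"
  then obtain h where h: "on_cay h" "H = hplane h" using assms(1) cay_iff by blast
  then have h0: "h \<noteq> 0" by (simp add: on_cay_def)
  obtain e' q eG G where q: "hom_poly e' q" "q h \<noteq> 0" and G: "\<forall>\<phi>. hom_poly eG (\<lambda>u. G u $ \<phi>)"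
    "\<And>h'. on_cay h' \<Longrightarrow> q h' \<noteq> 0 \<Longrightarrow> G h' \<in> pluecker_coords (refl h')"
    using refl_local[OF h(1)] by blast
  have "G u \<in> pluecker_coords (jmap w)" if "w \<in> X" "u \<in> hyperplane_coords w" "q u \<noteq> 0" for w u
  proof -
    have w: "on_cay u" "w = hplane u" using cay_coords[of w u] that assms(1) by blast+
    then have "jmap w = refl u" using jmap_hplane[of u] by (simp add: on_cay_def)
    then show ?thesis using G(2)[OF w(1) that(3)] by simp
  qed
  moreover have "\<exists>u\<in>hyperplane_coords H. q u \<noteq> 0"
    using hyperplane_coords_annihilator[OF h0] h(2) q(2) by blast
  ultimately show "\<exists>e' q e G. hom_poly e' q \<and> (\<exists>u\<in>hyperplane_coords H. q u \<noteq> 0) \<and> (\<forall>k. hom_poly e (\<lambda>u. G u $ k)) \<and>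
        (\<forall>w\<in>X. \<forall>u\<in>hyperplane_coords w. q u \<noteq> 0 \<longrightarrow> G u \<in> pluecker_coords (jmap w))"
    using q(1) G(1) by blast
qed

text \<open>The open set on which j is inverted, with image \<open>T\<close>. The smaller set
  \<open>good_planes\<close> is the one on which billiard reflection has exactly one
  solution.\<close>

definition generic_planes :: "(complex ^ ('d option)) set set" where
  "generic_planes = {H \<in> cay. \<exists>u\<in>hyperplane_coords H. generic u}"

definition good_planes :: "(complex ^ ('d option)) set set" where
  "good_planes = {H \<in> cay. \<exists>u\<in>hyperplane_coords H. nondeg u \<noteq> 0}"

lemma good_planes_generic_planes: "good_planes \<subseteq> generic_planes"
  unfolding good_planes_def generic_planes_def using nondeg_generic by blast

lemma good_dense:
  assumes "H \<in> cay" "u \<in> hyperplane_coords H" "hom_poly dg F" "F u \<noteq> 0"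
  shows "\<exists>s\<in>good_planes. \<exists>u\<in>hyperplane_coords s. F u \<noteq> 0"
proof -
  obtain \<mu> P where P: "\<mu> \<notin> poles" "P \<in> ell" "P \<noteq> 0" "bdot P (hP \<mu> P) = 0"
    "F (hP \<mu> P) \<noteq> 0" "nondeg (hP \<mu> P) \<noteq> 0"
    using dense_good[OF cay_coords(1)[OF assms(1,2)] assms(3,4)] by blast
  have nz: "hP \<mu> P \<noteq> 0" using hP_nz[OF P(1,3)] .
  have "hplane (hP \<mu> P) \<in> good_planes"
    using P on_cay_hP[OF P(1-4)] cay_iff hyperplane_coords_annihilator[OF nz] unfolding good_planes_def by blast
  then show ?thesis using hyperplane_coords_annihilator[OF nz] P(5) by blast
qed

lemma open_dense_good_planes: "open_dense hyperplane_coords cay good_planes"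
proof (rule open_denseI[OF proj_coords_hyperplane])
  obtain dg where "hom_poly dg nondeg" using hom_poly_nondeg by blast
  then show "openin (zariski hyperplane_coords cay) good_planes"
    unfolding good_planes_def by (rule openin_zariski_basic)
qed (use cay_nonempty good_dense in \<open>auto simp: good_planes_def\<close>)

lemma open_dense_generic_planes: "open_dense hyperplane_coords cay generic_planes"
proof (rule open_denseI[OF proj_coords_hyperplane])
  show "openin (zariski hyperplane_coords cay) generic_planes"
  proof (rule openin_zariskiI)
    fix H assume "H \<in> generic_planes"
    then obtain u s t z where u: "u \<in> hyperplane_coords H" "z \<in> L" "pen a s t (px z) u \<noteq> 0"
      unfolding generic_planes_def generic_def by blast
    have "{w \<in> cay. \<exists>u\<in>hyperplane_coords w. pen a s t (px z) u \<noteq> 0} \<subseteq> generic_planes"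
      unfolding generic_planes_def generic_def using u(2) by blast
    then show "\<exists>dg F. hom_poly dg F \<and> (\<exists>u\<in>hyperplane_coords H. F u \<noteq> 0) \<and> {w \<in> cay. \<exists>u\<in>hyperplane_coords w. F u \<noteq> 0} \<subseteq> generic_planes"
      using u hom_poly_pen_left[of s t "px z"] by (intro exI[of _ 1] exI[of _ "pen a s t (px z)"]) auto
  qed (simp add: generic_planes_def)
  show "generic_planes \<subseteq> cay" by (simp add: generic_planes_def)
next
  fix H u dg F assume "H \<in> cay" "u \<in> hyperplane_coords H" "hom_poly dg F" "F u \<noteq> 0"
  from good_dense[OF this] show "\<exists>s\<in>generic_planes. \<exists>u\<in>hyperplane_coords s. F u \<noteq> 0" using good_planes_generic_planes by blast
qed (use cay_nonempty in blast)

lemma T_recover: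
  assumes "L' \<in> T" "u \<in> pluecker_coords L'"
  shows "\<exists>j0 k. pluecker_form (rho1 j0 k) u \<noteq> 0"
proof -
  obtain h where h: "on_cay h" "generic h" "refl h = L'" using T_is_refl[OF assms(1)] by blast
  then obtain j0 where "recover j0 u \<noteq> 0" using recover_nz assms(2) by blast
  then show ?thesis unfolding recover_def vec_eq_iff by auto
qed

lemma open_dense_T: "open_dense pluecker_coords RDK T"
proof (rule open_denseI[OF proj_coords_pluecker])
  show "openin (zariski pluecker_coords RDK) T"
  proof (rule openin_zariskiI[OF T_RDK])
    fix L' assume L': "L' \<in> T"
    obtain u where u: "u \<in> pluecker_coords L'" using L' T_RDK RDK_iff by blast
    obtain j0 k where k: "pluecker_form (rho1 j0 k) u \<noteq> 0" using T_recover[OF L' u] by blast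
    have "{w \<in> RDK. \<exists>u\<in>pluecker_coords w. pluecker_form (rho1 j0 k) u \<noteq> 0} \<subseteq> T"
      using recover_imp_T unfolding recover_def by auto
    then show "\<exists>dg F. hom_poly dg F \<and> (\<exists>u\<in>pluecker_coords L'. F u \<noteq> 0) \<and> {w \<in> RDK. \<exists>u\<in>pluecker_coords w. F u \<noteq> 0} \<subseteq> T"
      using hom_poly_pluecker_form u k by blast
  qed
  show "T \<subseteq> RDK" by (rule T_RDK)
  show "pluecker_coords z \<noteq> {}" if "z \<in> RDK" for z using that RDK_iff by blast
  show "\<exists>s\<in>T. \<exists>u\<in>pluecker_coords s. F u \<noteq> 0"
    if "z \<in> RDK" "u \<in> pluecker_coords z" "hom_poly dg F" "F u \<noteq> 0" for z u dg F
    using that RDK_iff by blast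
qed

lemma generic_planes_hplane:
  assumes "H \<in> generic_planes"
  shows "\<exists>h. on_cay h \<and> generic h \<and> H = hplane h"
  using assms cay_coords unfolding generic_planes_def by blast

lemma hplane_generic_planes:
  assumes "on_cay h" "generic h"
  shows "hplane h \<in> generic_planes"
proof -
  have "h \<in> hyperplane_coords (hplane h)"
    using assms(1) by (intro hyperplane_coords_annihilator) (simp add: on_cay_def)
  moreover have "hplane h \<in> cay" unfolding cay_iff using assms(1) by blast
  ultimately show ?thesis unfolding generic_planes_def using assms(2) by blast
qed

lemma on_cay_nz: "on_cay h \<Longrightarrow> h \<noteq> 0" by (simp add: on_cay_def)

lemma regular_plane_of: "regular_map pluecker_coords hyperplane_coords T generic_planes plane_of"
proof (rule regular_mapI[OF _ _ proj_coords_pluecker])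
  show "plane_of ` T \<subseteq> generic_planes"
  proof
    fix H assume "H \<in> plane_of ` T"
    then obtain h where h: "on_cay h" "generic h" "H = plane_of (refl h)" using T_is_refl by blast
    then show "H \<in> generic_planes" using plane_of_refl[OF h(1,2)] hplane_generic_planes[OF h(1,2)] by simp
  qed
next
  fix L' assume L': "L' \<in> T"
  obtain u where u: "u \<in> pluecker_coords L'" using L' T_RDK RDK_iff by blast
  obtain j0 k where k: "pluecker_form (rho1 j0 k) u \<noteq> 0" using T_recover[OF L' u] by blast
  have "recover j0 u \<in> hyperplane_coords (plane_of w)"
    if w: "w \<in> T" "u \<in> pluecker_coords w" "pluecker_form (rho1 j0 k) u \<noteq> 0" for w u
  proof -
    obtain h where h: "on_cay h" "generic h" "w = refl h" using T_is_refl[OF w(1)] by blast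
    obtain c where c: "recover j0 u = c *s h" using recover_multiple w(2) h(3) by blast
    have "recover j0 u $ k \<noteq> 0" using w(3) by (simp add: recover_def)
    then have "c \<noteq> 0" using c by auto
    then have "hplane (c *s h) = hplane h" by (simp add: bdot_scale_left)
    then show ?thesis using \<open>c \<noteq> 0\<close> on_cay_nz[OF h(1)]
      unfolding c h(3) plane_of_refl[OF h(1,2)] hyperplane_coords_iff by simp
  qed
  moreover have "\<forall>k. hom_poly 1 (\<lambda>u. recover j0 u $ k)"
    unfolding recover_def vec_lambda_beta using hom_poly_pluecker_form by blast
  ultimately show "\<exists>e' q e G. hom_poly e' q \<and> (\<exists>u\<in>pluecker_coords L'. q u \<noteq> 0) \<and> (\<forall>k. hom_poly e (\<lambda>u. G u $ k)) \<and>
        (\<forall>w\<in>T. \<forall>u\<in>pluecker_coords w. q u \<noteq> 0 \<longrightarrow> G u \<in> hyperplane_coords (plane_of w))"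
    using hom_poly_pluecker_form[of "rho1 j0 k"] u k by blast
qed

lemma birational_jmap: "birational_morphism hyperplane_coords pluecker_coords cay RDK jmap"
  unfolding birational_morphism_def
proof (intro conjI exI)
  show "regular_map hyperplane_coords pluecker_coords cay RDK jmap"
    using refl_RDK jmap_hplane on_cay_nz cay_iff by (intro regular_jmap) auto
  show "open_dense hyperplane_coords cay generic_planes" by (rule open_dense_generic_planes)
  show "open_dense pluecker_coords RDK T" by (rule open_dense_T)
  have jT: "jmap ` generic_planes \<subseteq> T"
  proof
    fix x assume "x \<in> jmap ` generic_planes"
    then obtain h where h: "on_cay h" "generic h" "x = jmap (hplane h)" using generic_planes_hplane by blast
    then show "x \<in> T" using refl_T jmap_hplane[OF on_cay_nz] by simp
  qed
  show "regular_map hyperplane_coords pluecker_coords generic_planes T jmap"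
    by (rule regular_jmap[OF _ jT]) (simp add: generic_planes_def)
  show "regular_map pluecker_coords hyperplane_coords T generic_planes plane_of" by (rule regular_plane_of)
  show "\<forall>z\<in>generic_planes. plane_of (jmap z) = z"
  proof
    fix z assume "z \<in> generic_planes"
    then obtain h where h: "on_cay h" "generic h" "z = hplane h" using generic_planes_hplane by blast
    then show "plane_of (jmap z) = z" using plane_of_refl[OF h(1,2)] jmap_hplane[OF on_cay_nz[OF h(1)]] by simp
  qed
  show "\<forall>w\<in>T. jmap (plane_of w) = w"
  proof
    fix w assume "w \<in> T"
    then obtain h where h: "on_cay h" "generic h" "w = refl h" using T_is_refl by blast
    then show "jmap (plane_of w) = w" using plane_of_refl[OF h(1,2)] jmap_hplane[OF on_cay_nz[OF h(1)]] by simp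
  qed
qed

end

section \<open>The billiard law\<close>

lemma dim_le_2_span:
  fixes x y w :: "complex ^ 'n::finite"
  assumes "vec.dim {x, w, y} \<le> 2" "x \<noteq> 0" "\<And>c. y \<noteq> c *s x"
  shows "\<exists>c d. w = c *s x + d *s y"
proof -
  have y: "y \<notin> vec.span {x}" using assms(3) unfolding vec.span_singleton by blast
  have "vec.dim {x} = 1" using vec.dim_insert[of x "{}"] assms(2) by simp
  then have 2: "vec.dim {y, x} = 2" using vec.dim_insert[of y "{x}"] y by simp
  have "w \<in> vec.span {y, x}"
  proof (rule ccontr)
    assume "w \<notin> vec.span {y, x}"
    then have "vec.dim {w, y, x} = 3" using vec.dim_insert[of w "{y, x}"] 2 by simp
    moreover have "{w, y, x} = {x, w, y}" by blast
    ultimately show False using assms(1) by simp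
  qed
  then obtain d where "w - d *s y \<in> vec.span {x}" unfolding vec.span_breakdown_eq[of w y] by blast
  then obtain c where "w - d *s y = c *s x" unfolding vec.span_singleton by blast
  then have "w = c *s x + d *s y" by (simp add: algebra_simps)
  then show ?thesis by blast
qed

lemma dim_2:
  fixes P g :: "complex ^ ('d::finite option)"
  assumes "P $ None \<noteq> 0" "g $ None = 0" "g \<noteq> 0"
  shows "vec.dim (vec.span {P, g}) = 2"
proof -
  have "vec.dim {g} = 1" using vec.dim_insert[of g "{}"] assms(3) by simp
  moreover have "P \<notin> vec.span {g}" using assms(1,2) unfolding vec.span_singleton by auto
  ultimately have "vec.dim {P, g} = 2" using vec.dim_insert[of P "{g}"] by simp
  then show ?thesis by (metis vec.dim_span)
qed

lemma span_2_iff: "X \<in> vec.span {P, g :: complex ^ 'n::finite} \<longleftrightarrow> (\<exists>c d. X = c *s P + d *s g)"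
  unfolding vec.span_insert vec.span_singleton by (auto simp: algebra_simps)

lemma directions_iff: "w \<in> directions l \<longleftrightarrow> w \<noteq> 0 \<and> emb_dir w \<in> l"
  by (simp add: directions_def emb_dir_def)

lemma emb_dir_linear: "emb_dir (x + y) = emb_dir x + emb_dir y" "emb_dir (c *s x) = c *s emb_dir x"
  "emb_dir (x - y) = emb_dir x - emb_dir y"
  by (simp_all add: vec_eq_option_iff)

context confocal_line
begin

text \<open>The Euclidean reflection in the hyperplane h, in homogeneous coordinates;
  \<open>polar a 0 1 h\<close> is the normal direction, a point at infinity.\<close>

definition mirror :: "complex ^ ('d option) \<Rightarrow> complex ^ ('d option) \<Rightarrow> complex ^ ('d option)" where
  "mirror h X = X - (2 * bdot h X / penJ h h) *s polar a 0 1 h"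

lemma mirror_linear: "mirror h (x + y) = mirror h x + mirror h y" "mirror h (c *s x) = c *s mirror h x"
  by (simp_all add: mirror_def vec_eq_iff bdot_simps add_divide_distrib algebra_simps)

lemma mirror_mirror:
  assumes "penJ h h \<noteq> 0"
  shows "mirror h (mirror h X) = X"
proof -
  have "bdot h (polar a 0 1 h) = penJ h h" by (simp add: pen_def)
  then have "bdot h (mirror h X) = - bdot h X" using assms by (simp add: mirror_def bdot_simps)
  then show ?thesis unfolding mirror_def[of h "mirror h X"] by (simp add: mirror_def)
qed

lemma mirror_None: "mirror h X $ None = X $ None"
  by (simp add: mirror_def)

text \<open>For non-isotropic h the residual equation of the Euclidean member gives the coefficient
  c of the reflection. The reflection is self-adjoint for the pairing of hyperplanes with points, so
  it passes from L to the dual line.\<close>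

lemma pi_star_refl:
  assumes h: "on_cay h" and q: "penJ h h \<noteq> 0"
  shows "pi_star (refl h) = {X. mirror h X \<in> ell}"
proof -
  have key: "bdot (px (z + c *s emb h)) X = bdot (px z) (mirror h X)"
    if "z \<in> L" "residual 0 1 h z c = 0" for z c X
  proof -
    have "c * penJ h h = - (2 * penJ (px z) h)" using that(2) by (simp add: residual_def eq_neg_iff_add_eq_0 add.commute)
    then have c: "c = - (2 * penJ (px z) h) / penJ h h" using q by (simp add: field_simps)
    have p: "bdot (px z) (polar a 0 1 h) = penJ (px z) h" by (simp add: pen_def)
    show ?thesis unfolding mirror_def by (simp add: px_linear bdot_simps p c field_simps)
  qed
  have ps: "X \<in> pi_star M \<longleftrightarrow> (\<forall>x\<in>M. bdot (px x) X = 0)" for X M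
    by (auto simp: pi_star_def pi'_def bdot_def px_def)
  have "mirror h X \<in> ell" if X: "X \<in> pi_star (refl h)" for X
    unfolding in_ell
  proof
    fix z assume z: "z \<in> L"
    define c where "c = - (2 * penJ (px z) h) / penJ h h"
    have F: "residual 0 1 h z c = 0" using q by (simp add: residual_def c_def)
    have "residual 0 1 h 0 1 \<noteq> 0" using q by (simp add: residual_def px_linear pen_linear)
    then have "residual s t h z c = 0" for s t
      using residual_proportional[OF h _ vec.subspace_0[OF subL] F z] by blast
    then have "z + c *s emb h \<in> refl h" unfolding refl_def using z by blast
    then show "bdot (px z) (mirror h X) = 0" using X ps key[OF z F, of X] by metis
  qed
  moreover have "X \<in> pi_star (refl h)" if X: "mirror h X \<in> ell" for X
    unfolding ps
  proof
    fix x assume "x \<in> refl h"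
    then obtain z c where *: "x = z + c *s emb h" "z \<in> L" "residual 0 1 h z c = 0" unfolding refl_def by blast
    show "bdot (px x) X = 0" using X *(2) in_ell unfolding *(1) key[OF *(2,3)] by blast
  qed
  ultimately show ?thesis by blast
qed

text \<open>
  With \<open>w = x v + y n\<close> the angle condition is \<open>((v n)\<^sup>2 - (v v) (n n)) y (2 x (v n) + y (n n)) = 0\<close>;
  the solutions are the line itself (\<open>y = 0\<close>) and its mirror image.
\<close>

lemma angle_solutions:
  fixes vv :: complex
  assumes "F\<^sup>2 * (x\<^sup>2 * vv + 2 * x * y * F + y\<^sup>2 * q) = vv * (x * F + y * q)\<^sup>2" "vv * q - F\<^sup>2 \<noteq> 0"
  shows "y = 0 \<or> y * q = - 2 * x * F"
proof -
  have "(vv * q - F\<^sup>2) * (y * (2 * x * F + y * q)) =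
      vv * (x * F + y * q)\<^sup>2 - F\<^sup>2 * (x\<^sup>2 * vv + 2 * x * y * F + y\<^sup>2 * q)"
    by (simp add: power2_eq_square algebra_simps)
  then have "y * (2 * x * F + y * q) = 0" using assms by simp
  then show ?thesis by (auto simp: eq_neg_iff_add_eq_0 add.commute)
qed

context
  fixes \<mu> :: complex and P h :: "complex ^ ('d option)"
  assumes \<mu>: "\<mu> \<notin> poles" and P: "P \<in> ell" "P \<noteq> 0" "bdot P (hP \<mu> P) = 0"
    and h: "h = hP \<mu> P" and nondeg: "nondeg h \<noteq> 0"
begin

abbreviation "nn \<equiv> (\<chi> i. h $ Some i)"
abbreviation "qq \<equiv> penJ h h"
abbreviation "ff \<equiv> penJ f h"
abbreviation "gg \<equiv> mirror h f"
abbreviation "lr \<equiv> {X. mirror h X \<in> ell}"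
abbreviation "ww \<equiv> cvec v - (2 * ff / qq) *s nn"

lemma nondeg_facts: "h $ None \<noteq> 0" "qq \<noteq> 0" "ff \<noteq> 0" "gram h \<noteq> 0"
  using nondeg by (auto simp: nondeg_def)

lemma hPb: "bdot h P = 0" using P(3) h by (simp add: bdot_commute)

lemma P_None: "P $ None \<noteq> 0" using nondeg_facts(1) by (auto simp: h hP_def)

lemma bdot_hf: "bdot h f = ff" by (simp add: pen_J bdot_option mult.commute)

lemma bdots: "bdot (cvec v) nn = ff" "bdot nn nn = qq" "bdot (cvec v) (cvec v) = penJ f f"
  by (simp_all add: bdot_def pen_J)

lemma emb_nn: "emb_dir nn = polar a 0 1 h" by (simp add: vec_eq_option_iff)

lemma gg_eq: "gg = emb_dir ww"
  unfolding emb_dir_linear emb_nn by (simp add: mirror_def bdot_hf)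

lemma mirror_P: "mirror h P = P" by (simp add: mirror_def hPb)

lemma ell_Pf: "X \<in> ell \<longleftrightarrow> (\<exists>c d. X = c *s P + d *s f)"
proof
  assume X: "X \<in> ell"
  define c where "c = X $ None / P $ None"
  have "X - c *s P \<in> ell" using X P(1) diff_ell scale_ell by blast
  moreover have "(X - c *s P) $ None = 0" using P_None by (simp add: c_def)
  ultimately obtain d where "X - c *s P = d *s f" using ell_infinity by blast
  then have "X = c *s P + d *s f" by (simp add: algebra_simps)
  then show "\<exists>c d. X = c *s P + d *s f" by blast
next
  assume "\<exists>c d. X = c *s P + d *s f"
  then obtain c d where X: "X = c *s P + d *s f" by blast
  show "X \<in> ell" unfolding X
    by (intro add_ell scale_ell P(1) f_ell)
qed

lemma gg_nz: "gg \<noteq> 0" and gg_None: "gg $ None = 0"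
proof -
  show "gg $ None = 0" by (simp add: mirror_None)
  show "gg \<noteq> 0"
  proof
    assume "gg = 0"
    then have "mirror h gg = 0" by (simp add: mirror_def bdot_simps)
    then show False using mirror_mirror[OF nondeg_facts(2)] f_nz by simp
  qed
qed

lemma lr_span: "lr = vec.span {P, gg}"
proof (rule set_eqI)
  fix X
  have "mirror h X \<in> ell \<longleftrightarrow> (\<exists>c d. mirror h X = c *s P + d *s f)" by (rule ell_Pf)
  also have "\<dots> \<longleftrightarrow> (\<exists>c d. X = c *s P + d *s gg)"
  proof -
    have "mirror h X = c *s P + d *s f \<longleftrightarrow> X = c *s P + d *s gg" for c d
      using mirror_mirror[OF nondeg_facts(2)] mirror_P by (metis mirror_linear)
    then show ?thesis by simp
  qed
  finally show "X \<in> lr \<longleftrightarrow> X \<in> vec.span {P, gg}" by (simp add: span_2_iff)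
qed

lemma dim_lr: "vec.dim lr = 2"
  unfolding lr_span by (rule dim_2[OF P_None gg_None gg_nz])

lemma nn_not_parallel: "nn \<noteq> c *s cvec v"
proof
  assume "nn = c *s cvec v"
  then have "polar a 0 1 h = c *s f" by (simp add: emb_dir_linear flip: emb_nn)
  then show False using nondeg_gram[OF nondeg] by blast
qed

lemma lr_ne_ell: "lr \<noteq> ell"
proof
  assume "lr = ell"
  then have "gg \<in> ell" unfolding lr_span using vec.span_base[of gg "{P, gg}"] by blast
  then obtain \<tau> where \<tau>: "gg = \<tau> *s f" using ell_infinity gg_None by blast
  then have "(2 * ff / qq) *s polar a 0 1 h = (1 - \<tau>) *s f"
    by (simp add: mirror_def bdot_hf algebra_simps)
  then have "(qq / (2 * ff)) *s ((2 * ff / qq) *s polar a 0 1 h) = (qq / (2 * ff)) *s ((1 - \<tau>) *s f)" by simp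
  then have "polar a 0 1 h = (qq / (2 * ff) * (1 - \<tau>)) *s f"
    using nondeg_facts by (simp only: vector_smult_assoc) simp
  then show False using nondeg_gram[OF nondeg] by blast
qed

lemma normal_eq: "normal a \<mu> P = nn"
  by (simp add: normal_def h hP_def vec_eq_iff)

lemma billiard_lr: "billiard_reflection a ell (hplane h) lr"
  unfolding billiard_reflection_def
proof (intro conjI exI)
  show "vec.subspace lr" unfolding lr_span by (rule vec.subspace_span)
  show "vec.dim lr = 2" by (rule dim_lr)
  show "lr \<noteq> ell" by (rule lr_ne_ell)
  show "\<mu> \<notin> poles" by (rule \<mu>)
  show "hplane h = tangent_hyperplane a \<mu> P" by (simp add: tangent_hyperplane_eq h)
  \<comment> \<open>The reflected direction keeps its length, and its normal component changes
    sign.\<close>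
  have ww: "bdot ww ww = penJ f f" "bdot ww nn = - ff"
    using nondeg_facts(2) bdots bdot_commute[of nn "cvec v"]
    by (simp_all add: bdot_simps field_simps)
  have ff0: "penJ f f \<noteq> 0" using norm_v bdots(3) by simp
  have "vec.dim {cvec v, ww, nn} \<le> 2"
  proof -
    have "{cvec v, ww, nn} \<subseteq> vec.span {cvec v, nn}"
      by (auto intro: vec.span_base vec.span_diff vec.span_scale)
    then have "vec.dim {cvec v, ww, nn} \<le> card {cvec v, nn}" by (intro vec.dim_le_card) auto
    also have "\<dots> \<le> 2" by (simp add: card_insert_if)
    finally show ?thesis .
  qed
  moreover have "cos_sq (cvec v) nn = cos_sq ww nn"
    unfolding cos_sq_def ww bdots by simp
  moreover have "cvec v \<in> directions ell"
    unfolding directions_iff using f_ell norm_v by (auto simp: bdot_simps)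
  moreover have "ww \<in> directions lr"
  proof -
    have "ww \<noteq> 0" using ww(1) ff0 by (metis bdot_zero_left)
    moreover have "gg \<in> lr" unfolding lr_span by (rule vec.span_base) simp
    ultimately show ?thesis unfolding directions_iff gg_eq by simp
  qed
  moreover have "P \<in> conf_quadric a \<mu>" using P(3) by (simp add: conf_quadric_iff)
  moreover have "P \<in> lr" using P(1) mirror_P by simp
  ultimately show "billiard_law a \<mu> P ell lr"
    unfolding billiard_law_def normal_eq using P_None P(1) ww(1) ff0 nondeg_facts(2) bdots by metis
qed

text \<open>The law may be satisfied with another parameter and another point of contact. The
  hyperplane nevertheless fixes the normal up to scale, and it meets the line only in P because
  \<open>ff\<close> is nonzero, so only the angle condition remains to be solved.\<close>

lemma billiard_unique:
  assumes "billiard_reflection a ell (hplane h) l'"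
  shows "l' = lr"
proof -
  obtain \<mu>' P' where l': "vec.subspace l'" "vec.dim l' = 2" "l' \<noteq> ell"
    and \<mu>': "hplane h = tangent_hyperplane a \<mu>' P'"
    and law: "billiard_law a \<mu>' P' ell l'"
    using assms unfolding billiard_reflection_def by blast
  define n' where "n' = normal a \<mu>' P'"
  obtain v' w where P': "P' \<in> conf_quadric a \<mu>'" "P' $ None \<noteq> 0" "P' \<in> ell" "P' \<in> l'"
    and vw: "v' \<in> directions ell" "w \<in> directions l'"
    and nz: "bdot v' v' \<noteq> 0" "bdot w w \<noteq> 0" "bdot n' n' \<noteq> 0"
    and dim: "vec.dim {v', w, n'} \<le> 2" and cos: "cos_sq v' n' = cos_sq w n'"
    using law unfolding billiard_law_def n'_def by blast
  define h' where "h' = hP \<mu>' P'"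
  have h'0: "h' \<noteq> 0" using P'(2) by (auto simp: h'_def vec_eq_option_iff hP_def)
  have "hplane h = hplane h'" using \<mu>' by (simp add: tangent_hyperplane_eq h'_def)
  moreover have "h \<noteq> 0" using nondeg_facts(1) by auto
  ultimately obtain c where "h' = c *s h" using annihilator_subset_proportional[of h h'] by auto
  then have c: "c \<noteq> 0" "h' = c *s h" using h'0 by auto
  have n': "n' = c *s nn"
    using arg_cong[OF c(2), of "\<lambda>x. x $ Some _"] by (simp add: n'_def normal_def h'_def hP_def vec_eq_iff)
  obtain \<tau> where "emb_dir v' = \<tau> *s f"
    using vw(1) ell_infinity[of "emb_dir v'"] by (auto simp: directions_iff)
  then have v': "v' = \<tau> *s cvec v" by (simp add: vec_eq_option_iff vec_eq_iff)
  have \<tau>: "\<tau> \<noteq> 0" using v' nz(1) by (auto simp: bdot_simps)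
  have "bdot h' P' = 0" using P'(1) by (simp add: conf_quadric_iff h'_def bdot_commute)
  then have hP': "bdot h P' = 0" using c by (simp add: bdot_simps)
  obtain k d where kd: "P' = k *s P + d *s f" using P'(3) ell_Pf by blast
  then have "d = 0" using hP' hPb nondeg_facts(3) by (simp add: bdot_simps bdot_hf)
  then have P'P: "P' = k *s P" "k \<noteq> 0" using kd P'(2) by auto
  have "(1 / k) *s P' \<in> l'" using vec.subspace_scale[OF l'(1) P'(4)] .
  then have Pl': "P \<in> l'" using P'P by simp
  have "v' \<noteq> 0" using vw(1) by (simp add: directions_iff)
  moreover have "n' \<noteq> r *s v'" for r
  proof
    assume "n' = r *s v'"
    then have "(1 / c) *s (c *s nn) = (1 / c) *s ((r * \<tau>) *s cvec v)" unfolding n' v' by simp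
    then have "nn = (1 / c * (r * \<tau>)) *s cvec v" using c(1) by (simp only: vector_smult_assoc) simp
    then show False using nn_not_parallel by blast
  qed
  ultimately obtain x0 y0 where "w = x0 *s v' + y0 *s n'" using dim_le_2_span[OF dim] by blast
  then obtain x y where w: "w = x *s cvec v + y *s nn" unfolding v' n' vector_smult_assoc by blast
  let ?V = "penJ f f"
  have wn: "bdot w nn = x * ff + y * qq" unfolding w by (simp add: bdot_simps bdots)
  have ww': "bdot w w = x\<^sup>2 * ?V + 2 * x * y * ff + y\<^sup>2 * qq"
    unfolding w by (simp add: bdot_simps bdots bdot_commute[of nn "cvec v"] power2_eq_square algebra_simps)
  have V0: "?V \<noteq> 0" using norm_v bdots(3) by simp
  have "(\<tau> * c * ff)\<^sup>2 / (\<tau>\<^sup>2 * ?V * (c\<^sup>2 * qq)) = (c * bdot w nn)\<^sup>2 / (bdot w w * (c\<^sup>2 * qq))"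
    using cos unfolding cos_sq_def v' n' by (simp add: bdot_simps bdots power2_eq_square mult_ac)
  then have "ff\<^sup>2 / ?V = (bdot w nn)\<^sup>2 / bdot w w"
    using \<tau> c(1) nondeg_facts(2) V0 nz(2) by (simp add: power_mult_distrib divide_simps mult_ac split: if_splits)
  then have "ff\<^sup>2 * bdot w w = ?V * (bdot w nn)\<^sup>2" using V0 nz(2) by (simp add: field_simps)
  then have "ff\<^sup>2 * (x\<^sup>2 * ?V + 2 * x * y * ff + y\<^sup>2 * qq) = ?V * (x * ff + y * qq)\<^sup>2" unfolding ww' wn .
  moreover have "?V * qq - ff\<^sup>2 \<noteq> 0" using nondeg_facts(4) by (simp add: gram_def)
  ultimately have "y = 0 \<or> y * qq = - 2 * x * ff" by (rule angle_solutions)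
  moreover have w0: "w \<noteq> 0" and wl: "emb_dir w \<in> l'" using vw(2) by (simp_all add: directions_iff)
  \<comment> \<open>Otherwise l' contains P and the direction of the line and coincides with it,
    which the definition of reflection excludes.\<close>
  moreover have "y \<noteq> 0"
  proof
    assume "y = 0"
    then have wx: "w = x *s cvec v" "x \<noteq> 0" using w w0 by auto
    then have "(1 / x) *s emb_dir w = f" by (simp add: emb_dir_linear)
    then have fl': "f \<in> l'" using vec.subspace_scale[OF l'(1) wl, of "1 / x"] by simp
    have "ell \<subseteq> l'"
    proof
      fix X assume "X \<in> ell"
      then obtain c d where X: "X = c *s P + d *s f" using ell_Pf by blast
      show "X \<in> l'" unfolding X
        by (intro vec.subspace_add[OF l'(1)] vec.subspace_scale[OF l'(1)] Pl' fl')
    qed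
    moreover have "vec.dim ell = 2" by (rule dim_2) (use f_nz in auto)
    ultimately have "ell = l'" using l'(1,2) by (intro vec.subspace_dim_equal sub_ell) auto
    then show False using l'(3) by simp
  qed
  ultimately have y: "y * qq = - 2 * x * ff" by blast
  then have "x \<noteq> 0" using \<open>y \<noteq> 0\<close> nondeg_facts(2) by auto
  have "y = x * (- (2 * ff / qq))" using y nondeg_facts(2) by (simp add: field_simps)
  then have wx: "w = x *s ww" unfolding w by (simp add: vec_eq_iff algebra_simps)
  have "(1 / x) *s emb_dir w = gg"
    unfolding gg_eq wx emb_dir_linear(2) vector_smult_assoc using \<open>x \<noteq> 0\<close> by simp
  then have "gg \<in> l'" using vec.subspace_scale[OF l'(1) wl, of "1 / x"] by simp
  then have "lr \<subseteq> l'" unfolding lr_span using Pl' l'(1) by (intro vec.span_minimal) auto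
  moreover have "vec.subspace lr" unfolding lr_span by (rule vec.subspace_span)
  ultimately have "lr = l'" using l'(1,2) dim_lr by (intro vec.subspace_dim_equal) auto
  then show ?thesis by (rule sym)
qed

end

lemma billiard_jmap:
  assumes "H \<in> good_planes"
  shows "\<exists>!l'. billiard_reflection a ell H l'" "billiard_reflection a ell H l' \<Longrightarrow> pi_star (jmap H) = l'"
proof -
  obtain u where u: "H \<in> cay" "u \<in> hyperplane_coords H" "nondeg u \<noteq> 0" using assms unfolding good_planes_def by blast
  have H: "on_cay u" "H = hplane u" using cay_coords[OF u(1,2)] by blast+
  obtain \<mu> P where P: "\<mu> \<notin> poles" "P \<in> ell" "P \<noteq> 0" "bdot P (hP \<mu> P) = 0" "u = hP \<mu> P"
    using nondeg_regular[OF H(1) u(3)] by blast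
  have "jmap H = refl u" unfolding H(2) by (rule jmap_hplane[OF on_cay_nz[OF H(1)]])
  moreover have "penJ u u \<noteq> 0" using u(3) by (auto simp: nondeg_def)
  ultimately have "pi_star (jmap H) = {X. mirror u X \<in> ell}" using pi_star_refl[OF H(1)] by simp
  then show "billiard_reflection a ell H l' \<Longrightarrow> pi_star (jmap H) = l'"
    using billiard_unique[OF P u(3)] H(2) by simp
  show "\<exists>!l'. billiard_reflection a ell H l'"
    using billiard_unique[OF P u(3)] billiard_lr[OF P u(3)] unfolding H(2) by blast
qed

end

section \<open>From an affine line to the homogeneous setting\<close>

lemma line_two_points:
  fixes l :: "(real ^ 'd::finite) set"
  assumes "affine l" "aff_dim l = 1"
  shows "\<exists>x y. x \<noteq> y \<and> l = affine hull {x, y}"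
proof -
  obtain B where B: "\<not> affine_dependent B" "B \<subseteq> l" "affine hull B = affine hull l"
    using affine_basis_exists by blast
  then have "of_nat (card B) = aff_dim l + 1" using aff_dim_unique by blast
  then have "card B = 2" using assms(2) by simp
  then obtain x y where "B = {x, y}" "x \<noteq> y" by (auto simp: card_2_iff)
  then show ?thesis using B(3) assms(1) by (metis affine_hull_eq)
qed

lemma proj_closure_line:
  "proj_closure (affine hull {x, y}) = vec.span {emb_pt x, emb_dir (cvec (y - x))}" (is "?l = ?r")
proof -
  have pc: "proj_closure S = vec.span (emb_pt ` S)" for S :: "(real ^ 'a) set"
    by (simp add: proj_closure_def emb_pt_def[abs_def])
  have "emb_pt z \<in> ?r" if z: "z \<in> affine hull {x, y}" for z
  proof -
    obtain s t where st: "z = s *\<^sub>R x + t *\<^sub>R y" "s + t = 1" using z unfolding affine_hull_2 by blast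
    have s: "s = 1 - t" using st(2) by simp
    have "emb_pt z = 1 *s emb_pt x + of_real t *s emb_dir (cvec (y - x))"
      unfolding st(1) s by (simp add: vec_eq_option_iff algebra_simps)
    then show ?thesis using span_2_iff by blast
  qed
  then have "?l \<subseteq> ?r" unfolding pc by (intro vec.span_minimal) auto
  moreover have "?r \<subseteq> ?l"
  proof -
    have x: "emb_pt x \<in> ?l" and y: "emb_pt y \<in> ?l"
      unfolding pc by (auto intro!: vec.span_base imageI hull_inc)
    have "emb_dir (cvec (y - x)) = emb_pt y - emb_pt x" by (simp add: vec_eq_option_iff)
    then have "emb_dir (cvec (y - x)) \<in> ?l" using x y unfolding pc by (simp add: vec.span_diff)
    then show ?thesis using x unfolding pc by (intro vec.span_minimal) auto
  qed
  ultimately show ?thesis by blast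
qed

theorem corollary3:
  fixes a :: "'d::finite \<Rightarrow> real" and \<alpha> :: "'m::finite \<Rightarrow> real"
    and l :: "(real ^ 'd) set" and L :: "(complex ^ ('d option + 'm)) set"
  assumes "CARD('m) + 1 = CARD('d)"
    and "inj a" and "inj \<alpha>" and "\<And>i j. \<alpha> j \<noteq> a i"
    and "affine l" and "aff_dim l = 1"
    and "\<And>j. line_tangent_to a (of_real (\<alpha> j)) (proj_closure l)"
    and "L \<in> F_set a \<alpha>" and "pi_star L = proj_closure l"
  shows "\<exists>j. birational_morphism hyperplane_coords pluecker_coords
               (cayley_curve a (proj_closure l)) (RDK_curve a \<alpha> L) j \<and>
             (\<exists>U. open_dense hyperplane_coords (cayley_curve a (proj_closure l)) U \<and>
                (\<forall>H\<in>U. (\<exists>!l'. billiard_reflection a (proj_closure l) H l') \<and>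
                   (\<forall>l'. billiard_reflection a (proj_closure l) H l' \<longrightarrow> pi_star (j H) = l')))"
proof -
  obtain x y where xy: "x \<noteq> y" "l = affine hull {x, y}" using line_two_points[OF assms(5,6)] by blast
  have pc: "proj_closure l = vec.span {emb_pt x, emb_dir (cvec (y - x))}"
    unfolding xy(2) by (rule proj_closure_line)
  interpret confocal_line a \<alpha> x "y - x" L
    by unfold_locales (use assms xy pc in auto)
  show ?thesis unfolding pc using birational_jmap open_dense_good_planes billiard_jmap by blast
qed

end
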